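(* Let $q\ge2$, let $b$ be a digital function in base $q$, and let $m'\in\mathbb{N}$ with $\gcd(q-1,m')=1$ and $\gcd\bigl(m',\gcd(\{b(n):n\in\mathbb{N}\})\bigr)=1$. For every integer $k\ge1$ and every $(\alpha_0,\dots,\alpha_{k-1})\in\{\frac0{m'},\frac1{m'},\dots,\frac{m'-1}{m'}\}^k$ with $(\alpha_0,\dots,\alpha_{k-1})\neq(0,\dots,0)$ there exist $\eta>0$ and $C>0$ such that for all $N\ge1$ $$\Bigl|\sum_{n<N}\exp\Bigl(2\pi i\sum_{\ell=0}^{k-1}\alpha_\ell\, b((n+\ell)^2)\Bigr)\Bigr|\le C\,N^{1-\eta}.$$
   Context: For an integer $n\ge 0$, $\varepsilon_j(n)\in\{0,\dots,q-1\}$ denotes the $j$-th base-$q$ digit of $n$, with $\varepsilon_j(n)=0$ for $j<0$. A function $b:\mathbb{N}\to\mathbb{N}$ is a digital function if there exist an integer $m\ge1$ and $F:\{0,\dots,q-1\}^m\to\mathbb{N}$ with $F(0,\dots,0)=0$ such that $b(n)=\sum_{j\in\mathbb{Z}}F(\varepsilon_{j+m-1}(n),\dots,\varepsilon_j(n))$. *)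

theory Defs
  imports Complex_Main "HOL-Library.Groups_Big_Fun"
begin

definition base_digit :: "nat \<Rightarrow> int \<Rightarrow> nat \<Rightarrow> nat" where
  "base_digit q j n = (if j < 0 then 0 else n div q ^ nat j mod q)"

text \<open>The list \<open>[\<epsilon>\<^sub>j\<^sub>+\<^sub>m\<^sub>-\<^sub>1(n), \<dots>, \<epsilon>\<^sub>j(n)]\<close>, most significant digit first.\<close>

definition digit_block :: "nat \<Rightarrow> nat \<Rightarrow> int \<Rightarrow> nat \<Rightarrow> nat list" where
  "digit_block q m j n = map (\<lambda>i. base_digit q (j + int m - 1 - int i) n) [0..<m]"

text \<open>
  A map \<open>{0,\<dots>,q-1}\<^sup>m \<rightarrow> \<nat>\<close> is rendered as a function on lists, which is
  only ever applied to lists of length \<open>m\<close> with entries below \<open>q\<close>. The sum over all integers \<open>j\<close>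
  has finite support for \<open>q \<ge> 2\<close> (lemma \<open>finite_digit_block_support\<close> below), so that
  \<^const>\<open>Sum_any\<close> is the intended sum.
\<close>

definition digital_function :: "nat \<Rightarrow> (nat \<Rightarrow> nat) \<Rightarrow> bool" where
  "digital_function q b \<longleftrightarrow>
     (\<exists>m \<ge> 1. \<exists>F :: nat list \<Rightarrow> nat. F (replicate m 0) = 0 \<and>
        (\<forall>n. b n = Sum_any (\<lambda>j :: int. F (digit_block q m j n))))"

lemma finite_digit_block_support:
  fixes F :: "nat list \<Rightarrow> nat"
  assumes "q \<ge> 2" and F0: "F (replicate m 0) = 0"
  shows "finite {j :: int. F (digit_block q m j n) \<noteq> 0}"
proof (rule finite_subset)
  show "{j :: int. F (digit_block q m j n) \<noteq> 0} \<subseteq> {- int m .. int n}"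
  proof (rule subsetI, rule ccontr)
    fix j assume j: "j \<in> {j :: int. F (digit_block q m j n) \<noteq> 0}" "j \<notin> {- int m .. int n}"
    have "base_digit q (j + int m - 1 - int i) n = 0" if "i < m" for i
    proof (cases "j < - int m")
      case True
      then show ?thesis by (simp add: base_digit_def)
    next
      case False
      define e where "e = nat (j + int m - 1 - int i)"
      have "n < e" using False j(2) that by (auto simp: e_def)
      also have "e < 2 ^ e" by (rule less_exp)
      also have "(2::nat) ^ e \<le> q ^ e" using assms(1) by (rule power_mono) simp
      finally show ?thesis by (simp add: base_digit_def e_def)
    qed
    then have "digit_block q m j n = replicate m 0"
      by (auto simp: digit_block_def intro!: nth_equalityI)
    with j(1) F0 show False by simp
  qed
qed simp

end

theory Submission
  imports Defs "HOL-Analysis.Convex" "HOL-Number_Theory.Cong"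
begin

text \<open>
  Write \<open>\<chi>\<^sub>l(x) = exp(2 \<pi> i \<alpha>\<^sub>l b(x))\<close> and \<open>f(n) = \<Prod>\<^sub>l \<chi>\<^sub>l((n + l)\<^sup>2)\<close>. Averaging \<open>f\<close> over the shifts
  \<open>r + s Q\<close>, where \<open>Q\<close> is a power of \<open>q\<close> slightly smaller than \<open>N\<close>, and applying Cauchy--Schwarz in \<open>r\<close>
  and in \<open>s\<close> leads to products of four values of \<open>f\<close>. In these the digits below \<open>Q\<close> cancel between \<open>s\<close> and
  \<open>s'\<close>, and up to rare carries the digits much above \<open>N\<close> cancel between \<open>r\<close> and \<open>r'\<close>: only a
  short window of digits around the size of \<open>N\<close> remains. For \<open>n\<close> in a short interval and in a
  residue class, everything but \<open>n\<^sup>2\<close> modulo a power \<open>M\<close> of \<open>q\<close> is then constant, and \<open>n\<^sup>2 + v\<close>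
  with small \<open>v\<close> is close to uniform modulo \<open>M\<close> by a second moment count. Averaging over
  the residue class decouples \<open>s\<close> from \<open>s'\<close>. What remains are sums of
  \<open>\<Prod>\<^sub>l \<chi>\<^sub>l(w + l D) \<chi>\<^sub>l(w + (t + l) D)\<^sup>*\<close> over \<open>w\<close>, with \<open>\<^sup>*\<close> the conjugate. Whenever a block of digits of \<open>D\<close> and of \<open>t D\<close>
  is such that in the corresponding block exactly one of the strands \<open>w + l D\<close>, among those with
  nontrivial \<open>\<chi>\<^sub>l\<close>, differs from the strands \<open>w + (t + l) D\<close>, swapping two block values
  of \<open>w\<close> multiplies the product by a fixed \<open>\<zeta> \<noteq> 1\<close>, which saves a constant factor.
  For random \<open>D\<close> a positive proportion of the blocks has this property, except with exponentially small
  probability. That \<open>\<zeta> \<noteq> 1\<close> can be achieved is exactly where the two gcd conditions enter: otherwise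
  \<open>\<chi>\<^sub>l(n) = \<theta>\<^sup>n\<close>, and \<open>b(q n) = b(n)\<close> forces \<open>\<theta> = 1\<close>.
\<close>

section \<open>Digital functions\<close>

text \<open>Since \<open>n^2\<close> has about twice as many digits as \<open>n\<close>, the window
  lies around digit \<open>\<nu>\<close>, where \<open>q ^ \<nu>\<close> is about \<open>N\<close>:
  a shift by \<open>r < q ^ p\<close> moves \<open>n^2\<close> by about \<open>N * q ^ p\<close> at
  most, and a shift by \<open>s * Q\<close> keeps it modulo \<open>Q\<close>. Two demands limit the
  upper end \<open>\<kappa>\<close>. The square \<open>(s * Q)^2\<close> has to vanish modulo
  \<open>q ^ \<kappa>\<close>, and the modulus \<open>A = q ^ \<kappa> / Q\<close>, which determines
  \<open>n * Q\<close> modulo \<open>q ^ \<kappa>\<close>, has to be small enough that progressions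
  of step \<open>A\<close> are long inside intervals on which \<open>2 * n * r\<close> varies by
  much less than \<open>q ^ \<mu>\<close>.

  The obstacle in decoupling \<open>s\<close> from \<open>s'\<close> is the common factor of
  \<open>2 * (s' - s)\<close> with powers of \<open>q\<close>. It divides \<open>q ^ i\<close> once
  \<open>2 * (s' - s) \<le> 2 ^ i\<close>; as \<open>s'\<close> runs up to \<open>q ^ p\<close>,
  \<open>i\<close> is taken of size \<open>q * p\<close>. This is where the terms
  \<open>q * p\<close> in the parameters come from. The remaining parameters are multiples of
  \<open>p = 2 * G * n\<close>, where \<open>n\<close> is the number of digit blocks available for
  swapping. All error terms are then exponentially small in \<open>n\<close>, and \<open>n\<close>
  is proportional to \<open>log N\<close>.\<close>

lemma sum_any_shift:
  fixes h :: "int \<Rightarrow> nat"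
  shows "Sum_any (\<lambda>j. h (j - c)) = Sum_any h"
proof -
  have "bij (\<lambda>j::int. j - c)"
    by (rule bij_betw_byWitness[where f' = "\<lambda>j. j + c"]) auto
  then show ?thesis
    by (intro Sum_any.reindex_cong[of "\<lambda>j. j - c", symmetric]) (auto simp: fun_eq_iff)
qed

lemma finite_support_shift:
  fixes h :: "int \<Rightarrow> nat"
  assumes "finite {j. h j \<noteq> 0}"
  shows "finite {j. h (j - c) \<noteq> 0}"
proof -
  have "{j. h (j - c) \<noteq> 0} = (\<lambda>j. j + c) ` {j. h j \<noteq> 0}"
    by (auto simp: image_iff) (metis diff_add_cancel)
  then show ?thesis using assms by simp
qed

lemma digit_block_cong:
  assumes "\<And>i. j \<le> i \<Longrightarrow> i < j + int m \<Longrightarrow> base_digit q i n = base_digit q (i + c) n'"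
  shows "digit_block q m j n = digit_block q m (j + c) n'"
  unfolding digit_block_def
proof (rule map_cong[OF refl])
  fix i assume "i \<in> set [0..<m]"
  then have "base_digit q (j + int m - 1 - int i) n = base_digit q (j + int m - 1 - int i + c) n'"
    by (intro assms) auto
  then show "base_digit q (j + int m - 1 - int i) n = base_digit q (j + c + int m - 1 - int i) n'"
    by (simp add: algebra_simps)
qed

lemma digit_block_zero:
  assumes "\<And>i. j \<le> i \<Longrightarrow> i < j + int m \<Longrightarrow> base_digit q i n = 0"
  shows "digit_block q m j n = replicate m 0"
  unfolding digit_block_def using assms by (intro nth_equalityI) auto

lemma base_digit_div:
  "base_digit q j (n div q ^ P) = (if j < 0 then 0 else base_digit q (j + int P) n)"
  by (simp add: base_digit_def div_mult2_eq[symmetric] power_add[symmetric] nat_add_distrib add.commute)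

lemma base_digit_mod_cong:
  assumes "n mod q ^ K = n' mod q ^ K" "j < int K"
  shows "base_digit q j n = base_digit q j n'"
proof (cases "j < 0")
  case False
  define i where "i = nat j"
  have *: "x div q ^ i mod q = (x mod q ^ K) div q ^ i mod q" for x
  proof -
    have "i < K" using assms False by (auto simp: i_def)
    then have K: "q ^ K = q ^ i * (q * q ^ (K - Suc i))"
      by (metis Suc_leI le_add_diff_inverse mult.assoc power_Suc power_add semiring_normalization_rules(28))
    show ?thesis unfolding K mod_mult2_eq
      by (cases "q = 0") (auto simp: mod_mult2_eq)
  qed
  show ?thesis using False *[of n] *[of n'] assms by (simp add: base_digit_def i_def)
qed (simp add: base_digit_def)

text \<open>In the fourth property, blocks starting at or above \<open>P\<close> contribute equally
  to \<open>b n\<close> and to \<open>b (n div q ^ P)\<close>. The other blocks of either number,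
  including those of \<open>n div q ^ P\<close> that start at negative positions, read only digits
  of \<open>n\<close> below \<open>P + m\<close>. In the fifth, the \<open>m\<close> digits of
  \<open>w\<close> below position \<open>B\<close> vanish, so no block meets nonzero digits of both
  \<open>x\<close> and \<open>w\<close>.\<close>

lemma digital_function_props:
  assumes q: "q \<ge> 2" and "digital_function q b"
  obtains m where "m \<ge> 1" "b 0 = 0" "\<And>n. b (q * n) = b n"
    "\<And>P n n'. n mod q ^ (P + m) = n' mod q ^ (P + m) \<Longrightarrow> b n + b (n' div q ^ P) = b n' + b (n div q ^ P)"
    "\<And>B x w. w * q ^ m < q ^ B \<Longrightarrow> b (x * q ^ B + w) = b x + b w"
proof -
  obtain m F where m: "m \<ge> 1" and F0: "F (replicate m 0) = (0::nat)"
    and b: "\<And>n. b n = Sum_any (\<lambda>j. F (digit_block q m j n))"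
    using assms unfolding digital_function_def by blast
  have fin: "finite {j. F (digit_block q m j n) \<noteq> 0}" for n
    using finite_digit_block_support[of q F m n] q F0 by simp
  have q0: "q > 0" using q by simp
  have zero: "F (digit_block q m j n) = 0" if "\<And>i. j \<le> i \<Longrightarrow> i < j + int m \<Longrightarrow> base_digit q i n = 0" for j n
    using digit_block_zero[of j m q n] that F0 by simp
  have 1: "b 0 = 0"
    unfolding b by (subst zero) (auto simp: base_digit_def)
  have 2: "b (q * n) = b n" for n
  proof -
    have "digit_block q m j (q * n) = digit_block q m (j - 1) n" for j
    proof -
      have "base_digit q i (q * n) = base_digit q (i + -1) n" for i
      proof (cases "i \<le> 0")
        case True
        then show ?thesis using q0 by (auto simp: base_digit_def)
      next
        case False
        then have "nat i = Suc (nat (i - 1))" by simp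
        then show ?thesis using q0 False by (simp add: base_digit_def div_mult2_eq)
      qed
      then show ?thesis using digit_block_cong[of j m q "q * n" "-1" n] by simp
    qed
    then show ?thesis unfolding b using sum_any_shift[of "\<lambda>j. F (digit_block q m j n)" 1] by simp
  qed
  have 3: "b n + b (n' div q ^ P) = b n' + b (n div q ^ P)"
    if eq: "n mod q ^ (P + m) = n' mod q ^ (P + m)" for P n n'
  proof -
    have s: "b (x div q ^ P) = Sum_any (\<lambda>j. F (digit_block q m (j - int P) (x div q ^ P)))" for x
      unfolding b using sum_any_shift[of "\<lambda>j. F (digit_block q m j (x div q ^ P))" "int P"] by simp
    have fs: "finite {j. F (digit_block q m (j - int P) (x div q ^ P)) \<noteq> 0}" for x
      by (rule finite_support_shift[OF fin])
    have hi: "digit_block q m (j - int P) (x div q ^ P) = digit_block q m j x" if "j \<ge> int P" for j x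
      using digit_block_cong[of "j - int P" m q "x div q ^ P" "int P" x] that
      by (simp add: base_digit_div)
    have lo1: "digit_block q m j n = digit_block q m j n'" if "j < int P" for j
      using digit_block_cong[of j m q n 0 n'] base_digit_mod_cong[OF eq] that by simp
    have lo2: "digit_block q m (j - int P) (n div q ^ P) = digit_block q m (j - int P) (n' div q ^ P)" if "j < int P" for j
      using digit_block_cong[of "j - int P" m q "n div q ^ P" 0 "n' div q ^ P"] base_digit_mod_cong[OF eq] that 
      by (simp add: base_digit_div)
    have "F (digit_block q m j n) + F (digit_block q m (j - int P) (n' div q ^ P))
        = F (digit_block q m j n') + F (digit_block q m (j - int P) (n div q ^ P))" for j
      by (cases "j < int P") (simp_all add: hi lo1 lo2)
    then show ?thesis unfolding s unfolding b
      by (simp only: Sum_any.distrib[OF fin fs, symmetric])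
  qed
  have 4: "b (x * q ^ B + w) = b x + b w" if w: "w * q ^ m < q ^ B" for B x w
  proof -
    have wB: "w < q ^ B"
      by (rule le_less_trans[OF _ w]) (use q0 in simp)
    have w0: "base_digit q i w = 0" if "i \<ge> int B - int m" for i
    proof (cases "i < 0")
      case False
      have "q ^ B \<le> q ^ (nat i + m)" using that False q0 by (intro power_increasing) auto
      with w have "w * q ^ m < q ^ (nat i + m)" by (rule less_le_trans)
      then have "w * q ^ m < q ^ nat i * q ^ m" by (simp only: power_add)
      then have "w < q ^ nat i" using mult_less_cancel2 by blast
      then show ?thesis by (simp add: base_digit_def)
    qed (simp add: base_digit_def)
    have lo: "base_digit q i (x * q ^ B + w) = base_digit q i w" if "i < int B" for i
      by (rule base_digit_mod_cong[of _ _ B]) (use that in auto)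
    have hi: "base_digit q i (x * q ^ B + w) = base_digit q (i - int B) x" if "i \<ge> int B" for i
    proof -
      have "(x * q ^ B + w) div q ^ B = x" using wB q0 by (metis add.commute add.right_neutral div_less div_mult_self1 less_nat_zero_code)
      then show ?thesis using base_digit_div[of q "i - int B" "x * q ^ B + w" B] that by simp
    qed
    have neg: "base_digit q i x = 0" if "i < 0" for i x using that by (simp add: base_digit_def)
    have "F (digit_block q m j (x * q ^ B + w))
        = F (digit_block q m (j - int B) x) + F (digit_block q m j w)" for j
    proof (cases "j \<le> int B - int m")
      case True
      have "F (digit_block q m (j - int B) x) = 0"
        by (rule zero) (use True in \<open>auto intro!: neg\<close>)
      moreover have "digit_block q m j (x * q ^ B + w) = digit_block q m j w"
        using digit_block_cong[of j m q "x * q ^ B + w" 0 w] True by (simp add: lo)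
      ultimately show ?thesis by simp
    next
      case False
      have "F (digit_block q m j w) = 0"
        by (rule zero) (use False in \<open>auto intro!: w0\<close>)
      moreover have "digit_block q m j (x * q ^ B + w) = digit_block q m (j + - int B) x"
      proof (rule digit_block_cong)
        fix i assume "j \<le> i" "i < j + int m"
        with False show "base_digit q i (x * q ^ B + w) = base_digit q (i + - int B) x"
          by (cases "i < int B") (auto simp: lo hi w0 neg)
      qed
      ultimately show ?thesis by simp
    qed
    then have "b (x * q ^ B + w)
        = Sum_any (\<lambda>j. F (digit_block q m (j - int B) x)) + Sum_any (\<lambda>j. F (digit_block q m j w))"
      unfolding b by (simp only: Sum_any.distrib[OF finite_support_shift[OF fin] fin])
    then show ?thesis unfolding b by (simp only: sum_any_shift[of "\<lambda>j. F (digit_block q m j x)"])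
  qed
  show thesis by (rule that[OF m 1 2 3 4])
qed

lemma eq_1_of_coprime_powers:
  fixes x :: complex
  assumes "x ^ a = 1" "x ^ b = 1" "coprime a b" "a > 0"
  shows "x = 1"
proof -
  obtain i j where "a * i = b * j + gcd a b" using bezout_nat[of a b] assms(4) by auto
  then have "a * i = b * j + 1" using assms(3) by simp
  then have "(x ^ a) ^ i = (x ^ b) ^ j * x"
    by (metis power_add power_mult power_one_right)
  then show ?thesis using assms by simp
qed

text \<open>The effect of adding \<open>q ^ m * \<delta>\<close> on the phase is to differ between
  \<open>u\<close> and \<open>u + 1\<close>; a carry from \<open>u\<close> to \<open>u + 1\<close>
  then becomes visible. Multiples of \<open>q ^ m\<close> are taken so that the \<open>m\<close>
  digits next to the lower part of a number stay unchanged. The first gcd condition gives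
  \<open>\<theta> = 1\<close>; the second then turns the divisibility of all \<open>a * b n\<close>
  by \<open>m'\<close> into \<open>m' dvd a\<close>.\<close>

lemma exists_nonlinear_phase:
  fixes b :: "nat \<Rightarrow> nat" and \<chi> :: "nat \<Rightarrow> complex"
  assumes q: "q \<ge> 2" and b0: "b 0 = 0" and bq: "\<And>n. b (q * n) = b n"
    and \<chi>: "\<And>x. \<chi> x = cis (2 * pi * (real a / real m') * real (b x))"
    and a: "0 < a" "a < m'" and g1: "gcd (q - 1) m' = 1" and g2: "gcd m' (Gcd (range b)) = 1"
  shows "\<exists>u \<delta>. \<delta> > 0 \<and> \<chi> (u + q ^ m * \<delta>) * \<chi> (u + 1) \<noteq> \<chi> u * \<chi> (u + 1 + q ^ m * \<delta>)"
proof (rule ccontr)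
  assume "\<not> ?thesis"
  then have eq: "\<chi> (u + q ^ m * \<delta>) * \<chi> (u + 1) = \<chi> u * \<chi> (u + 1 + q ^ m * \<delta>)" if "\<delta> > 0" for u \<delta>
    using that by blast
  have nz: "\<chi> x \<noteq> 0" for x by (simp add: \<chi>)
  have \<chi>0: "\<chi> 0 = 1" by (simp add: \<chi> b0)
  have \<chi>q: "\<chi> (q * n) = \<chi> n" for n by (simp add: \<chi> bq)
  have \<chi>qm: "\<chi> (q ^ i * n) = \<chi> n" for i n
    by (induction i) (auto simp: mult.assoc \<chi>q)
  define \<theta> where "\<theta> = \<chi> 1"
  have step: "\<chi> (n + q ^ m) = \<chi> n * \<theta>" for n
  proof (induction n)
    case 0
    then show ?case using \<chi>qm[of m 1] by (simp add: \<chi>0 \<theta>_def)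
  next
    case (Suc n)
    have "\<chi> (n + q ^ m) * \<chi> (n + 1) = \<chi> n * \<chi> (n + 1 + q ^ m)" using eq[of 1 n] by simp
    with Suc nz[of n] show ?case by (simp add: mult_ac)
  qed
  have "\<chi> (q ^ m * j) = \<theta> ^ j" for j
    by (induction j) (use step[of "q ^ m * _"] in \<open>auto simp: \<chi>0 algebra_simps\<close>)
  \<comment> \<open>The value at \<open>q ^ m * j\<close> is both \<open>\<theta> ^ j\<close> and,
    by invariance under multiplication by \<open>q\<close>, the value at \<open>j\<close>.\<close>
  then have pow: "\<chi> j = \<theta> ^ j" for j using \<chi>qm by metis
  have "\<theta> ^ q = \<theta>" using \<chi>q[of 1] pow[of q] by (simp add: \<theta>_def)
  moreover have "\<theta> ^ q = \<theta> ^ (q - 1) * \<theta>" using q by (metis One_nat_def Suc_1 Suc_le_D diff_Suc_1 power_Suc2)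
  ultimately have "\<theta> ^ (q - 1) = 1" using nz[of 1] by (simp add: \<theta>_def)
  moreover have "\<theta> ^ m' = 1"
  proof -
    have "\<theta> ^ m' = cis (real m' * (2 * pi * (real a / real m') * real (b 1)))"
      unfolding \<theta>_def \<chi> by (rule DeMoivre)
    also have "real m' * (2 * pi * (real a / real m') * real (b 1)) = 2 * pi * real (a * b 1)"
      using a by simp
    finally show ?thesis by (simp add: cis_multiple_2pi)
  qed
  ultimately have "\<theta> = 1"
    by (rule eq_1_of_coprime_powers) (use g1 q in \<open>auto simp: coprime_iff_gcd_eq_1\<close>)
  have "m' dvd a * b n" for n
  proof -
    have "cis (2 * pi * (real a / real m') * real (b n)) = 1" using pow[of n] \<open>\<theta> = 1\<close> by (simp add: \<chi>)
    then have "cos (2 * pi * (real a / real m') * real (b n)) = 1"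
      by (metis cis.simps(1) one_complex.simps(1))
    then obtain i :: int where "2 * pi * (real a / real m') * real (b n) = of_int i * 2 * pi"
      using cos_one_2pi_int by blast
    then have "real (a * b n) = of_int i * real m'" using a by (simp add: field_simps)
    then have "int (a * b n) = i * int m'"
      by (metis of_int_eq_iff of_int_mult of_int_of_nat_eq)
    then have "int m' dvd int (a * b n)" by simp
    then show ?thesis by (simp only: int_dvd_int_iff)
  qed
  then have "m' dvd Gcd ((*) a ` range b)" by (intro Gcd_greatest) auto
  then have "m' dvd a * Gcd (range b)" by (simp add: Gcd_mult)
  then have "m' dvd a" using g2 by (metis coprime_dvd_mult_left_iff coprime_iff_gcd_eq_1)
  then show False using a by (simp add: nat_dvd_not_less)
qed

section \<open>Averages over digits\<close>

lemma sum_swap3: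
  "(\<Sum>n\<in>N. \<Sum>a\<in>A. \<Sum>b\<in>B. h n a b) = (\<Sum>a\<in>A. \<Sum>b\<in>B. \<Sum>n\<in>N. h n a b)"
  by (simp only: sum.swap[where A = N])

lemma sum_swap5:
  "(\<Sum>n\<in>N. \<Sum>a\<in>A. \<Sum>b\<in>B. \<Sum>c\<in>C. \<Sum>d\<in>D. h n a b c d)
    = (\<Sum>a\<in>A. \<Sum>b\<in>B. \<Sum>c\<in>C. \<Sum>d\<in>D. \<Sum>n\<in>N. h n a b c d)"
  by (simp only: sum.swap[where A = N])

lemma div_add_mult_eq: "r < d \<Longrightarrow> (r + a * d) div d = a" for r d a :: nat
  by (cases "d = 0") simp_all

lemma sum_lessThan_mult:
  fixes f :: "nat \<Rightarrow> 'a::comm_monoid_add"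
  shows "(\<Sum>y<n * b. f y) = (\<Sum>i<n. \<Sum>j<b. f (i * b + j))"
proof -
  have "(\<Sum>j<b. f (i * b + j)) = sum f {i * b..<i * b + b}" for i
    using sum.shift_bounds_nat_ivl[of f 0 "i * b" b] by (simp add: add.commute atLeast0LessThan)
  then show ?thesis by (simp add: sum.nat_group)
qed

text \<open>At a marked position the terms with digits \<open>v1\<close> and \<open>v2\<close>
  combine to \<open>1 + \<zeta>\<close> times one of them. The lowest digit is summed out first:
  swaps at higher positions leave it alone, so the inner sum \<open>A'\<close> inherits their
  relations. The factor \<open>e\<close> stands for whatever lies above the \<open>I\<close>
  positions.\<close>

lemma digit_swap_bound:
  fixes A :: "nat \<Rightarrow> complex"
  assumes v: "v1 < v2" "v2 < b" and C: "\<And>y. cmod (A y) \<le> C"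
    and swap: "\<And>i y. i < I \<Longrightarrow> J i \<Longrightarrow> y div b ^ i mod b = v1 \<Longrightarrow> A (y + (v2 - v1) * b ^ i) = \<zeta> * A y"
  shows "cmod (\<Sum>y<b ^ I * e. A y)
     \<le> real e * C * (\<Prod>i<I. if J i then real b - 2 + cmod (1 + \<zeta>) else real b)"
  using C swap
proof (induction I arbitrary: A J C)
  case 0
  have "cmod (\<Sum>y<e. A y) \<le> (\<Sum>y<e. C)" by (intro sum_norm_le 0)
  then show ?case by simp
next
  case (Suc I)
  define A' where "A' y = (\<Sum>\<delta><b. A (y * b + \<delta>))" for y
  define c where "c = (if J 0 then real b - 2 + cmod (1 + \<zeta>) else real b)"
  have b0: "b > 0" using v by simp
  have bound: "cmod (A' y) \<le> c * C" for y
  proof (cases "J 0")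
    case True
    have eq: "A (y * b + v2) = \<zeta> * A (y * b + v1)"
    proof -
      have "y * b + v1 + (v2 - v1) * b ^ 0 = y * b + v2" using v by simp
      moreover have "A (y * b + v1 + (v2 - v1) * b ^ 0) = \<zeta> * A (y * b + v1)"
        by (rule Suc.prems(2)) (use True v in auto)
      ultimately show ?thesis by (simp only:)
    qed
    have "{..<b} = insert v1 (insert v2 ({..<b} - {v1, v2}))" using v by auto
    then have "A' y = A (y * b + v1) + (A (y * b + v2) + (\<Sum>\<delta>\<in>{..<b} - {v1, v2}. A (y * b + \<delta>)))"
      unfolding A'_def using v by (metis (no_types, lifting) Diff_iff finite_Diff finite_insert finite_lessThan insert_iff nat_neq_iff sum.insert)
    also have "\<dots> = (1 + \<zeta>) * A (y * b + v1) + (\<Sum>\<delta>\<in>{..<b} - {v1, v2}. A (y * b + \<delta>))"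
      by (simp only: eq) (simp add: algebra_simps)
    also have "cmod \<dots> \<le> cmod (1 + \<zeta>) * C + real (card ({..<b} - {v1, v2})) * C"
      by (intro norm_triangle_mono sum_norm_bound Suc.prems(1)) (simp add: norm_mult mult_left_mono Suc.prems(1))
    also have "card ({..<b} - {v1, v2}) = b - 2" using v by (subst card_Diff_subset) auto
    also have "real (b - 2) = real b - 2" using v by simp
    finally show ?thesis using True by (simp add: c_def algebra_simps)
  next
    case False
    have "cmod (A' y) \<le> real (card {..<b}) * C" unfolding A'_def by (intro sum_norm_bound Suc.prems(1))
    then show ?thesis using False by (simp add: c_def)
  qed
  have "(\<Sum>y<b ^ Suc I * e. A y) = (\<Sum>y<(b ^ I * e) * b. A y)" by (simp add: mult_ac)
  also have "\<dots> = (\<Sum>y<b ^ I * e. A' y)" unfolding A'_def by (rule sum_lessThan_mult)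
  also have "cmod \<dots> \<le> real e * (c * C) * (\<Prod>i<I. if J (Suc i) then real b - 2 + cmod (1 + \<zeta>) else real b)"
  proof (rule Suc.IH[OF bound])
    fix i y assume i: "i < I" "J (Suc i)" "y div b ^ i mod b = v1"
    have "A ((y + (v2 - v1) * b ^ i) * b + \<delta>) = \<zeta> * A (y * b + \<delta>)" if "\<delta> < b" for \<delta>
    proof -
      have "(y * b + \<delta>) div b ^ Suc i mod b = v1" using i that by (simp add: div_mult2_eq)
      then have "A (y * b + \<delta> + (v2 - v1) * b ^ Suc i) = \<zeta> * A (y * b + \<delta>)"
        by (intro Suc.prems(2)) (use i in auto)
      then show ?thesis by (simp add: algebra_simps)
    qed
    then show "A' (y + (v2 - v1) * b ^ i) = \<zeta> * A' y"
      unfolding A'_def sum_distrib_left by (intro sum.cong) auto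
  qed
  also have "\<dots> = real e * C * (c * (\<Prod>i<I. if J (Suc i) then real b - 2 + cmod (1 + \<zeta>) else real b))"
    by simp
  finally show ?case by (simp add: prod.lessThan_Suc_shift c_def del: prod.lessThan_Suc)
qed

text \<open>The factor \<open>\<phi> i\<close> sees all digits from position \<open>i\<close>
  upwards, so only \<open>\<phi> 0\<close> involves the lowest digit, and that digit can be averaged
  first. Accordingly the bound for the average over one digit is uniform in the digits above
  it.\<close>

lemma digit_average_bound:
  fixes \<phi> :: "nat \<Rightarrow> nat \<Rightarrow> real"
  assumes b: "b > 0" and "\<And>i z. \<phi> i z \<ge> 0"
    and "\<And>i z. i < I \<Longrightarrow> (\<Sum>\<delta><b. \<phi> i (z * b + \<delta>)) \<le> real b * c i"
  shows "(\<Sum>z<b ^ I * e. \<Prod>i<I. \<phi> i (z div b ^ i)) \<le> real e * (\<Prod>i<I. real b * c i)"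
  using assms(2,3)
proof (induction I arbitrary: \<phi> c)
  case 0
  then show ?case by simp
next
  case (Suc I)
  have c0: "real b * c i \<ge> 0" if "i < Suc I" for i
    using Suc.prems(2)[OF that, of 0] sum_nonneg[of "{..<b}" "\<lambda>\<delta>. \<phi> i (0 * b + \<delta>)"] Suc.prems(1) by fastforce
  have "(\<Sum>z<b ^ Suc I * e. \<Prod>i<Suc I. \<phi> i (z div b ^ i)) = (\<Sum>z<(b ^ I * e) * b. \<Prod>i<Suc I. \<phi> i (z div b ^ i))"
    by (simp add: mult_ac)
  also have "\<dots> = (\<Sum>z<b ^ I * e. \<Sum>\<delta><b. \<Prod>i<Suc I. \<phi> i ((z * b + \<delta>) div b ^ i))"
    by (rule sum_lessThan_mult)
  also have "\<dots> = (\<Sum>z<b ^ I * e. \<Sum>\<delta><b. \<phi> 0 (z * b + \<delta>) * (\<Prod>i<I. \<phi> (Suc i) (z div b ^ i)))"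
    using b by (intro sum.cong refl) (simp add: prod.lessThan_Suc_shift div_mult2_eq del: prod.lessThan_Suc)
  also have "\<dots> = (\<Sum>z<b ^ I * e. (\<Sum>\<delta><b. \<phi> 0 (z * b + \<delta>)) * (\<Prod>i<I. \<phi> (Suc i) (z div b ^ i)))"
    by (simp add: sum_distrib_right)
  also have "\<dots> \<le> (\<Sum>z<b ^ I * e. (real b * c 0) * (\<Prod>i<I. \<phi> (Suc i) (z div b ^ i)))"
    by (intro sum_mono mult_right_mono Suc.prems prod_nonneg) auto
  also have "\<dots> = (real b * c 0) * (\<Sum>z<b ^ I * e. \<Prod>i<I. \<phi> (Suc i) (z div b ^ i))"
    by (simp add: sum_distrib_left)
  also have "\<dots> \<le> (real b * c 0) * (real e * (\<Prod>i<I. real b * c (Suc i)))"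
    by (intro mult_left_mono Suc.IH[of "\<lambda>i. \<phi> (Suc i)" "\<lambda>i. c (Suc i)"] c0 Suc.prems) auto
  also have "\<dots> = real e * (\<Prod>i<Suc I. real b * c i)"
    by (simp add: prod.lessThan_Suc_shift del: prod.lessThan_Suc)
  finally show ?case .
qed

section \<open>Differencing\<close>

lemma cmod_sum_squared:
  fixes x :: "'a \<Rightarrow> complex"
  shows "complex_of_real ((cmod (\<Sum>i\<in>A. x i))\<^sup>2) = (\<Sum>i\<in>A. \<Sum>j\<in>A. x i * cnj (x j))"
  by (simp only: complex_norm_square cnj_sum sum_product)

lemma cmod_sum_squared_le:
  fixes x :: "'a \<Rightarrow> complex"
  assumes "finite A"
  shows "(cmod (\<Sum>i\<in>A. x i))\<^sup>2 \<le> real (card A) * (\<Sum>i\<in>A. (cmod (x i))\<^sup>2)"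
proof -
  have "(cmod (\<Sum>i\<in>A. x i))\<^sup>2 \<le> (\<Sum>i\<in>A. cmod (x i))\<^sup>2"
    by (intro power_mono norm_sum) simp
  also have "\<dots> \<le> real (card A) * (\<Sum>i\<in>A. (cmod (x i))\<^sup>2)"
    using sum_squared_le_sum_of_squares[of "\<lambda>i. cmod (x i)" A] assms by (simp add: mult.commute)
  finally show ?thesis .
qed

text \<open>Cauchy--Schwarz over \<open>r\<close>, then over the pairs \<open>(s, s')\<close>. The
  quadruple sum \<open>K\<close> equals the sum of the squared moduli of the correlations
  \<open>V s s'\<close>, hence it is real and \<open>Re\<close> loses nothing.\<close>

lemma box_cauchy_schwarz:
  fixes a :: "nat \<Rightarrow> nat \<Rightarrow> complex" and R S :: nat
  defines "K \<equiv> (\<Sum>s<S. \<Sum>s'<S. \<Sum>r<R. \<Sum>r'<R. a r s * cnj (a r' s) * cnj (a r s') * a r' s')"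
  shows "(cmod (\<Sum>r<R. \<Sum>s<S. a r s)) ^ 4 \<le> (real R)\<^sup>2 * (real S)\<^sup>2 * Re K"
proof -
  define V where "V s s' = (\<Sum>r<R. a r s * cnj (a r s'))" for s s'
  have K: "K = complex_of_real (\<Sum>s<S. \<Sum>s'<S. (cmod (V s s'))\<^sup>2)"
    unfolding K_def V_def of_real_sum cmod_sum_squared by (simp add: mult_ac)
  have "complex_of_real (\<Sum>r<R. (cmod (\<Sum>s<S. a r s))\<^sup>2) = (\<Sum>r<R. \<Sum>s<S. \<Sum>s'<S. a r s * cnj (a r s'))"
    unfolding of_real_sum cmod_sum_squared ..
  also have "\<dots> = (\<Sum>s<S. \<Sum>r<R. \<Sum>s'<S. a r s * cnj (a r s'))" by (rule sum.swap)
  also have "\<dots> = (\<Sum>s<S. \<Sum>s'<S. V s s')"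
    unfolding V_def by (intro sum.cong refl sum.swap)
  also have "\<dots> = (\<Sum>(s, s')\<in>{..<S} \<times> {..<S}. V s s')" by (simp add: sum.cartesian_product)
  finally have eq: "complex_of_real (\<Sum>r<R. (cmod (\<Sum>s<S. a r s))\<^sup>2) = (\<Sum>(s, s')\<in>{..<S} \<times> {..<S}. V s s')" .
  have "(\<Sum>r<R. (cmod (\<Sum>s<S. a r s))\<^sup>2)\<^sup>2 = (cmod (\<Sum>(s, s')\<in>{..<S} \<times> {..<S}. V s s'))\<^sup>2"
    unfolding eq[symmetric] norm_of_real by simp
  also have "\<dots> \<le> real (card ({..<S} \<times> {..<S})) * (\<Sum>p\<in>{..<S} \<times> {..<S}. (cmod (case p of (s, s') \<Rightarrow> V s s'))\<^sup>2)"
    by (rule cmod_sum_squared_le) auto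
  also have "\<dots> = (real S)\<^sup>2 * Re K"
    by (simp add: K sum.cartesian_product power2_eq_square case_prod_unfold)
  finally have 1: "(\<Sum>r<R. (cmod (\<Sum>s<S. a r s))\<^sup>2)\<^sup>2 \<le> (real S)\<^sup>2 * Re K" .
  have "(cmod (\<Sum>r<R. \<Sum>s<S. a r s)) ^ 4 = ((cmod (\<Sum>r<R. \<Sum>s<S. a r s))\<^sup>2)\<^sup>2" by simp
  also have "\<dots> \<le> (real R * (\<Sum>r<R. (cmod (\<Sum>s<S. a r s))\<^sup>2))\<^sup>2"
    using cmod_sum_squared_le[of "{..<R}" "\<lambda>r. \<Sum>s<S. a r s"] by (intro power_mono) auto
  also have "\<dots> \<le> (real R)\<^sup>2 * ((real S)\<^sup>2 * Re K)"
    using 1 by (simp add: power_mult_distrib mult_left_mono)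
  finally show ?thesis by (simp add: mult_ac)
qed

lemma sum_fourth_power_le:
  fixes x :: "nat \<Rightarrow> real"
  shows "(\<Sum>n<N. x n) ^ 4 \<le> (real N) ^ 3 * (\<Sum>n<N. x n ^ 4)"
proof -
  have cs: "(\<Sum>n<N. y n)\<^sup>2 \<le> real N * (\<Sum>n<N. (y n)\<^sup>2)" for y :: "nat \<Rightarrow> real"
    using sum_squared_le_sum_of_squares[of y "{..<N}"] by (simp add: mult.commute)
  have "(\<Sum>n<N. x n) ^ 4 = ((\<Sum>n<N. x n)\<^sup>2)\<^sup>2" by simp
  also have "\<dots> \<le> (real N * (\<Sum>n<N. (x n)\<^sup>2))\<^sup>2" by (intro power_mono cs) auto
  also have "\<dots> = (real N)\<^sup>2 * (\<Sum>n<N. (x n)\<^sup>2)\<^sup>2" by (simp add: power_mult_distrib)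
  also have "\<dots> \<le> (real N)\<^sup>2 * (real N * (\<Sum>n<N. ((x n)\<^sup>2)\<^sup>2))" by (intro mult_left_mono cs) auto
  finally show ?thesis by (simp add: power2_eq_square power3_eq_cube power4_eq_xxxx mult_ac)
qed

lemma sum_shift_diff:
  fixes f :: "nat \<Rightarrow> complex"
  assumes f: "\<And>n. cmod (f n) \<le> 1"
  shows "cmod ((\<Sum>n<N. f n) - (\<Sum>n<N. f (n + j))) \<le> 2 * real j"
proof -
  have a: "(\<Sum>n<N. f (n + j)) = (\<Sum>n\<in>{j..<N + j}. f n)"
    using sum.shift_bounds_nat_ivl[of f 0 j N] by (simp add: atLeast0LessThan)
  have b: "(\<Sum>n<N + j. f n) = (\<Sum>n<j. f n) + (\<Sum>n\<in>{j..<N + j}. f n)"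
    using sum.atLeastLessThan_concat[of 0 j "N + j" f] by (simp add: atLeast0LessThan)
  have c: "(\<Sum>n<N + j. f n) = (\<Sum>n<N. f n) + (\<Sum>n\<in>{N..<N + j}. f n)"
    using sum.atLeastLessThan_concat[of 0 N "N + j" f] by (simp add: atLeast0LessThan)
  have "(\<Sum>n<N. f n) - (\<Sum>n<N. f (n + j)) = (\<Sum>n<j. f n) - (\<Sum>n\<in>{N..<N + j}. f n)"
    unfolding a using b c by (simp add: algebra_simps)
  also have "cmod \<dots> \<le> cmod (\<Sum>n<j. f n) + cmod (\<Sum>n\<in>{N..<N + j}. f n)" by (rule norm_triangle_ineq4)
  also have "\<dots> \<le> real (card {..<j}) * 1 + real (card {N..<N + j}) * 1"
    by (intro add_mono sum_norm_bound f)
  finally show ?thesis by simp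
qed

text \<open>Pairs with \<open>r\<close>, \<open>r'\<close> closer than \<open>T0\<close> or with
  \<open>s = s'\<close> are estimated trivially and account for the first two terms in the bound by
  \<open>X ^ 4\<close>. All other pairs reduce to \<open>r < r'\<close> and \<open>s < s'\<close>,
  because exchanging \<open>r\<close> with \<open>r'\<close> or \<open>s\<close> with
  \<open>s'\<close> conjugates the fourfold product. The summand \<open>2 * (R + S * Q)\<close> pays
  for shifting the range of summation.\<close>

lemma box_bound:
  fixes f :: "nat \<Rightarrow> complex" and N R S Q T0 :: nat and \<epsilon> X :: real
  assumes f: "\<And>n. cmod (f n) \<le> 1" and RS: "R > 0" "S > 0"
    and off: "\<And>r r' s s'. r + T0 \<le> r' \<Longrightarrow> r < r' \<Longrightarrow> r' < R \<Longrightarrow> s < s' \<Longrightarrow> s' < S \<Longrightarrow>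
      cmod (\<Sum>n<N. f (n + r + s * Q) * cnj (f (n + r' + s * Q)) * cnj (f (n + r + s' * Q)) * f (n + r' + s' * Q))
        \<le> real N * \<epsilon>"
    and \<epsilon>: "\<epsilon> \<ge> 0" and X: "X \<ge> 0" "2 * real T0 / real R + 1 / real S + \<epsilon> \<le> X ^ 4" and T0: "T0 > 0"
  shows "cmod (\<Sum>n<N. f n) \<le> 2 * (real R + real S * real Q) + real N * X"
proof -
  define P where "P r r' s s' = cmod (\<Sum>n<N. f (n + r + s * Q) * cnj (f (n + r' + s * Q)) *
      cnj (f (n + r + s' * Q)) * f (n + r' + s' * Q))" for r r' s s'
  have Ptriv: "P r r' s s' \<le> real N" for r r' s s'
  proof -
    have "P r r' s s' \<le> real (card {..<N}) * 1"
      unfolding P_def by (intro sum_norm_bound) (simp add: norm_mult mult_le_one f)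
    then show ?thesis by simp
  qed
  have Pr: "P r r' s s' = P r' r s s'" for r r' s s'
  proof -
    have "P r' r s s' = cmod (cnj (\<Sum>n<N. f (n + r + s * Q) * cnj (f (n + r' + s * Q)) *
      cnj (f (n + r + s' * Q)) * f (n + r' + s' * Q)))"
      unfolding P_def by (simp add: mult_ac)
    then show ?thesis unfolding complex_mod_cnj P_def by simp
  qed
  have Ps: "P r r' s s' = P r r' s' s" for r r' s s'
  proof -
    have "P r r' s' s = cmod (cnj (\<Sum>n<N. f (n + r + s * Q) * cnj (f (n + r' + s * Q)) *
      cnj (f (n + r + s' * Q)) * f (n + r' + s' * Q)))"
      unfolding P_def by (simp add: mult_ac)
    then show ?thesis unfolding complex_mod_cnj P_def by simp
  qed
  have Pbound: "P r r' s s' \<le> real N * ((if r < r' + T0 \<and> r' < r + T0 then 1 else 0) + (if s = s' then 1 else 0) + \<epsilon>)"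
    if "r < R" "r' < R" "s < S" "s' < S" for r r' s s'
  proof -
    have main: "P r r' s s' \<le> real N * \<epsilon>" if "r + T0 \<le> r'" "r' < R" "s < s'" "s' < S" for r r' s s'
      unfolding P_def using off[of r r' s s'] that T0 by simp
    consider "r < r' + T0 \<and> r' < r + T0" | "s = s'" | "\<not> (r < r' + T0 \<and> r' < r + T0)" "s \<noteq> s'" by blast
    then show ?thesis
    proof cases
      case 1
      have "real N * 1 \<le> real N * ((if r < r' + T0 \<and> r' < r + T0 then 1 else 0) + (if s = s' then 1 else 0) + \<epsilon>)"
        using 1 \<epsilon> by (intro mult_left_mono) auto
      then show ?thesis using Ptriv[of r r' s s'] by simp
    next
      case 2
      have "real N * 1 \<le> real N * ((if r < r' + T0 \<and> r' < r + T0 then 1 else 0) + (if s = s' then 1 else 0) + \<epsilon>)"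
        using 2 \<epsilon> by (intro mult_left_mono) auto
      then show ?thesis using Ptriv[of r r' s s'] by simp
    next
      case 3
      have "P r r' s s' \<le> real N * \<epsilon>"
      proof (cases "r < r'")
        case True
        then show ?thesis using 3 that Ps[of r r' s s'] main[of r r' s s'] main[of r r' s' s] by (cases "s < s'") auto
      next
        case False
        then show ?thesis using 3 that Ps[of r r' s s'] Pr[of r r' s s'] Pr[of r r' s' s] main[of r' r s s'] main[of r' r s' s] 
          by (cases "s < s'") auto
      qed
      then show ?thesis using 3 by auto
    qed
  qed
  have cnt: "(\<Sum>r<R. \<Sum>r'<R. if r < r' + T0 \<and> r' < r + T0 then 1 else 0 :: real) \<le> real R * (2 * real T0)"
  proof -
    have "(\<Sum>r'<R. if r < r' + T0 \<and> r' < r + T0 then 1 else 0 :: real) \<le> 2 * real T0" for r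
    proof -
      have "(\<Sum>r'<R. if r < r' + T0 \<and> r' < r + T0 then 1 else 0 :: real) = real (card {r' \<in> {..<R}. r < r' + T0 \<and> r' < r + T0})"
        by (simp add: sum.If_cases Int_def)
      also have "card {r' \<in> {..<R}. r < r' + T0 \<and> r' < r + T0} \<le> card {r - T0..<r + T0}"
        by (intro card_mono) auto
      also have "\<dots> \<le> 2 * T0" by simp
      finally show ?thesis by simp
    qed
    then have "(\<Sum>r<R. \<Sum>r'<R. if r < r' + T0 \<and> r' < r + T0 then 1 else 0 :: real) \<le> (\<Sum>r<R. 2 * real T0)"
      by (intro sum_mono)
    then show ?thesis by simp
  qed
  have "(\<Sum>s<S. \<Sum>s'<S. \<Sum>r<R. \<Sum>r'<R. P r r' s s')
      \<le> (\<Sum>s<S. \<Sum>s'<S. \<Sum>r<R. \<Sum>r'<R. real N * ((if r < r' + T0 \<and> r' < r + T0 then 1 else 0) + (if s = s' then 1 else 0) + \<epsilon>))"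
    by (intro sum_mono Pbound) auto
  also have "\<dots> = real N * ((real S)\<^sup>2 * (\<Sum>r<R. \<Sum>r'<R. if r < r' + T0 \<and> r' < r + T0 then 1 else 0 :: real)
       + (real R)\<^sup>2 * real S + (real R)\<^sup>2 * (real S)\<^sup>2 * \<epsilon>)"
    by (simp add: sum_distrib_left[symmetric] sum.distrib power2_eq_square algebra_simps)
  also have "\<dots> \<le> real N * ((real S)\<^sup>2 * (real R * (2 * real T0)) + (real R)\<^sup>2 * real S + (real R)\<^sup>2 * (real S)\<^sup>2 * \<epsilon>)"
    by (intro mult_left_mono add_right_mono cnt) auto
  also have "\<dots> = real N * ((real R)\<^sup>2 * (real S)\<^sup>2 * (2 * real T0 / real R + 1 / real S + \<epsilon>))"
    using RS by (simp add: field_simps power2_eq_square)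
  also have "\<dots> \<le> real N * ((real R)\<^sup>2 * (real S)\<^sup>2 * X ^ 4)" by (intro mult_left_mono X) auto
  finally have Psum: "(\<Sum>s<S. \<Sum>s'<S. \<Sum>r<R. \<Sum>r'<R. P r r' s s') \<le> real N * ((real R)\<^sup>2 * (real S)\<^sup>2 * X ^ 4)" .

  define B where "B n = (\<Sum>r<R. \<Sum>s<S. f (n + r + s * Q))" for n
  define K where "K n = (\<Sum>s<S. \<Sum>s'<S. \<Sum>r<R. \<Sum>r'<R. f (n + r + s * Q) * cnj (f (n + r' + s * Q)) *
      cnj (f (n + r + s' * Q)) * f (n + r' + s' * Q))" for n
  have "(\<Sum>n<N. Re (K n)) = Re (\<Sum>n<N. K n)" by simp
  also have "\<dots> \<le> cmod (\<Sum>n<N. K n)" by (rule complex_Re_le_cmod)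
  also have "(\<Sum>n<N. K n) = (\<Sum>s<S. \<Sum>s'<S. \<Sum>r<R. \<Sum>r'<R. \<Sum>n<N. f (n + r + s * Q) * cnj (f (n + r' + s * Q)) *
      cnj (f (n + r + s' * Q)) * f (n + r' + s' * Q))"
    unfolding K_def by (rule sum_swap5)
  also have "cmod \<dots> \<le> (\<Sum>s<S. \<Sum>s'<S. \<Sum>r<R. \<Sum>r'<R. P r r' s s')"
    unfolding P_def by (intro sum_norm_le order_refl)
  finally have K: "(\<Sum>n<N. Re (K n)) \<le> real N * ((real R)\<^sup>2 * (real S)\<^sup>2 * X ^ 4)" using Psum by simp
  have "(\<Sum>n<N. cmod (B n)) ^ 4 \<le> (real N) ^ 3 * (\<Sum>n<N. cmod (B n) ^ 4)" by (rule sum_fourth_power_le)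
  also have "\<dots> \<le> (real N) ^ 3 * (\<Sum>n<N. (real R)\<^sup>2 * (real S)\<^sup>2 * Re (K n))"
    unfolding B_def K_def by (intro mult_left_mono sum_mono box_cauchy_schwarz) auto
  also have "\<dots> = (real N) ^ 3 * ((real R)\<^sup>2 * (real S)\<^sup>2 * (\<Sum>n<N. Re (K n)))"
    by (simp add: sum_distrib_left)
  also have "\<dots> \<le> (real N) ^ 3 * ((real R)\<^sup>2 * (real S)\<^sup>2 * (real N * ((real R)\<^sup>2 * (real S)\<^sup>2 * X ^ 4)))"
    by (intro mult_left_mono K) auto
  also have "\<dots> = (real N * (real R * real S * X)) ^ 4"
    by (simp add: power2_eq_square power3_eq_cube power4_eq_xxxx mult_ac)
  finally have "(\<Sum>n<N. cmod (B n)) \<le> real N * (real R * real S * X)"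
    using X RS by (subst (asm) power_mono_iff) (auto intro!: sum_nonneg)
  then have Bsum: "cmod (\<Sum>n<N. B n) \<le> real N * (real R * real S * X)"
    using norm_sum[of B "{..<N}"] by linarith
  have "(\<Sum>n<N. B n) = (\<Sum>r<R. \<Sum>s<S. \<Sum>n<N. f (n + (r + s * Q)))"
    unfolding B_def by (subst sum_swap3) (simp add: add.assoc)
  then have "of_nat (R * S) * (\<Sum>n<N. f n) - (\<Sum>n<N. B n) = (\<Sum>r<R. \<Sum>s<S. (\<Sum>n<N. f n) - (\<Sum>n<N. f (n + (r + s * Q))))"
    by (simp add: sum_subtractf mult_ac)
  also have "cmod \<dots> \<le> (\<Sum>r<R. \<Sum>s<S. 2 * real (r + s * Q))"
    by (intro sum_norm_le sum_shift_diff f)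
  also have "\<dots> \<le> (\<Sum>r<R. \<Sum>s<S. 2 * (real R + real S * real Q))"
    by (intro sum_mono mult_left_mono) (auto intro!: add_mono mult_right_mono)
  also have "\<dots> = real R * real S * (2 * (real R + real S * real Q))" by simp
  finally have "cmod (of_nat (R * S) * (\<Sum>n<N. f n) - (\<Sum>n<N. B n)) \<le> real R * real S * (2 * (real R + real S * real Q))" .
  then have "cmod (of_nat (R * S) * (\<Sum>n<N. f n)) \<le> real R * real S * (2 * (real R + real S * real Q)) + real N * (real R * real S * X)"
    using Bsum norm_triangle_sub[of "of_nat (R * S) * (\<Sum>n<N. f n)" "\<Sum>n<N. B n"] by linarith
  then have "real R * real S * cmod (\<Sum>n<N. f n) \<le> real R * real S * (2 * (real R + real S * real Q) + real N * X)"
    by (simp add: norm_mult algebra_simps)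
  then show ?thesis using RS by (simp add: mult_le_cancel_left)
qed

section \<open>Squares in short progressions\<close>

lemma card_residue_le:
  fixes d M L c :: nat
  assumes "M > 0"
  shows "card {y \<in> {..<L}. (d + y) mod M = c} \<le> L div M + 1"
proof -
  have "inj_on (\<lambda>y. y div M) {y \<in> {..<L}. (d + y) mod M = c}"
  proof (rule inj_onI)
    fix x y assume x: "x \<in> {y \<in> {..<L}. (d + y) mod M = c}" and y: "y \<in> {y \<in> {..<L}. (d + y) mod M = c}"
      and eq: "x div M = y div M"
    have "(d + x) mod M = (d + y) mod M" using x y by simp
    then have "x mod M = y mod M"
      by (simp only: cong_def[symmetric] cong_add_lcancel_nat)
    with eq show "x = y" by (metis div_mult_mod_eq)
  qed
  then have "card {y \<in> {..<L}. (d + y) mod M = c} = card ((\<lambda>y. y div M) ` {y \<in> {..<L}. (d + y) mod M = c})"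
    by (simp add: card_image)
  also have "\<dots> \<le> card {..L div M}"
    by (intro card_mono) (auto intro: div_le_mono)
  finally show ?thesis by simp
qed

text \<open>Count by \<open>y = g * t + v\<close>: it satisfies one congruence modulo
  \<open>M\<close>, and for given \<open>y\<close> the value of \<open>t\<close> lies within
  \<open>L div g\<close> below \<open>y div g\<close>.\<close>

lemma card_progression_window:
  fixes d g M T L c :: nat
  assumes "M > 0" "g > 0"
  shows "card {(t, v) \<in> {..<T} \<times> {..<L}. (d + g * t + v) mod M = c}
     \<le> ((g * T + L) div M + 1) * (L div g + 1)"
proof -
  let ?S = "{(t, v) \<in> {..<T} \<times> {..<L}. (d + g * t + v) mod M = c}"
  let ?Y = "{y \<in> {..<g * T + L}. (d + y) mod M = c}"
  let ?T = "\<lambda>y. {y div g - L div g..y div g}"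
  have "inj_on (\<lambda>(t, v). (g * t + v, t)) ?S" by (auto simp: inj_on_def)
  then have "card ?S = card ((\<lambda>(t, v). (g * t + v, t)) ` ?S)" by (simp add: card_image)
  also have "\<dots> \<le> card (Sigma ?Y ?T)"
  proof (intro card_mono subsetI)
    show "finite (Sigma ?Y ?T)" by auto
    fix p assume "p \<in> (\<lambda>(t, v). (g * t + v, t)) ` ?S"
    then obtain t v where p: "p = (g * t + v, t)" and t: "t < T" and v: "v < L" and c: "(d + g * t + v) mod M = c"
      by auto
    have "g * t + v < g * T + L" using t v by (intro add_le_less_mono) auto
    moreover have "t \<le> (g * t + v) div g" using assms by simp
    moreover have "(g * t + v) div g \<le> t + L div g" using assms v by (simp add: div_le_mono)
    ultimately show "p \<in> Sigma ?Y ?T" using c by (auto simp: p add.assoc)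
  qed
  also have "\<dots> = (\<Sum>y\<in>?Y. card (?T y))" by simp
  also have "\<dots> \<le> (\<Sum>y\<in>?Y. L div g + 1)" by (intro sum_mono) auto
  also have "\<dots> = card ?Y * (L div g + 1)" by simp
  also have "\<dots> \<le> ((g * T + L) div M + 1) * (L div g + 1)"
    by (intro mult_right_mono card_residue_le assms) auto
  finally show ?thesis .
qed

lemma sum_square_symmetric:
  fixes W :: "nat \<Rightarrow> nat \<Rightarrow> real"
  assumes "\<And>t t'. W t t' = W t' t"
  shows "(\<Sum>t<T. \<Sum>t'<T. W t t') = (\<Sum>t<T. W t t) + 2 * (\<Sum>u<T. \<Sum>t<T - Suc u. W (t + Suc u) t)"
proof (induction T)
  case (Suc T)
  have "(\<Sum>u<Suc T. \<Sum>t<Suc T - Suc u. W (t + Suc u) t) = (\<Sum>u<T. \<Sum>t<T - u. W (t + Suc u) t)" by simp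
  also have "\<dots> = (\<Sum>u<T. (\<Sum>t<T - Suc u. W (t + Suc u) t) + W T (T - Suc u))"
  proof (intro sum.cong refl)
    fix u assume "u \<in> {..<T}"
    then have "T - u = Suc (T - Suc u)" "T - Suc u + Suc u = T" by auto
    then show "(\<Sum>t<T - u. W (t + Suc u) t) = (\<Sum>t<T - Suc u. W (t + Suc u) t) + W T (T - Suc u)"
      by (simp del: add_Suc_right)
  qed
  also have "\<dots> = (\<Sum>u<T. \<Sum>t<T - Suc u. W (t + Suc u) t) + (\<Sum>t<T. W T t)"
    by (simp add: sum.distrib sum.nat_diff_reindex[of "\<lambda>t. W T t"])
  finally have *: "(\<Sum>u<Suc T. \<Sum>t<Suc T - Suc u. W (t + Suc u) t) =
    (\<Sum>u<T. \<Sum>t<T - Suc u. W (t + Suc u) t) + (\<Sum>t<T. W T t)" .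
  have "(\<Sum>t<T. W t T) = (\<Sum>t<T. W T t)" using assms by (intro sum.cong) auto
  then show ?case unfolding * using Suc by (simp add: sum.distrib algebra_simps)
qed simp

text \<open>Terms with \<open>u < Y\<close> are at most 1, the others at most \<open>1 / Y\<close>.
  This crude bound replaces the logarithm, since only a power saving is wanted.\<close>

lemma sum_inverse_le:
  assumes "Y > 0"
  shows "(\<Sum>u<T. 1 / real (Suc u)) \<le> real Y + real T / real Y"
proof -
  have "(\<Sum>u<T. 1 / real (Suc u)) \<le> (\<Sum>u<T. (if u < Y then 1 else 0) + 1 / real Y)"
    by (intro sum_mono) (use assms in \<open>auto simp: field_simps\<close>)
  also have "\<dots> = real (card ({..<T} \<inter> {..<Y})) + real T / real Y"
    by (simp add: sum.distrib sum.If_cases Int_def lessThan_def)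
  also have "card ({..<T} \<inter> {..<Y}) \<le> Y" using card_mono[of "{..<Y}" "{..<T} \<inter> {..<Y}"] by simp
  finally show ?thesis by simp
qed

text \<open>Isolates the expected number \<open>(T * L)^2 / M\<close> of collisions. The last factor
  is the relative error; \<open>G\<close> stands for \<open>A^2 * T\<close> and \<open>Z\<close> for
  \<open>Y + T / Y\<close>.\<close>

lemma collision_count_identity:
  fixes T L M G Z :: real
  assumes "T > 0" "L > 0" "M > 0"
  shows "T * L + 2 * (L * (T\<^sup>2 / 2 * (L / M + 2 * G / M) + L * Z + 2 * T))
    = T * L * (T * L / M) + T * L * (T * L / M) * (2 * G / L + 2 * M * Z / T\<^sup>2 + 5 * M / (T * L))"
proof -
  have "T * L * (T * L / M) * (2 * G / L) = T\<^sup>2 * L * 2 * G / M"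
    using assms by (simp add: power2_eq_square)
  moreover have "T * L * (T * L / M) * (2 * M * Z / T\<^sup>2) = 2 * L * L * Z"
    using assms by (simp add: power2_eq_square)
  moreover have "T * L * (T * L / M) * (5 * M / (T * L)) = 5 * T * L"
    using assms by simp
  moreover have "2 * (L * (T\<^sup>2 / 2 * (L / M + 2 * G / M) + L * Z + 2 * T))
     = T\<^sup>2 * L * L / M + T\<^sup>2 * L * 2 * G / M + 2 * L * L * Z + 4 * T * L"
    by (simp add: algebra_simps)
  moreover have "T * L * (T * L / M) = T\<^sup>2 * L * L / M" by (simp add: power2_eq_square)
  ultimately show ?thesis by (simp only: distrib_left)
qed
text \<open>The pairs \<open>(n\<^sub>0 + A t, v)\<close> with \<open>t - t' = u\<close> fixed give an arithmetic progression in \<open>t'\<close> with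
  step \<open>2 A\<^sup>2 u\<close>, much shorter than the smoothing window \<open>L\<close>, so the collision count is
  elementary.\<close>

lemma squares_near_uniform:
  fixes n0 A T L M Y :: nat and \<epsilon> :: real and \<Psi> :: "nat \<Rightarrow> complex"
  assumes pos: "A > 0" "T > 0" "L > 0" "M > 0" "Y > 0" and LM: "L \<le> M"
    and \<Psi>: "\<And>w. cmod (\<Psi> w) \<le> 1" and \<epsilon>: "\<epsilon> \<ge> 0"
    and rel: "2 * real (A\<^sup>2 * T) / real L + 2 * real M * (real Y + real T / real Y) / (real T)\<^sup>2
       + 5 * real M / (real T * real L) \<le> \<epsilon>\<^sup>2"
  shows "cmod ((\<Sum>t<T. \<Sum>v<L. \<Psi> (((n0 + A * t)\<^sup>2 + v) mod M)) - of_real (real T * real L / real M) * (\<Sum>w<M. \<Psi> w))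
     \<le> real T * real L * \<epsilon>"
proof -
  define z where "z t v = ((n0 + A * t)\<^sup>2 + v) mod M" for t v
  have zM: "z t v < M" for t v using pos by (simp add: z_def)
  define c where "c w = (\<Sum>t<T. \<Sum>v<L. of_bool (z t v = w) :: real)" for w
  define \<kappa> where "\<kappa> = real T * real L / real M"
  have \<kappa>M: "real M * \<kappa> = real T * real L" using pos by (simp add: \<kappa>_def)
  define W where "W t t' = (\<Sum>v<L. \<Sum>v'<L. of_bool (z t v = z t' v') :: real)" for t t'
  have pick: "(\<Sum>w<M. of_bool (z t v = w) * h w) = h (z t v)" for t v and h :: "nat \<Rightarrow> real"
    using zM[of t v] by (simp add: of_bool_def if_distrib[of "\<lambda>x. x * _"] cong: if_cong)
  have pickC: "(\<Sum>w<M. of_bool (z t v = w) * h w) = h (z t v)" for t v and h :: "nat \<Rightarrow> complex"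
    using zM[of t v] by (simp add: of_bool_def if_distrib[of "\<lambda>x. x * _"] cong: if_cong)
  have csum: "(\<Sum>w<M. c w) = real T * real L"
  proof -
    have "(\<Sum>w<M. c w) = (\<Sum>t<T. \<Sum>v<L. \<Sum>w<M. of_bool (z t v = w))"
      unfolding c_def by (rule sum_swap3)
    also have "\<dots> = (\<Sum>t<T. \<Sum>v<L. 1)"
      using pick[of _ _ "\<lambda>_. 1"] by (intro sum.cong refl) simp
    finally show ?thesis by simp
  qed
  have c\<Psi>: "(\<Sum>t<T. \<Sum>v<L. \<Psi> (z t v)) = (\<Sum>w<M. of_real (c w) * \<Psi> w)"
  proof -
    have "(\<Sum>w<M. of_real (c w) * \<Psi> w) = (\<Sum>t<T. \<Sum>v<L. \<Sum>w<M. of_bool (z t v = w) * \<Psi> w)"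
    proof -
      have ob: "complex_of_real (of_bool P) = of_bool P" for P by (cases P) auto
      show ?thesis unfolding c_def of_real_sum sum_distrib_right ob by (rule sum_swap3)
    qed
    then show ?thesis by (simp add: pickC)
  qed
  have csq: "(\<Sum>w<M. (c w)\<^sup>2) = (\<Sum>t<T. \<Sum>t'<T. W t t')"
  proof -
    have "(\<Sum>w<M. (c w)\<^sup>2) = (\<Sum>w<M. \<Sum>t<T. \<Sum>v<L. of_bool (z t v = w) * c w)"
      by (intro sum.cong refl) (simp only: power2_eq_square sum_distrib_right[symmetric] c_def[symmetric])
    also have "\<dots> = (\<Sum>t<T. \<Sum>v<L. \<Sum>w<M. of_bool (z t v = w) * c w)"
      by (rule sum_swap3)
    also have "\<dots> = (\<Sum>t<T. \<Sum>v<L. c (z t v))" using pick[of _ _ c] by simp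
    also have "\<dots> = (\<Sum>t<T. \<Sum>v<L. \<Sum>t'<T. \<Sum>v'<L. of_bool (z t v = z t' v'))"
      unfolding c_def by (intro sum.cong refl arg_cong[of _ _ of_bool]) auto
    also have "\<dots> = (\<Sum>t<T. \<Sum>t'<T. W t t')"
      unfolding W_def by (intro sum.cong refl sum.swap)
    finally show ?thesis .
  qed
  have Wsym: "W t t' = W t' t" for t t'
    unfolding W_def by (subst sum.swap) (intro sum.cong refl arg_cong[of _ _ of_bool], auto)
  \<comment> \<open>Distinct \<open>v\<close> below \<open>L \<le> M\<close> stay distinct modulo
    \<open>M\<close>, so for equal \<open>t\<close> only \<open>v = v'\<close> collides.\<close>
  have Wdiag: "W t t \<le> real L" for t
  proof -
    have "(\<Sum>v'<L. of_bool (z t v = z t v') :: real) \<le> 1" if "v < L" for v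
    proof -
      have "z t v = z t v' \<longleftrightarrow> v' = v" if "v' < L" for v'
      proof
        assume "z t v = z t v'"
        then have "[(n0 + A * t)\<^sup>2 + v = (n0 + A * t)\<^sup>2 + v'] (mod M)" unfolding z_def cong_def .
        then have "[v = v'] (mod M)" by (simp add: cong_add_lcancel_nat)
        then show "v' = v" using that \<open>v < L\<close> LM by (simp add: cong_def)
      qed simp
      then have "(\<Sum>v'<L. of_bool (z t v = z t v') :: real) = (\<Sum>v'<L. if v' = v then 1 else 0)"
        by (intro sum.cong) auto
      then show ?thesis using that by simp
    qed
    then have "W t t \<le> (\<Sum>v<L. 1)" unfolding W_def by (intro sum_mono) auto
    then show ?thesis by simp
  qed
  define g where "g u = 2 * A\<^sup>2 * Suc u" for u
  define E where "E u = (real (g u * (T - Suc u) + L) / real M + 1) * (real L / real (g u) + 1)" for u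
  have off: "(\<Sum>t<T - Suc u. W (t + Suc u) t) \<le> real L * E u" for u
  proof -
    define d where "d = (A * Suc u) * (2 * n0 + A * Suc u)"
    have g0: "g u > 0" using pos by (simp add: g_def)
    have sq: "(n0 + A * (t + Suc u))\<^sup>2 = (n0 + A * t)\<^sup>2 + (d + g u * t)" for t
      by (simp add: d_def g_def power2_eq_square algebra_simps)
    have eq: "z (t + Suc u) v = z t v' \<longleftrightarrow> (d + g u * t + v) mod M = v' mod M" for t v v'
    proof -
      have "z (t + Suc u) v = z t v' \<longleftrightarrow> [(n0 + A * t)\<^sup>2 + (d + g u * t + v) = (n0 + A * t)\<^sup>2 + v'] (mod M)"
        unfolding z_def sq cong_def by (simp add: add.assoc)
      then show ?thesis by (simp only: cong_add_lcancel_nat) (simp only: cong_def)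
    qed
    have "(\<Sum>t<T - Suc u. W (t + Suc u) t)
       = (\<Sum>t<T - Suc u. \<Sum>v<L. \<Sum>v'<L. of_bool ((d + g u * t + v) mod M = v' mod M))"
      unfolding W_def eq by (rule refl)
    also have "\<dots> = (\<Sum>v'<L. \<Sum>t<T - Suc u. \<Sum>v<L. of_bool ((d + g u * t + v) mod M = v' mod M))"
      by (rule sum_swap3[symmetric])
    also have "\<dots> = (\<Sum>v'<L. real (card {(t, v) \<in> {..<T - Suc u} \<times> {..<L}. (d + g u * t + v) mod M = v' mod M}))"
    proof (intro sum.cong refl)
      fix v'
      have "(\<Sum>t<T - Suc u. \<Sum>v<L. of_bool ((d + g u * t + v) mod M = v' mod M) :: real)
        = (\<Sum>p\<in>{..<T - Suc u} \<times> {..<L}. of_bool ((d + g u * fst p + snd p) mod M = v' mod M))"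
        by (simp add: sum.cartesian_product case_prod_unfold del: sum_of_bool_eq)
      also have "\<dots> = real (card {(t, v) \<in> {..<T - Suc u} \<times> {..<L}. (d + g u * t + v) mod M = v' mod M})"
        by (simp add: case_prod_unfold Int_def mem_Times_iff conj_assoc)
      finally show "(\<Sum>t<T - Suc u. \<Sum>v<L. of_bool ((d + g u * t + v) mod M = v' mod M) :: real)
        = real (card {(t, v) \<in> {..<T - Suc u} \<times> {..<L}. (d + g u * t + v) mod M = v' mod M})" .
    qed
    also have "\<dots> \<le> (\<Sum>v'<L. E u)"
    proof (intro sum_mono)
      fix v'
      have "real (card {(t, v) \<in> {..<T - Suc u} \<times> {..<L}. (d + g u * t + v) mod M = v' mod M})
         \<le> real (((g u * (T - Suc u) + L) div M + 1) * (L div g u + 1))"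
        using card_progression_window[OF pos(4) g0] by (simp only: of_nat_le_iff)
      also have "\<dots> = (real ((g u * (T - Suc u) + L) div M) + 1) * (real (L div g u) + 1)"
        by (simp only: of_nat_mult of_nat_add of_nat_1)
      also have "\<dots> \<le> E u"
        unfolding E_def by (intro mult_mono add_mono of_nat_div_le_of_nat) auto
      finally show "real (card {(t, v) \<in> {..<T - Suc u} \<times> {..<L}. (d + g u * t + v) mod M = v' mod M}) \<le> E u" .
    qed
    finally show ?thesis by simp
  qed
  have Eu: "E u \<le> real (T - Suc u) * real L / real M + real (T - Suc u) * (2 * real (A\<^sup>2 * T)) / real M
       + (real L * (1 / real (Suc u)) + 2)" if "u < T" for u
  proof -
    have g2: "2 * Suc u \<le> g u" unfolding g_def by (intro mult_right_mono) (use pos in auto)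
    then have g0: "real (g u) > 0" by simp
    have LM1: "real L / real M \<le> 1" using LM pos by simp
    have "real L / real (g u) \<le> real L / (2 * real (Suc u))"
    proof (rule divide_left_mono)
      show "2 * real (Suc u) \<le> real (g u)" using g2 by (metis of_nat_le_iff of_nat_mult of_nat_numeral)
    qed (use g0 in auto)
    then have Lg: "real L / real (g u) \<le> real L * (1 / real (Suc u)) / 2" by (simp add: mult.commute)
    have "g u \<le> 2 * (A\<^sup>2 * T)" unfolding g_def mult.assoc using that by (intro mult_left_mono) auto
    then have gT: "real (g u) \<le> 2 * real (A\<^sup>2 * T)" by (metis of_nat_le_iff of_nat_mult of_nat_numeral)
    have "E u = real (T - Suc u) * real L / real M + real (T - Suc u) * real (g u) / real M
        + (real L / real M + 1) * (real L / real (g u) + 1)"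
      using g0 pos unfolding E_def of_nat_add of_nat_mult by (simp add: divide_simps) (simp add: algebra_simps)
    also have "\<dots> \<le> real (T - Suc u) * real L / real M + real (T - Suc u) * (2 * real (A\<^sup>2 * T)) / real M
        + 2 * (real L * (1 / real (Suc u)) / 2 + 1)"
      using g0 LM1 Lg by (intro add_mono mult_mono divide_right_mono mult_left_mono gT) auto
    finally have "E u \<le> real (T - Suc u) * real L / real M + real (T - Suc u) * (2 * real (A\<^sup>2 * T)) / real M
        + 2 * (real L * (1 / real (Suc u)) / 2 + 1)" .
    moreover have "2 * (x / 2 + 1) = x + 2" for x :: real by simp
    ultimately show ?thesis by (simp only:)
  qed
  have tri: "(\<Sum>u<T. real (T - Suc u)) \<le> (real T)\<^sup>2 / 2"
  proof -
    have "(\<Sum>u<T. real (T - Suc u)) = (\<Sum>u<T. real u)" by (rule sum.nat_diff_reindex)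
    also have "\<dots> \<le> (real T)\<^sup>2 / 2" by (induction T) (auto simp: power2_eq_square algebra_simps)
    finally show ?thesis .
  qed
  have "(\<Sum>w<M. (c w)\<^sup>2) \<le> (\<Sum>t<T. real L) + 2 * (\<Sum>u<T. real L * E u)"
    unfolding csq sum_square_symmetric[OF Wsym] by (intro add_mono sum_mono mult_left_mono Wdiag off) auto
  also have "(\<Sum>u<T. real L * E u) \<le> (\<Sum>u<T. real L * (real (T - Suc u) * real L / real M
       + real (T - Suc u) * (2 * real (A\<^sup>2 * T)) / real M + (real L * (1 / real (Suc u)) + 2)))"
    by (intro sum_mono mult_left_mono Eu) auto
  also have "\<dots> = real L * ((\<Sum>u<T. real (T - Suc u)) * (real L / real M + 2 * real (A\<^sup>2 * T) / real M)
       + real L * (\<Sum>u<T. 1 / real (Suc u)) + 2 * real T)"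
  proof -
    have "(\<Sum>u<T. real L * (X u * real L / real M + X u * k / real M + (real L * h u + 2)))
      = real L * ((\<Sum>u<T. X u) * (real L / real M + k / real M) + real L * (\<Sum>u<T. h u) + 2 * real T)"
      for X h :: "nat \<Rightarrow> real" and k
    proof -
      have "(\<Sum>u<T. real L * (X u * real L / real M + X u * k / real M + (real L * h u + 2)))
        = (\<Sum>u<T. X u * (real L * (real L / real M + k / real M)) + h u * (real L * real L) + real L * 2)"
        by (intro sum.cong refl) (simp add: algebra_simps add_divide_distrib)
      also have "\<dots> = (\<Sum>u<T. X u) * (real L * (real L / real M + k / real M)) + (\<Sum>u<T. h u) * (real L * real L)
          + real T * (real L * 2)"
        by (simp only: sum.distrib sum_distrib_right sum_constant card_lessThan)
      finally show ?thesis by (simp add: algebra_simps add_divide_distrib)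
    qed
    then show ?thesis .
  qed
  also have "\<dots> \<le> real L * ((real T)\<^sup>2 / 2 * (real L / real M + 2 * real (A\<^sup>2 * T) / real M)
       + real L * (real Y + real T / real Y) + 2 * real T)"
    by (intro mult_left_mono add_mono mult_right_mono tri sum_inverse_le pos) auto
  finally have "(\<Sum>w<M. (c w)\<^sup>2) \<le> real T * real L + 2 * (real L * ((real T)\<^sup>2 / 2 * (real L / real M + 2 * real (A\<^sup>2 * T) / real M)
       + real L * (real Y + real T / real Y) + 2 * real T))" by simp
  also have "\<dots> = real T * real L * \<kappa> + real T * real L * \<kappa> *
     (2 * real (A\<^sup>2 * T) / real L + 2 * real M * (real Y + real T / real Y) / (real T)\<^sup>2 + 5 * real M / (real T * real L))"
    unfolding \<kappa>_def by (rule collision_count_identity) (use pos in auto)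
  also have "\<dots> \<le> real T * real L * \<kappa> + real T * real L * \<kappa> * \<epsilon>\<^sup>2"
    by (intro add_left_mono mult_left_mono rel) (auto simp: \<kappa>_def)
  finally have Q: "(\<Sum>w<M. (c w)\<^sup>2) \<le> real T * real L * \<kappa> + real T * real L * \<kappa> * \<epsilon>\<^sup>2" .
  \<comment> \<open>As \<open>\<kappa>\<close> is the mean of \<open>c\<close>, removing the main
    term from the second moment leaves the variance. Cauchy--Schwarz over the \<open>M\<close>
    residues then bounds the total deviation.\<close>
  have "(\<Sum>w<M. (c w - \<kappa>)\<^sup>2) = (\<Sum>w<M. (c w)\<^sup>2) - 2 * \<kappa> * (\<Sum>w<M. c w) + real M * \<kappa>\<^sup>2"
    by (simp add: power2_diff sum.distrib sum_subtractf sum_distrib_left mult_ac)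
  also have "\<dots> = (\<Sum>w<M. (c w)\<^sup>2) - real T * real L * \<kappa>"
    unfolding csum using \<kappa>M by (simp add: power2_eq_square mult.assoc[symmetric])
  also have "\<dots> \<le> real T * real L * \<kappa> * \<epsilon>\<^sup>2" using Q by simp
  finally have var: "(\<Sum>w<M. (c w - \<kappa>)\<^sup>2) \<le> real T * real L * \<kappa> * \<epsilon>\<^sup>2" .
  have "(\<Sum>w<M. \<bar>c w - \<kappa>\<bar>)\<^sup>2 \<le> (\<Sum>w<M. (c w - \<kappa>)\<^sup>2) * real M"
    using sum_squared_le_sum_of_squares[of "\<lambda>w. \<bar>c w - \<kappa>\<bar>" "{..<M}"] by simp
  also have "\<dots> \<le> real T * real L * \<kappa> * \<epsilon>\<^sup>2 * real M" by (intro mult_right_mono var) auto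
  also have "\<dots> = (real T * real L * \<epsilon>)\<^sup>2" using \<kappa>M by (simp add: power2_eq_square mult_ac)
  finally have l1: "(\<Sum>w<M. \<bar>c w - \<kappa>\<bar>) \<le> real T * real L * \<epsilon>"
    by (rule power2_le_imp_le) (use \<epsilon> in auto)
  have "(\<Sum>t<T. \<Sum>v<L. \<Psi> (z t v)) - of_real \<kappa> * (\<Sum>w<M. \<Psi> w) = (\<Sum>w<M. of_real (c w - \<kappa>) * \<Psi> w)"
    unfolding c\<Psi> by (simp add: sum_distrib_left sum_subtractf algebra_simps)
  also have "cmod \<dots> \<le> (\<Sum>w<M. \<bar>c w - \<kappa>\<bar>)"
  proof (rule sum_norm_le)
    fix w
    show "cmod (of_real (c w - \<kappa>) * \<Psi> w) \<le> \<bar>c w - \<kappa>\<bar>"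
      unfolding norm_mult norm_of_real using mult_left_mono[OF \<Psi>[of w], of "\<bar>c w - \<kappa>\<bar>"] by simp
  qed
  also note l1
  finally show ?thesis unfolding z_def \<kappa>_def .
qed

section \<open>Windows of digits\<close>

text \<open>Multiplicative forms of the two block properties of a digital function. The index
  \<open>l\<close> is needed because the shift by \<open>l\<close> carries its own
  coefficient.\<close>

locale digit_phase =
  fixes q m k :: nat and \<chi> :: "nat \<Rightarrow> nat \<Rightarrow> complex"
  assumes q2: "q \<ge> 2"
    and norm_chi: "cmod (\<chi> l x) = 1"
    and low_part: "n mod q ^ (P + m) = n' mod q ^ (P + m) \<Longrightarrow> \<chi> l n * \<chi> l (n' div q ^ P) = \<chi> l n' * \<chi> l (n div q ^ P)"
    and split: "w * q ^ m < q ^ B \<Longrightarrow> \<chi> l (x * q ^ B + w) = \<chi> l x * \<chi> l w"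
begin

lemma q_pos: "q ^ n > 0"
  using q2 by simp

lemma q_power_ge_1: "1 \<le> q ^ n"
  using q_pos[of n] by linarith

lemma q_power_mono: "a \<le> b \<Longrightarrow> q ^ a \<le> q ^ b"
  using q2 by (intro power_increasing) auto

lemma two_mult_q_power: "2 * q ^ a \<le> q ^ (a + 1)"
  using q2 by simp

lemma le_mult_q_power: "x \<le> x * q ^ n"
  using mult_le_mono2[OF q_power_ge_1, of x n] by simp

lemma chi_nonzero: "\<chi> l x \<noteq> 0"
  using norm_chi[of l x] by auto

lemma chi_cnj: "\<chi> l x * cnj (\<chi> l x) = 1"
  by (simp add: complex_norm_square[symmetric] norm_chi)

definition window :: "nat \<Rightarrow> nat \<Rightarrow> nat \<Rightarrow> nat \<Rightarrow> complex" where
  "window \<mu> \<kappa> l z = \<chi> l ((z mod q ^ \<kappa>) div q ^ \<mu>)"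

lemma norm_window: "cmod (window \<mu> \<kappa> l z) = 1"
  by (simp add: window_def norm_chi)

lemma window_arg:
  assumes "\<mu> \<le> P" "P + B \<le> \<kappa>" "w < q ^ B" "r < q ^ P"
  shows "((h * q ^ (P + B) + w * q ^ P + r) mod q ^ \<kappa>) div q ^ \<mu>
    = (h mod q ^ (\<kappa> - P - B)) * q ^ (P - \<mu> + B) + w * q ^ (P - \<mu>) + r div q ^ \<mu>"
proof -
  define h' where "h' = h mod q ^ (\<kappa> - P - B)"
  have "w * q ^ P + r < w * q ^ P + q ^ P" using assms by simp
  also have "\<dots> = (w + 1) * q ^ P" by simp
  also have "\<dots> \<le> q ^ B * q ^ P" using assms by (intro mult_right_mono) auto
  finally have lt: "w * q ^ P + r < q ^ (P + B)" by (simp add: power_add mult.commute)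
  have "q ^ \<kappa> = q ^ (P + B) * q ^ (\<kappa> - P - B)" using assms by (simp add: power_add[symmetric])
  then have "(h * q ^ (P + B) + w * q ^ P + r) mod q ^ \<kappa>
     = q ^ (P + B) * (((h * q ^ (P + B) + (w * q ^ P + r)) div q ^ (P + B)) mod q ^ (\<kappa> - P - B)) + (w * q ^ P + r)"
    using lt by (simp add: mod_mult2_eq add.assoc del: power_add)
  also have "(h * q ^ (P + B) + (w * q ^ P + r)) div q ^ (P + B) = h"
    using lt q_pos[of "P + B"] by (simp only: div_mult_self3 div_less)
  finally have 1: "(h * q ^ (P + B) + w * q ^ P + r) mod q ^ \<kappa> = h' * q ^ (P + B) + w * q ^ P + r"
    by (simp add: h'_def)
  have "q ^ (P + B) = q ^ (P - \<mu> + B) * q ^ \<mu>" "q ^ P = q ^ (P - \<mu>) * q ^ \<mu>"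
    using assms by (simp_all add: power_add[symmetric])
  then have "h' * q ^ (P + B) + w * q ^ P + r = r + (h' * q ^ (P - \<mu> + B) + w * q ^ (P - \<mu>)) * q ^ \<mu>"
    by (simp add: algebra_simps)
  then show ?thesis unfolding 1 h'_def[symmetric] using q_pos[of \<mu>] by (simp add: add.commute)
qed

text \<open>The block of \<open>B\<close> digits at position \<open>P\<close> changes from
  \<open>w\<close> to \<open>w + \<Delta>\<close>, and the phase changes by a ratio free of all
  other digits. Because \<open>q ^ m\<close> divides \<open>\<Delta>\<close>, the lowest
  \<open>P - \<mu> + m\<close> digits of the window are kept and \<open>low_part\<close> removes
  everything below \<open>P\<close>; because the block has \<open>m\<close> zeros on top before and
  after, \<open>split\<close> detaches the digits above.\<close>

lemma window_shift:
  assumes "\<mu> \<le> P" "P + B \<le> \<kappa>" and \<Delta>: "q ^ m dvd \<Delta>"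
    and w: "w = (z div q ^ P) mod q ^ B" and less: "(w + \<Delta>) * q ^ m < q ^ B"
  shows "window \<mu> \<kappa> l (z + \<Delta> * q ^ P) * \<chi> l w = window \<mu> \<kappa> l z * \<chi> l (w + \<Delta>)"
proof -
  define h where "h = z div q ^ (P + B)"
  define h' where "h' = h mod q ^ (\<kappa> - P - B)"
  define r where "r = z mod q ^ P"
  have r: "r < q ^ P" using q_pos by (simp add: r_def)
  have "z = (z div q ^ P div q ^ B * q ^ B + w) * q ^ P + r"
    unfolding w r_def div_mult_mod_eq ..
  also have "z div q ^ P div q ^ B = h" by (simp add: h_def div_mult2_eq power_add)
  finally have z: "z = h * q ^ (P + B) + w * q ^ P + r" by (simp add: algebra_simps power_add)
  then have z': "z + \<Delta> * q ^ P = h * q ^ (P + B) + (w + \<Delta>) * q ^ P + r" by (simp add: algebra_simps)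
  have less': "w + \<Delta> < q ^ B" by (rule le_less_trans[OF le_mult_q_power less])
  define Z where "Z v = h' * q ^ (P - \<mu> + B) + v * q ^ (P - \<mu>) + r div q ^ \<mu>" for v
  have win: "window \<mu> \<kappa> l z = \<chi> l (Z w)" "window \<mu> \<kappa> l (z + \<Delta> * q ^ P) = \<chi> l (Z (w + \<Delta>))"
    unfolding z' unfolding z window_def Z_def h'_def using window_arg[OF assms(1,2) _ r] less' by simp_all
  have rdiv: "r div q ^ \<mu> < q ^ (P - \<mu>)"
    using r assms(1) q_pos[of \<mu>] by (simp add: div_less_iff_less_mult power_add[symmetric])
  have Zdiv: "Z v div q ^ (P - \<mu>) = h' * q ^ B + v" for v
  proof -
    have "Z v = r div q ^ \<mu> + (h' * q ^ B + v) * q ^ (P - \<mu>)"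
      by (simp add: Z_def power_add algebra_simps)
    then show ?thesis by (simp only: div_add_mult_eq[OF rdiv])
  qed
  obtain d where d: "\<Delta> = q ^ m * d" using \<Delta> by blast
  have "Z (w + \<Delta>) = Z w + d * q ^ (P - \<mu> + m)"
    by (simp add: Z_def d power_add algebra_simps)
  then have "Z (w + \<Delta>) mod q ^ (P - \<mu> + m) = Z w mod q ^ (P - \<mu> + m)" by simp
  from low_part[OF this, of l]
  have "\<chi> l (Z (w + \<Delta>)) * \<chi> l (h' * q ^ B + w) = \<chi> l (Z w) * \<chi> l (h' * q ^ B + (w + \<Delta>))"
    unfolding Zdiv .
  moreover have "w * q ^ m < q ^ B" by (rule le_less_trans[OF _ less]) simp
  ultimately have "\<chi> l (Z (w + \<Delta>)) * (\<chi> l h' * \<chi> l w) = \<chi> l (Z w) * (\<chi> l h' * \<chi> l (w + \<Delta>))"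
    by (simp only: split less)
  then show ?thesis unfolding win using chi_nonzero[of l h'] by (simp add: mult.left_commute)
qed

text \<open>Here \<open>y\<close> is a sum of truncated summands, congruent to \<open>z\<close>. It
  stays below the modulus, so nothing wraps around, and the block is read off from the multiple of
  \<open>F * X\<close> just below \<open>y\<close>.\<close>

lemma digit_block_of_sum:
  assumes "c * F * X \<le> y" "y < (c + 1) * F * X" and c: "c + 1 \<le> q ^ B"
    and X: "X = q ^ P" and F: "F = q ^ B'" and z: "z mod q ^ (P + (B' + B)) = y mod q ^ (P + (B' + B))"
  shows "(z div q ^ (P + B')) mod q ^ B = c"
proof -
  have FX: "F * X = q ^ (P + B')" by (simp add: X F power_add mult.commute)
  have "(c + 1) * F * X \<le> q ^ B * (F * X)" unfolding mult.assoc using c by (intro mult_right_mono) auto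
  also have "\<dots> = q ^ (P + (B' + B))" by (simp add: X F power_add mult_ac)
  finally have "y < q ^ (P + (B' + B))" using assms(2) by linarith
  then have "z mod q ^ ((P + B') + B) = y" using z by (simp add: add.assoc)
  then have y: "q ^ (P + B') * ((z div q ^ (P + B')) mod q ^ B) + z mod q ^ (P + B') = y"
    by (simp only: power_add[of q "P + B'" B] mod_mult2_eq)
  then have "y div q ^ (P + B') = (z div q ^ (P + B')) mod q ^ B"
    using q_pos[of "P + B'"] by (metis add.commute add.right_neutral div_less div_mult_self2 mod_less_divisor nat_less_le)
  moreover have "y div q ^ (P + B') = c"
  proof (rule div_nat_eqI)
    show "q ^ (P + B') * c \<le> y" using assms(1) by (simp only: mult.assoc FX) (simp only: mult.commute)
    show "y < q ^ (P + B') * Suc c" using assms(2) by (simp only: mult.assoc FX Suc_eq_plus1) (simp only: mult.commute)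
  qed
  ultimately show ?thesis by simp
qed

lemma digit_block_bounds:
  assumes "(z div q ^ P) mod q ^ G = v"
  shows "v * q ^ P \<le> z mod q ^ (P + G)" "z mod q ^ (P + G) < (v + 1) * q ^ P"
proof -
  have "z mod q ^ (P + G) = q ^ P * v + z mod q ^ P"
    unfolding power_add mod_mult2_eq assms ..
  then show "v * q ^ P \<le> z mod q ^ (P + G)" "z mod q ^ (P + G) < (v + 1) * q ^ P"
    using q_pos[of P] by (simp_all add: algebra_simps)
qed

definition corr :: "nat \<Rightarrow> nat \<Rightarrow> nat \<Rightarrow> nat \<Rightarrow> nat \<Rightarrow> complex" where
  "corr \<mu> \<kappa> t D w = (\<Prod>l<k. window \<mu> \<kappa> l (w + l * D) * cnj (window \<mu> \<kappa> l (w + (t + l) * D)))"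

lemma norm_corr: "cmod (corr \<mu> \<kappa> t D w) = 1"
  unfolding corr_def prod_norm[symmetric] by (simp add: norm_mult norm_window)

end

text \<open>A block has \<open>G = B' + B\<close> digits. The upper \<open>B\<close> hold
  \<open>u\<close> or \<open>u + 1\<close>; the lower \<open>B'\<close> are a buffer of size
  \<open>F\<close> in which it is decided whether a carry occurs. The bound on \<open>F\<close>
  leaves room for at most one carry: \<open>4 * k^2\<close> for the multiples of \<open>D\<close>,
  \<open>4 * k^2 + 2 * q^2\<close> for the shift by \<open>t\<close>, and \<open>2 * k + 2\<close>
  for digits cut off below the block.\<close>

locale digit_pattern = digit_phase +
  fixes i0 u \<Delta> B' B G F :: nat
  assumes i0: "i0 < k" and chi_trivial: "\<And>l x. l < i0 \<Longrightarrow> \<chi> l x = 1"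
    and \<Delta>: "\<Delta> > 0" "q ^ m dvd \<Delta>" and B: "(u + 1 + \<Delta>) * q ^ m < q ^ B"
    and F: "F = q ^ B'" "8 * k\<^sup>2 + 2 * k + 2 * q\<^sup>2 + 2 \<le> F" and G: "G = B' + B"
begin

text \<open>The contribution of strand \<open>i0\<close>: its first copy passes from
  \<open>u\<close> to \<open>u + \<Delta>\<close>, its conjugated copy from \<open>u + 1\<close> to
  \<open>u + 1 + \<Delta>\<close>.\<close>

definition \<zeta> :: complex where
  "\<zeta> = \<chi> i0 (u + \<Delta>) / \<chi> i0 u * cnj (\<chi> i0 (u + 1 + \<Delta>) / \<chi> i0 (u + 1))"

text \<open>In units of \<open>q\<^sup>P\<close> a block of \<open>w\<close> with value \<open>v1\<close> lies \<open>4 k (i0 + 1)\<close> below the integer \<open>u + 1\<close>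
  times \<open>F\<close>. If \<open>D\<close> contributes \<open>2 k\<close> and \<open>2 t D\<close> contributes about \<open>4 k\<^sup>2\<close>, the strand
  \<open>w + l (2 D)\<close> is pushed over it precisely for \<open>l > i0\<close>, and the strand \<open>w + (t + l) (2 D)\<close> for every \<open>l\<close>.\<close>

definition v1 :: nat where "v1 = u * F + (F - 4 * k * (i0 + 1))"

definition good :: "nat \<Rightarrow> nat \<Rightarrow> nat \<Rightarrow> bool" where
  "good t D P \<longleftrightarrow> (D div q ^ P) mod q ^ G = 2 * k \<and>
     (2 * t * D div q ^ P) mod q ^ G \<in> {4 * k\<^sup>2..<4 * k\<^sup>2 + 2 * q\<^sup>2}"

lemma strand_values:
  assumes w: "(w div q ^ P) mod q ^ G = v1" and good: "good t D P" and l: "l < k"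
  shows "((w + l * (2 * D)) div q ^ (P + B')) mod q ^ B = (if l \<le> i0 then u else u + 1)"
    and "((w + (t + l) * (2 * D)) div q ^ (P + B')) mod q ^ B = u + 1"
proof -
  define X where "X = q ^ P"
  define M where "M = q ^ (P + G)"
  define w' D' T' where "w' = w mod M" and "D' = D mod M" and "T' = (2 * t * D) mod M"
  define \<tau> where "\<tau> = (2 * t * D div q ^ P) mod q ^ G"
  define w0 where "w0 = F - 4 * k * (i0 + 1)"
  have sq: "k * (i0 + 1) \<le> k\<^sup>2" unfolding power2_eq_square using i0 by (intro mult_left_mono) auto
  \<comment> \<open>The natural subtraction in \<open>w0\<close> is exact, because \<open>F\<close>
    exceeds \<open>4 * k^2\<close>.\<close>
  then have w0: "w0 + 4 * k * (i0 + 1) = F" using F(2) by (simp add: w0_def)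
  have \<tau>: "4 * k\<^sup>2 \<le> \<tau>" "\<tau> < 4 * k\<^sup>2 + 2 * q\<^sup>2" using good by (auto simp: good_def \<tau>_def)
  have bw: "(u * F + w0) * X \<le> w'" "w' < (u * F + w0 + 1) * X"
    using digit_block_bounds[OF w] by (simp_all add: w'_def M_def X_def v1_def w0_def)
  have bD: "(2 * k) * X \<le> D'" "D' < (2 * k + 1) * X"
    using digit_block_bounds[of D P G "2 * k"] good by (simp_all add: good_def D'_def M_def X_def)
  have bT: "\<tau> * X \<le> T'" "T' < (\<tau> + 1) * X"
    using digit_block_bounds[OF \<tau>_def[symmetric]] by (simp_all add: T'_def M_def X_def)
  have ll: "k * l \<le> k\<^sup>2" using l by (simp add: power2_eq_square)
  have e: "4 * k * (i0 + 1) = 4 * (k * i0) + 4 * k" "2 * l * (2 * k + 1) = 4 * (k * l) + 2 * l"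
    "2 * l * (2 * k) = 4 * (k * l)" "k * (i0 + 1) = k * i0 + k"
    by (simp_all add: algebra_simps)
  \<comment> \<open>The digits of \<open>D\<close> below \<open>P\<close> amount to less than one
    unit; this is the extra \<open>2 * l\<close> in the upper bound.\<close>
  have lD: "2 * l * (2 * k) * X \<le> 2 * l * D'" "2 * l * D' \<le> 2 * l * (2 * k + 1) * X"
    using bD by (simp_all only: mult.assoc mult_le_mono2 less_imp_le)
  have "u + 1 + \<Delta> < q ^ B" by (rule le_less_trans[OF le_mult_q_power B])
  then have uB: "u + 2 \<le> q ^ B" using \<Delta>(1) by linarith
  define y where "y = w' + 2 * l * D'"
  have zy: "(w + l * (2 * D)) mod q ^ (P + (B' + B)) = y mod q ^ (P + (B' + B))"
  proof -
    have "l * (2 * D) = 2 * l * D" by simp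
    then show ?thesis unfolding y_def w'_def D'_def M_def G unfolding cong_def[symmetric]
      by (simp only:) (intro cong_add cong_mult cong_refl, simp_all add: cong_def)
  qed
  have ylo: "(u * F + w0 + 2 * l * (2 * k)) * X \<le> y" 
    using add_mono[OF bw(1) lD(1)] by (simp only: y_def distrib_right[symmetric])
  have yhi: "y < (u * F + w0 + 1 + 2 * l * (2 * k + 1)) * X" 
    using add_less_le_mono[OF bw(2) lD(2)] by (simp only: y_def distrib_right[symmetric])
  show "((w + l * (2 * D)) div q ^ (P + B')) mod q ^ B = (if l \<le> i0 then u else u + 1)"
  proof (cases "l \<le> i0")
    case True
    have "k * l \<le> k * i0" using True by (rule mult_le_mono2)
    then have "w0 + 1 + 2 * l * (2 * k + 1) \<le> F" using w0 True i0 unfolding e by linarith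
    then have "(u * F + w0 + 1 + 2 * l * (2 * k + 1)) * X \<le> (u + 1) * F * X"
      by (intro mult_right_mono) (auto simp: algebra_simps)
    then have "y < (u + 1) * F * X" using yhi by linarith
    moreover have "u * F * X \<le> y" using ylo by (simp add: algebra_simps)
    ultimately show ?thesis using digit_block_of_sum[OF _ _ _ X_def F(1) zy, of u] uB True by simp
  next
    case False
    then have "k * (i0 + 1) \<le> k * l" by (intro mult_le_mono2) auto
    then have "F \<le> w0 + 2 * l * (2 * k)" using w0 unfolding e by linarith
    then have "(u + 1) * F * X \<le> (u * F + w0 + 2 * l * (2 * k)) * X"
      by (intro mult_right_mono) (auto simp: algebra_simps)
    then have 1: "(u + 1) * F * X \<le> y" using ylo by linarith
    have "w0 + 1 + 2 * l * (2 * k + 1) \<le> 2 * F" using w0 ll l F(2) unfolding e by linarith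
    then have "(u * F + w0 + 1 + 2 * l * (2 * k + 1)) * X \<le> (u + 1 + 1) * F * X"
      by (intro mult_right_mono) (auto simp: algebra_simps)
    then have "y < (u + 1 + 1) * F * X" using yhi by linarith
    with 1 show ?thesis using digit_block_of_sum[OF _ _ _ X_def F(1) zy, of "u + 1"] uB False by simp
  qed
  define y2 where "y2 = w' + T' + 2 * l * D'"
  have zy2: "(w + (t + l) * (2 * D)) mod q ^ (P + (B' + B)) = y2 mod q ^ (P + (B' + B))"
  proof -
    have "w + (t + l) * (2 * D) = w + 2 * t * D + 2 * l * D" by (simp add: algebra_simps)
    then show ?thesis
      unfolding y2_def w'_def D'_def T'_def M_def G unfolding cong_def[symmetric]
      by (simp only:) (intro cong_add cong_mult cong_refl, simp_all add: cong_def)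
  qed
  \<comment> \<open>The contribution \<open>\<tau>\<close> of \<open>2 * t * D\<close> alone covers
    the gap \<open>4 * k * (i0 + 1)\<close> to the next multiple of \<open>F\<close>, whatever
    \<open>l\<close> is.\<close>
  have "F \<le> w0 + \<tau>" using w0 sq \<tau> unfolding e by linarith
  then have "(u + 1) * F * X \<le> (u * F + w0 + \<tau>) * X" by (intro mult_right_mono) (auto simp: algebra_simps)
  also have "\<dots> \<le> y2"
    using add_mono[OF bw(1) bT(1)] by (simp only: y2_def distrib_right[symmetric])
  finally have 1: "(u + 1) * F * X \<le> y2" .
  have "w0 + 1 + (\<tau> + 1) + 2 * l * (2 * k + 1) \<le> 2 * F" using w0 ll l F(2) \<tau> unfolding e by linarith
  then have "(u * F + w0 + 1 + (\<tau> + 1) + 2 * l * (2 * k + 1)) * X \<le> (u + 1 + 1) * F * X"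
    by (intro mult_right_mono) (auto simp: algebra_simps)
  moreover have "y2 < (u * F + w0 + 1 + (\<tau> + 1) + 2 * l * (2 * k + 1)) * X"
    using add_less_le_mono[OF add_strict_mono[OF bw(2) bT(2)] lD(2)] by (simp only: y2_def distrib_right[symmetric])
  ultimately have "y2 < (u + 1 + 1) * F * X" by linarith
  with 1 show "((w + (t + l) * (2 * D)) div q ^ (P + B')) mod q ^ B = u + 1"
    using digit_block_of_sum[OF _ _ _ X_def F(1) zy2, of "u + 1"] uB by simp
qed

text \<open>All \<open>2 * k\<close> windows undergo the same shift by \<open>\<Delta>\<close> in
  the upper part of the block. For \<open>l < i0\<close> the phases are trivial. For
  \<open>l > i0\<close> both copies read \<open>u + 1\<close>, so their ratios are conjugate and
  cancel. Only \<open>l = i0\<close> leaves a factor.\<close>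

lemma corr_swap:
  assumes w: "(w div q ^ P) mod q ^ G = v1" and good: "good t D P"
    and P: "\<mu> \<le> P" "P + G \<le> \<kappa>"
  shows "corr \<mu> \<kappa> t (2 * D) (w + \<Delta> * F * q ^ P) = \<zeta> * corr \<mu> \<kappa> t (2 * D) w"
proof -
  define f where "f w l = window \<mu> \<kappa> l (w + l * (2 * D)) * cnj (window \<mu> \<kappa> l (w + (t + l) * (2 * D)))" for w l
  have shift: "\<Delta> * F * q ^ P = \<Delta> * q ^ (P + B')" by (simp add: F(1) power_add)
  have le: "(u + \<Delta>) * q ^ m < q ^ B" by (rule le_less_trans[OF _ B]) simp
  have P': "\<mu> \<le> P + B'" "P + B' + B \<le> \<kappa>" using P by (simp_all add: G)
  have "f (w + \<Delta> * F * q ^ P) l = (if l = i0 then \<zeta> else 1) * f w l" if l: "l < k" for l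
  proof -
    note val = strand_values[OF w good l]
    define c where "c = (if l \<le> i0 then u else u + 1)"
    have "window \<mu> \<kappa> l (w + l * (2 * D) + \<Delta> * q ^ (P + B')) * \<chi> l c = window \<mu> \<kappa> l (w + l * (2 * D)) * \<chi> l (c + \<Delta>)"
      using val(1) B le by (intro window_shift[OF P' \<Delta>(2)]) (auto simp: c_def)
    then have 1: "window \<mu> \<kappa> l (w + \<Delta> * F * q ^ P + l * (2 * D)) = window \<mu> \<kappa> l (w + l * (2 * D)) * (\<chi> l (c + \<Delta>) / \<chi> l c)"
      unfolding shift using chi_nonzero[of l c] by (simp add: field_simps)
    have "window \<mu> \<kappa> l (w + (t + l) * (2 * D) + \<Delta> * q ^ (P + B')) * \<chi> l (u + 1) = window \<mu> \<kappa> l (w + (t + l) * (2 * D)) * \<chi> l (u + 1 + \<Delta>)"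
      using val(2) B by (intro window_shift[OF P' \<Delta>(2)]) auto
    then have 2: "window \<mu> \<kappa> l (w + \<Delta> * F * q ^ P + (t + l) * (2 * D)) = window \<mu> \<kappa> l (w + (t + l) * (2 * D)) * (\<chi> l (u + 1 + \<Delta>) / \<chi> l (u + 1))"
      unfolding shift using chi_nonzero[of l "u + 1"] by (simp add: field_simps)
    have f: "f (w + \<Delta> * F * q ^ P) l = (\<chi> l (c + \<Delta>) / \<chi> l c * cnj (\<chi> l (u + 1 + \<Delta>) / \<chi> l (u + 1))) * f w l"
      unfolding f_def 1 2 by simp
    have one: "\<chi> l (u + 1 + \<Delta>) / \<chi> l (u + 1) * cnj (\<chi> l (u + 1 + \<Delta>) / \<chi> l (u + 1)) = 1"
      by (simp only: complex_norm_square[symmetric]) (simp add: norm_divide norm_chi)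
    consider "l < i0" | "l = i0" | "l > i0" by linarith
    then show ?thesis
    proof cases
      case 1
      then show ?thesis unfolding f by (simp add: chi_trivial)
    next
      case 2
      then show ?thesis unfolding f by (simp add: \<zeta>_def c_def)
    next
      case 3
      then have "c = u + 1" by (simp add: c_def)
      then show ?thesis unfolding f using 3 one by simp
    qed
  qed
  then have "(\<Prod>l<k. f (w + \<Delta> * F * q ^ P) l) = (\<Prod>l<k. (if l = i0 then \<zeta> else 1) * f w l)"
    by (intro prod.cong) auto
  also have "\<dots> = \<zeta> * (\<Prod>l<k. f w l)" using i0 by (simp add: prod.distrib)
  finally show ?thesis by (simp add: corr_def f_def)
qed

lemma corr_sum_bound:
  assumes W: "W < q ^ K" and K: "\<mu> \<le> K" "K + I * G \<le> \<kappa>"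
  shows "cmod (\<Sum>y<(q ^ G) ^ I * e. corr \<mu> \<kappa> t (2 * D) (W + q ^ K * y))
    \<le> real e * (\<Prod>i<I. if good t D (K + i * G) then real (q ^ G) - 2 + cmod (1 + \<zeta>) else real (q ^ G))"
proof -
  define v2 where "v2 = v1 + \<Delta> * F"
  have F0: "F > 0" using F(2) by linarith
  have v12: "v1 < v2" using \<Delta> F0 by (simp add: v2_def)
  have less_qB: "u + 1 + \<Delta> < q ^ B" by (rule le_less_trans[OF le_mult_q_power B])
  have "v2 \<le> (u + 1 + \<Delta>) * F" by (simp add: v2_def v1_def algebra_simps)
  also have "\<dots> < q ^ B * F"
    using F0 less_qB by (intro mult_strict_right_mono) auto
  finally have v2: "v2 < q ^ G" by (simp add: G F(1) power_add mult.commute)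
  have "cmod (\<Sum>y<(q ^ G) ^ I * e. corr \<mu> \<kappa> t (2 * D) (W + q ^ K * y))
    \<le> real e * 1 * (\<Prod>i<I. if good t D (K + i * G) then real (q ^ G) - 2 + cmod (1 + \<zeta>) else real (q ^ G))"
  proof (rule digit_swap_bound[OF v12 v2])
    show "cmod (corr \<mu> \<kappa> t (2 * D) (W + q ^ K * y)) \<le> 1" for y by (simp add: norm_corr)
    fix i y assume i: "i < I" "good t D (K + i * G)" "y div (q ^ G) ^ i mod q ^ G = v1"
    have "(W + q ^ K * y) div q ^ (K + i * G) = y div (q ^ G) ^ i"
      using W q_pos[of K] by (simp add: power_add div_mult2_eq power_mult[symmetric] mult.commute)
    then have "((W + q ^ K * y) div q ^ (K + i * G)) mod q ^ G = v1" using i by simp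
    moreover have "K + i * G + G \<le> \<kappa>"
    proof -
      have "Suc i * G \<le> I * G" using i by (intro mult_right_mono) auto
      then show ?thesis using K by simp
    qed
    ultimately have "corr \<mu> \<kappa> t (2 * D) (W + q ^ K * y + \<Delta> * F * q ^ (K + i * G)) = \<zeta> * corr \<mu> \<kappa> t (2 * D) (W + q ^ K * y)"
      using K i by (intro corr_swap) auto
    moreover have "W + q ^ K * (y + (v2 - v1) * (q ^ G) ^ i) = W + q ^ K * y + \<Delta> * F * q ^ (K + i * G)"
      by (simp add: v2_def power_add power_mult algebra_simps)
    ultimately show "corr \<mu> \<kappa> t (2 * D) (W + q ^ K * (y + (v2 - v1) * (q ^ G) ^ i)) = \<zeta> * corr \<mu> \<kappa> t (2 * D) (W + q ^ K * y)"
      by (simp only:)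
  qed
  then show ?thesis by simp
qed

end

section \<open>Frequency of good blocks along a progression of differences\<close>

lemma sum_aligned_blocks_le:
  fixes g :: "nat \<Rightarrow> real"
  assumes g: "\<And>j. g j \<ge> 0" and L: "L > 0"
    and block: "\<And>e. (\<Sum>v<L. g (e * L + v)) \<le> real L * c"
  shows "(\<Sum>j<J. g (j + s)) \<le> (real J + 2 * real L) * c"
proof -
  define E where "E = {s div L..(s + J) div L}"
  have c: "c \<ge> 0"
  proof -
    have "0 \<le> (\<Sum>v<L. g (0 * L + v))" by (intro sum_nonneg g)
    then have "0 \<le> real L * c" using block[of 0] by linarith
    then show ?thesis using L by (simp add: zero_le_mult_iff)
  qed
  have "(\<Sum>j<J. g (j + s)) = (\<Sum>j\<in>{s..<s + J}. g j)"
    using sum.shift_bounds_nat_ivl[of g 0 s J] by (simp add: atLeast0LessThan add.commute)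
  also have "\<dots> = (\<Sum>p\<in>(\<lambda>j. (j div L, j mod L)) ` {s..<s + J}. g (fst p * L + snd p))"
  proof (subst sum.reindex)
    show "inj_on (\<lambda>j. (j div L, j mod L)) {s..<s + J}"
      by (rule inj_onI) (metis Pair_inject div_mult_mod_eq)
  qed simp
  also have "\<dots> \<le> (\<Sum>p\<in>E \<times> {..<L}. g (fst p * L + snd p))"
    by (intro sum_mono2) (auto simp: E_def g L intro!: div_le_mono)
  also have "\<dots> = (\<Sum>e\<in>E. \<Sum>v<L. g (e * L + v))"
    by (simp add: sum.cartesian_product case_prod_unfold)
  also have "\<dots> \<le> (\<Sum>e\<in>E. real L * c)" by (intro sum_mono block)
  also have "\<dots> = real (card E) * (real L * c)" by simp
  also have "\<dots> \<le> (real J / real L + 2) * (real L * c)"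
  proof (rule mult_right_mono)
    have "(s + J) div L * L \<le> s + J" by simp
    moreover have "s < (s div L + 1) * L" using L by (simp add: dividend_less_div_times)
    ultimately have "(s + J) div L * L \<le> J + (s div L + 1) * L" by linarith
    then have "real ((s + J) div L * L) \<le> real (J + (s div L + 1) * L)" by (simp only: of_nat_le_iff)
    then have "real ((s + J) div L) * real L \<le> real J + (real (s div L) + 1) * real L"
      by (simp only: of_nat_add of_nat_mult of_nat_1)
    then have "real ((s + J) div L) \<le> real J / real L + real (s div L) + 1"
      using L by (simp add: field_simps)
    moreover have "s div L \<le> (s + J) div L" by (intro div_le_mono) simp
    ultimately show "real (card E) \<le> real J / real L + 2" by (simp add: E_def of_nat_diff)
  qed (use c in auto)
  also have "\<dots> = (real J + 2 * real L) * c" using L by (simp add: field_simps)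
  finally show ?thesis .
qed

text \<open>\<open>s\<close> is the distance from \<open>\<gamma>\<close> up to a point congruent to
  \<open>a * X\<close> modulo \<open>b * X\<close>, and \<open>\<delta>\<close> is the number of
  steps needed to reach it. The overshoot is less than one step, hence less than
  \<open>r * X\<close>. Steps have length at least \<open>2 * X\<close>, so fewer than
  \<open>b\<close> of them suffice.\<close>

lemma exists_step_into_window:
  fixes \<gamma> g X a b r :: nat
  assumes g: "2 * X \<le> g" "g < r * X" and a: "a + r \<le> b" and b: "b \<ge> 2" and X: "X > 0"
  shows "\<exists>\<delta><b. ((\<gamma> + g * \<delta>) div X) mod b \<in> {a..<a + r}"
proof -
  define s where "s = (a * X + (b * X - \<gamma> mod (b * X))) mod (b * X)"
  define \<delta> where "\<delta> = (s + g - 1) div g"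
  have bX: "b * X > 0" and g0: "g > 0" using b X g by auto
  have s: "s < b * X" using bX by (simp add: s_def)
  have aX: "a * X < b * X" using a g X by (cases "r = 0") auto
  have "(\<gamma> + s) mod (b * X) = (\<gamma> mod (b * X) + (a * X + (b * X - \<gamma> mod (b * X)))) mod (b * X)"
    by (simp add: s_def mod_simps)
  also have "\<gamma> mod (b * X) + (a * X + (b * X - \<gamma> mod (b * X))) = a * X + b * X"
    using mod_less_divisor[OF bX, of \<gamma>] by linarith
  finally have \<gamma>s: "(\<gamma> + s) mod (b * X) = a * X" using aX by simp
  have d1: "s \<le> g * \<delta>"
  proof -
    have "s + g - 1 < g + g * \<delta>" unfolding \<delta>_def by (rule dividend_less_times_div[OF g0])
    then show ?thesis using g0 by linarith
  qed
  have d2: "g * \<delta> \<le> s + g - 1" unfolding \<delta>_def by simp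
  define e where "e = g * \<delta> - s"
  have e: "e < g" "\<gamma> + g * \<delta> = \<gamma> + s + e" using d1 d2 g0 by (auto simp: e_def)
  have lt: "a * X + e < (a + r) * X" using e g by (simp add: algebra_simps)
  also have "\<dots> \<le> b * X" using a by (intro mult_right_mono) auto
  finally have "(\<gamma> + g * \<delta>) mod (b * X) = a * X + e"
    unfolding e(2) using \<gamma>s by (metis mod_add_left_eq mod_less)
  moreover have "((\<gamma> + g * \<delta>) div X) mod b = ((\<gamma> + g * \<delta>) mod (b * X)) div X"
    using X by (simp add: mult.commute[of b X] mod_mult2_eq)
  ultimately have "((\<gamma> + g * \<delta>) div X) mod b = a + e div X" using X by simp
  moreover have "a + e div X < a + r"
    using e(1) g(2) X by (simp add: div_less_iff_less_mult)
  moreover have "\<delta> < b"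
  proof (rule ccontr)
    assume "\<not> \<delta> < b"
    then have "g * b \<le> g * \<delta>" by simp
    then have "g * b \<le> s + g - 1" using d2 by linarith
    then have "g * (b - 1) < b * X" using s g0 by (simp add: diff_mult_distrib2)
    moreover have "2 * X * (b - 1) \<le> g * (b - 1)" using g by (intro mult_right_mono) auto
    ultimately have "2 * X * (b - 1) < b * X" by (rule le_less_trans[rotated])
    then have "X * (2 * (b - 1)) < X * b" by (simp only: mult_ac)
    then have "2 * (b - 1) < b" by (simp only: mult_less_cancel1)
    then show False using b by linarith
  qed
  ultimately show ?thesis by (metis atLeastLessThan_iff le_add1)
qed

lemma sum_le_with_small_term:
  fixes \<phi> :: "nat \<Rightarrow> real"
  assumes "\<delta> < b" "\<phi> \<delta> \<le> c" "\<And>i. \<phi> i \<le> 1"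
  shows "(\<Sum>i<b. \<phi> i) \<le> real b * (1 - (1 - c) / real b)"
proof -
  have "(\<Sum>i<b. \<phi> i) = \<phi> \<delta> + (\<Sum>i\<in>{..<b} - {\<delta>}. \<phi> i)" using assms by (simp add: sum.remove)
  also have "\<dots> \<le> c + real (card ({..<b} - {\<delta>})) * 1"
    by (intro add_mono assms sum_bounded_above)
  also have "card ({..<b} - {\<delta>}) = b - 1" using assms by simp
  also have "c + real (b - 1) * 1 = real b * (1 - (1 - c) / real b)"
  proof -
    have "real b * (1 - (1 - c) / real b) = real b - real b * ((1 - c) / real b)"
      by (simp only: right_diff_distrib mult_1_right)
    also have "real b * ((1 - c) / real b) = 1 - c" using assms(1) by simp
    finally show ?thesis using assms(1) by (simp add: of_nat_diff)
  qed
  finally show ?thesis .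
qed

context digit_pattern
begin

lemma window_bound_le: "4 * k\<^sup>2 + 2 * q\<^sup>2 \<le> q ^ G" "2 * k < q ^ G" "2 \<le> q ^ G"
proof -
  have "F * 1 \<le> F * q ^ B" by (intro mult_le_mono2 q_power_ge_1)
  then have "F \<le> q ^ G" by (simp add: G F(1) power_add)
  then show "4 * k\<^sup>2 + 2 * q\<^sup>2 \<le> q ^ G" "2 * k < q ^ G" "2 \<le> q ^ G" using F(2) by linarith+
qed

text \<open>Since \<open>2 * t < q ^ (l + 2)\<close>, the digits \<open>v mod (q ^ G) ^ i\<close>
  move \<open>2 * t * D\<close> by less than \<open>q^2\<close> units of the block. The second
  condition of \<open>good\<close> may thus be tested without them in a window of length
  \<open>q^2\<close>, half of the length that \<open>good\<close> allows. The test then depends on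
  \<open>v\<close> only through \<open>v div (q ^ G) ^ i\<close>, which is the shape needed for
  averaging digit by digit.\<close>

lemma good_of_truncated:
  assumes r0: "r0 < q ^ Z" and v: "v < q ^ l" and t: "2 * t < q ^ (l + 2)" and i: "i < I"
    and main: "(y div (q ^ G) ^ i) mod q ^ G = 2 * k"
    and zone: "(2 * t * (e * q ^ (Z + l + I * G) + q ^ (Z + l) * y + r0 + q ^ Z * (q ^ G) ^ i * (v div (q ^ G) ^ i))
        div q ^ (Z + l + i * G)) mod q ^ G \<in> {4 * k\<^sup>2..<4 * k\<^sup>2 + q\<^sup>2}"
  shows "good t (e * q ^ (Z + l + I * G) + q ^ (Z + l) * y + q ^ Z * v + r0) (Z + l + i * G)"
proof -
  define b where "b = q ^ G"
  define X where "X = q ^ (Z + l + i * G)"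
  define D where "D = e * q ^ (Z + l + I * G) + q ^ (Z + l) * y + q ^ Z * v + r0"
  have X0: "X > 0" unfolding X_def by (rule q_pos)
  have b0: "b > 0" unfolding b_def by (rule q_pos)
  have low: "q ^ Z * v + r0 < q ^ (Z + l)"
  proof -
    have "q ^ Z * v + r0 < q ^ Z * (v + 1)" using r0 by simp
    also have "\<dots> \<le> q ^ Z * q ^ l" using v by (intro mult_le_mono2) simp
    finally show ?thesis by (simp add: power_add)
  qed
  have "D = (q ^ Z * v + r0) + (e * b ^ I + y) * q ^ (Z + l)"
    by (simp add: D_def b_def power_add power_mult[symmetric] algebra_simps)
  then have "D div q ^ (Z + l) = e * b ^ I + y" by (simp only: div_add_mult_eq[OF low])
  then have "D div X = (e * b ^ I + y) div b ^ i"
    by (simp add: X_def power_add[of q "Z + l"] div_mult2_eq b_def power_mult[symmetric] mult.commute)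
  also have "b ^ I = b * b ^ (I - Suc i) * b ^ i"
    using i by (simp flip: power_Suc power_add)
  then have "(e * b ^ I + y) div b ^ i = e * (b * b ^ (I - Suc i)) + y div b ^ i"
    using b0 by (simp add: mult.assoc[symmetric])
  finally have "D div X mod b = y div b ^ i mod b" by (simp add: mult.left_commute)
  then have 1: "D div X mod b = 2 * k" using main by (simp add: b_def)
  define \<Gamma> where "\<Gamma> = 2 * t * (e * q ^ (Z + l + I * G) + q ^ (Z + l) * y + r0 + q ^ Z * b ^ i * (v div b ^ i))"
  define p where "p = 2 * t * (q ^ Z * (v mod b ^ i))"
  have split: "2 * t * D = \<Gamma> + p"
  proof -
    have "q ^ Z * v = q ^ Z * b ^ i * (v div b ^ i) + q ^ Z * (v mod b ^ i)"
      by (metis distrib_left mult.assoc mult_div_mod_eq)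
    then show ?thesis by (simp add: D_def \<Gamma>_def p_def algebra_simps)
  qed
  have "2 * t * (q ^ Z * (v mod b ^ i)) \<le> q ^ (l + 2) * (q ^ Z * (v mod b ^ i))" using t by (intro mult_right_mono) auto
  also have "\<dots> < q ^ (l + 2) * (q ^ Z * b ^ i)"
    by (intro mult_strict_left_mono q_pos mod_less_divisor) (use b0 in simp)
  also have "\<dots> = q\<^sup>2 * X" by (simp add: X_def b_def power_add power_mult[symmetric] power2_eq_square mult_ac)
  finally have p: "p < q\<^sup>2 * X" by (simp add: p_def)
  define \<tau> where "\<tau> = \<Gamma> div X mod b"
  have \<tau>: "4 * k\<^sup>2 \<le> \<tau>" "\<tau> < 4 * k\<^sup>2 + q\<^sup>2" using zone by (auto simp: \<tau>_def \<Gamma>_def X_def b_def)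
  define d where "d = (\<Gamma> mod X + p) div X"
  have "(\<Gamma> + p) div X = \<Gamma> div X + d"
  proof -
    have "\<Gamma> + p = (\<Gamma> mod X + p) + \<Gamma> div X * X" by simp
    then have "(\<Gamma> + p) div X = ((\<Gamma> mod X + p) + \<Gamma> div X * X) div X" by (rule arg_cong)
    also have "\<dots> = \<Gamma> div X + (\<Gamma> mod X + p) div X"
      by (rule div_mult_self1) (use X0 in simp)
    finally show ?thesis by (simp only: d_def)
  qed
  \<comment> \<open>The 1 is a possible carry out of the part of \<open>\<Gamma>\<close> below the
    block. Even with \<open>d = q^2\<close>, \<open>\<tau> + d\<close> stays inside the window of
    length \<open>2 * q^2\<close>.\<close>
  moreover have "d < q\<^sup>2 + 1"
  proof -
    have "\<Gamma> mod X < X" using X0 by simp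
    then have "\<Gamma> mod X + p < (q\<^sup>2 + 1) * X" using p by (simp add: algebra_simps)
    then show ?thesis using X0 by (simp add: d_def div_less_iff_less_mult)
  qed
  moreover have "\<tau> + d < b" using \<tau> \<open>d < q\<^sup>2 + 1\<close> window_bound_le(1) by (simp add: b_def)
  ultimately have "(\<Gamma> + p) div X mod b = \<tau> + d" by (metis \<tau>_def mod_add_left_eq mod_less)
  then have "(2 * t * D div X) mod b \<in> {4 * k\<^sup>2..<4 * k\<^sup>2 + 2 * q\<^sup>2}"
    unfolding split using \<tau> \<open>d < q\<^sup>2 + 1\<close> by auto
  with 1 show ?thesis by (simp add: good_def D_def X_def b_def)
qed

text \<open>The digits of \<open>y\<close> decide which blocks of \<open>D\<close> equal
  \<open>2 * k\<close>. At such a block, raising the matching digit of \<open>v\<close> by one moves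
  \<open>2 * t * D\<close> by at least \<open>q\<close> and less than \<open>q^2\<close> units, so
  some value of that digit hits the target window. Each of the two events is granted a frequency
  \<open>1 / q ^ G\<close>, whence the square. \<open>I * G \<le> l\<close> gives \<open>v\<close> a
  digit for each block.\<close>

lemma good_block_average:
  assumes r0: "r0 < q ^ Z" and t: "q ^ (l + 1) \<le> 2 * t" "2 * t < q ^ (l + 2)" and I: "I * G \<le> l"
    and c: "0 \<le> c" "c \<le> 1"
  shows "(\<Sum>y<(q ^ G) ^ I. \<Sum>v<q ^ l. \<Prod>i<I. if good t (e * q ^ (Z + l + I * G) + q ^ (Z + l) * y + q ^ Z * v + r0) (Z + l + i * G) then c else 1)
    \<le> real (q ^ l) * real ((q ^ G) ^ I) * (1 - (1 - c) / (real (q ^ G))\<^sup>2) ^ I"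
proof -
  define b where "b = q ^ G"
  define c2 where "c2 = 1 - (1 - c) / real b"
  define c3 where "c3 = 1 - (1 - c) / (real b)\<^sup>2"
  have b2: "b \<ge> 2" using window_bound_le by (simp add: b_def)
  have c2: "0 \<le> c2" "c2 \<le> 1" using c b2 by (simp_all add: c2_def field_simps)
  have c3: "c3 = 1 - (1 - c2) / real b" using b2 by (simp add: c2_def c3_def power2_eq_square field_simps)
  have ql: "q ^ l = b ^ I * q ^ (l - I * G)"
    using I by (simp add: b_def power_mult[symmetric] power_add[symmetric] mult.commute)
  define main where "main y i \<longleftrightarrow> (y div b ^ i) mod b = 2 * k" for y i
  define \<phi> where "\<phi> y i z = (if main y i \<and> (2 * t * (e * q ^ (Z + l + I * G) + q ^ (Z + l) * y + r0 + q ^ Z * b ^ i * z)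
        div q ^ (Z + l + i * G)) mod b \<in> {4 * k\<^sup>2..<4 * k\<^sup>2 + q\<^sup>2} then c else 1)" for y i z
  have inner: "(\<Sum>v<q ^ l. \<Prod>i<I. if good t (e * q ^ (Z + l + I * G) + q ^ (Z + l) * y + q ^ Z * v + r0) (Z + l + i * G) then c else 1)
     \<le> real (q ^ l) * (\<Prod>i<I. if main y i then c2 else 1)" for y
  proof -
    have "(\<Sum>v<q ^ l. \<Prod>i<I. if good t (e * q ^ (Z + l + I * G) + q ^ (Z + l) * y + q ^ Z * v + r0) (Z + l + i * G) then c else 1)
       \<le> (\<Sum>v<q ^ l. \<Prod>i<I. \<phi> y i (v div b ^ i))"
    proof (intro sum_mono prod_mono conjI)
      fix v i assume "v \<in> {..<q ^ l}" "i \<in> {..<I}"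
      then show "(if good t (e * q ^ (Z + l + I * G) + q ^ (Z + l) * y + q ^ Z * v + r0) (Z + l + i * G) then c else 1) \<le> \<phi> y i (v div b ^ i)"
        using good_of_truncated[OF r0 _ t(2), of v i I y e] c unfolding \<phi>_def main_def b_def by auto
    qed (use c in auto)
    also have "\<dots> \<le> real (q ^ (l - I * G)) * (\<Prod>i<I. real b * (if main y i then c2 else 1))"
      unfolding ql
    proof (rule digit_average_bound)
      show "b > 0" using b2 by simp
      show "\<phi> y i z \<ge> 0" for i z using c by (simp add: \<phi>_def)
      fix i z assume i: "i < I"
      show "(\<Sum>\<delta><b. \<phi> y i (z * b + \<delta>)) \<le> real b * (if main y i then c2 else 1)"
      proof (cases "main y i")
        case False
        then show ?thesis by (simp add: \<phi>_def)
      next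
        case True
        define X where "X = q ^ (Z + l + i * G)"
        define g where "g = 2 * t * (q ^ Z * b ^ i)"
        define \<gamma> where "\<gamma> = 2 * t * (e * q ^ (Z + l + I * G) + q ^ (Z + l) * y + r0 + q ^ Z * b ^ i * (z * b))"
        have Xq: "q * X = q ^ (l + 1) * (q ^ Z * b ^ i)" "q\<^sup>2 * X = q ^ (l + 2) * (q ^ Z * b ^ i)"
          by (simp_all add: X_def b_def power_add power_mult[symmetric] power2_eq_square mult_ac)
        have zb: "q ^ Z * b ^ i > 0" using q_pos[of Z] b2 by simp
        have "2 * X \<le> q * X" using q2 by simp
        also have "\<dots> \<le> g" unfolding Xq g_def using t by (intro mult_right_mono) auto
        finally have 1: "2 * X \<le> g" .
        have 2: "g < q\<^sup>2 * X" unfolding Xq g_def using t zb by (intro mult_strict_right_mono) auto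
        have "4 * k\<^sup>2 + q\<^sup>2 \<le> b" using window_bound_le(1) by (simp add: b_def)
        then obtain \<delta> where \<delta>: "\<delta> < b" "((\<gamma> + g * \<delta>) div X) mod b \<in> {4 * k\<^sup>2..<4 * k\<^sup>2 + q\<^sup>2}"
          using exists_step_into_window[OF 1 2 _ b2] q_pos[of "Z + l + i * G"] unfolding X_def by blast
        have "\<gamma> + g * \<delta> = 2 * t * (e * q ^ (Z + l + I * G) + q ^ (Z + l) * y + r0 + q ^ Z * b ^ i * (z * b + \<delta>))"
          by (simp add: \<gamma>_def g_def algebra_simps)
        then have "\<phi> y i (z * b + \<delta>) = c" using True \<delta>(2) by (simp add: \<phi>_def X_def)
        then have "(\<Sum>\<delta><b. \<phi> y i (z * b + \<delta>)) \<le> real b * c2"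
          unfolding c2_def using \<delta>(1) c by (intro sum_le_with_small_term[where \<delta> = \<delta>]) (auto simp: \<phi>_def)
        then show ?thesis using True by simp
      qed
    qed
    also have "\<dots> = real (q ^ l) * (\<Prod>i<I. if main y i then c2 else 1)"
      unfolding ql by (simp add: prod.distrib mult_ac)
    finally show ?thesis .
  qed
  have "(\<Sum>y<b ^ I. \<Prod>i<I. if main y i then c2 else 1) \<le> real b ^ I * c3 ^ I"
  proof -
    have "(\<Sum>y<b ^ I * 1. \<Prod>i<I. (\<lambda>i z. if z mod b = 2 * k then c2 else 1) i (y div b ^ i)) \<le> real 1 * (\<Prod>i<I. real b * (\<lambda>_. c3) i)"
    proof (rule digit_average_bound)
      show "b > 0" using b2 by simp
      show "0 \<le> (if z mod b = 2 * k then c2 else 1)" for z using c2 by simp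
      fix z
      show "(\<Sum>\<delta><b. if (z * b + \<delta>) mod b = 2 * k then c2 else 1) \<le> real b * c3"
        unfolding c3 using window_bound_le(2) c2
        by (intro sum_le_with_small_term[where \<delta> = "2 * k"]) (auto simp: b_def)
    qed
    then show ?thesis by (simp add: main_def power_mult_distrib)
  qed
  then have outer: "real (q ^ l) * (\<Sum>y<b ^ I. \<Prod>i<I. if main y i then c2 else 1) \<le> real (q ^ l) * (real b ^ I * c3 ^ I)"
    by (intro mult_left_mono) auto
  have "(\<Sum>y<b ^ I. \<Sum>v<q ^ l. \<Prod>i<I. if good t (e * q ^ (Z + l + I * G) + q ^ (Z + l) * y + q ^ Z * v + r0) (Z + l + i * G) then c else 1)
    \<le> (\<Sum>y<b ^ I. real (q ^ l) * (\<Prod>i<I. if main y i then c2 else 1))"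
    by (intro sum_mono inner)
  also have "\<dots> \<le> real (q ^ l) * (real b ^ I * c3 ^ I)" using outer by (simp add: sum_distrib_left)
  finally show ?thesis by (simp add: b_def c3_def)
qed

text \<open>Over an aligned stretch of length \<open>L\<close> the digits of
  \<open>q ^ h * j\<close> split into three groups: \<open>r\<close> from \<open>h\<close> to
  \<open>Z\<close>, \<open>v\<close> from \<open>Z\<close> to \<open>Z + l\<close>, and
  \<open>y\<close> on the next \<open>I * G\<close> positions. The incomplete stretches at both ends
  cost \<open>2 * L \<le> 2 * J\<close>, which makes the factor 3.\<close>

lemma good_average:
  assumes t: "q ^ (l + 1) \<le> 2 * t" "2 * t < q ^ (l + 2)" and I: "I * G \<le> l" and h: "h \<le> Z"
    and J: "q ^ (Z + l + I * G - h) \<le> J" and c: "0 \<le> c" "c \<le> 1"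
  shows "(\<Sum>j<J. \<Prod>i<I. if good t (q ^ h * (j + s)) (Z + l + i * G) then c else 1)
    \<le> 3 * real J * (1 - (1 - c) / (real (q ^ G))\<^sup>2) ^ I"
proof -
  define L where "L = q ^ (Z + l + I * G - h)"
  define c3 where "c3 = 1 - (1 - c) / (real (q ^ G))\<^sup>2"
  define g where "g j = (\<Prod>i<I. if good t (q ^ h * j) (Z + l + i * G) then c else 1)" for j
  have g0: "g j \<ge> 0" for j unfolding g_def using c by (intro prod_nonneg) auto
  have Leq: "L = ((q ^ G) ^ I * q ^ l) * q ^ (Z - h)"
  proof -
    have "Z + l + I * G - h = G * I + l + (Z - h)" using h by (simp add: mult.commute)
    then show ?thesis by (simp only: L_def power_add power_mult)
  qed
  have "(\<Sum>j<J. g (j + s)) \<le> (real J + 2 * real L) * c3 ^ I"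
  proof (rule sum_aligned_blocks_le)
    show "L > 0" unfolding L_def by (rule q_pos)
    fix e
    have "(\<Sum>v<L. g (e * L + v)) = (\<Sum>i<(q ^ G) ^ I * q ^ l. \<Sum>r<q ^ (Z - h). g (e * L + (i * q ^ (Z - h) + r)))"
      unfolding Leq by (rule sum_lessThan_mult)
    also have "\<dots> = (\<Sum>y<(q ^ G) ^ I. \<Sum>v<q ^ l. \<Sum>r<q ^ (Z - h). g (e * L + ((y * q ^ l + v) * q ^ (Z - h) + r)))"
      by (rule sum_lessThan_mult)
    also have "\<dots> = (\<Sum>r<q ^ (Z - h). \<Sum>y<(q ^ G) ^ I. \<Sum>v<q ^ l. g (e * L + ((y * q ^ l + v) * q ^ (Z - h) + r)))"
      by (rule sum_swap3[symmetric])
    also have "\<dots> \<le> (\<Sum>r<q ^ (Z - h). real (q ^ l) * real ((q ^ G) ^ I) * c3 ^ I)"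
    proof (rule sum_mono)
      fix r assume "r \<in> {..<q ^ (Z - h)}"
      then have "q ^ h * r < q ^ h * q ^ (Z - h)" using q_pos[of h] by (intro mult_strict_left_mono) auto
      then have r: "q ^ h * r < q ^ Z" using h by (simp add: power_add[symmetric])
      have "q ^ h * (e * L + ((y * q ^ l + v) * q ^ (Z - h) + r))
        = e * q ^ (Z + l + I * G) + q ^ (Z + l) * y + q ^ Z * v + q ^ h * r" for y v
      proof -
        have "h + (Z + l + I * G - h) = Z + l + I * G" using h by simp
        then have "q ^ (Z + l + I * G) = q ^ h * L" by (simp only: L_def power_add[symmetric])
        moreover have "q ^ Z = q ^ h * q ^ (Z - h)" using h by (simp add: power_add[symmetric])
        moreover have "q ^ h * (e * L + ((y * q ^ l + v) * q ^ (Z - h) + r))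
          = e * (q ^ h * L) + (q ^ h * q ^ (Z - h)) * q ^ l * y + (q ^ h * q ^ (Z - h)) * v + q ^ h * r"
          by (simp add: algebra_simps)
        ultimately show ?thesis by (simp only: power_add[of q Z l])
      qed
      then show "(\<Sum>y<(q ^ G) ^ I. \<Sum>v<q ^ l. g (e * L + ((y * q ^ l + v) * q ^ (Z - h) + r)))
          \<le> real (q ^ l) * real ((q ^ G) ^ I) * c3 ^ I"
        unfolding g_def c3_def using good_block_average[OF r t I c, of e] by simp
    qed
    also have "\<dots> = real L * c3 ^ I" by (simp add: Leq)
    finally show "(\<Sum>v<L. g (e * L + v)) \<le> real L * c3 ^ I" .
  qed (rule g0)
  also have "\<dots> \<le> (3 * real J) * c3 ^ I"
  proof (rule mult_right_mono)
    have "real L \<le> real J" using J by (simp add: L_def flip: of_nat_power)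
    then show "real J + 2 * real L \<le> 3 * real J" by simp
    define N where "N = (real (q ^ G))\<^sup>2"
    have "1 \<le> N" unfolding N_def using q_power_ge_1[of G] by (intro one_le_power) (simp flip: of_nat_power)
    then have "(1 - c) / N \<le> 1" using c by (subst divide_le_eq_1_pos) auto
    then show "0 \<le> c3 ^ I" by (intro zero_le_power) (simp add: c3_def N_def)
  qed
  finally show ?thesis by (simp add: g_def c3_def)
qed

end

section \<open>Reduction to a window\<close>

lemma bij_betw_add_mod:
  fixes c d :: nat
  assumes "d > 0"
  shows "bij_betw (\<lambda>j. (j + c) mod d) {..<d} {..<d}"
proof -
  have "inj_on (\<lambda>j. (j + c) mod d) {..<d}"
  proof (rule inj_onI)
    fix x y assume xy: "x \<in> {..<d}" "y \<in> {..<d}" "(x + c) mod d = (y + c) mod d"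
    then have "[x = y] (mod d)" by (simp only: cong_def[symmetric] cong_add_rcancel_nat)
    with xy show "x = y" by (simp add: cong_def)
  qed
  moreover have "(\<lambda>j. (j + c) mod d) ` {..<d} \<subseteq> {..<d}" using assms by auto
  ultimately show ?thesis by (simp add: bij_betw_def endo_inj_surj)
qed

lemma sum_add_mod:
  fixes h :: "nat \<Rightarrow> 'a::comm_monoid_add"
  shows "(\<Sum>j<d. h ((j + c) mod d)) = (\<Sum>j<d. h j)"
  using sum.reindex_bij_betw[OF bij_betw_add_mod[of d c], of h] by (cases "d = 0") auto

lemma sum_periodic_shift:
  fixes h :: "nat \<Rightarrow> 'a::comm_monoid_add"
  assumes "\<And>j. h (j mod d) = h j"
  shows "(\<Sum>j<d. h (j + c)) = (\<Sum>j<d. h j)"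
  using sum_add_mod[where h = h and d = d and c = c] by (simp only: assms)

lemma card_near_boundary_le:
  fixes a c d e g :: nat
  shows "card {w \<in> {..<g * d}. \<not> (a \<le> (w + c) mod d \<and> (w + c) mod d < d - e)} \<le> g * (a + e)"
proof -
  define h :: "nat \<Rightarrow> nat" where "h y = of_bool (\<not> (a \<le> y \<and> y < d - e))" for y
  have "card {w \<in> {..<g * d}. \<not> (a \<le> (w + c) mod d \<and> (w + c) mod d < d - e)}
    = (\<Sum>w<g * d. h ((w + c) mod d))"
    by (simp add: h_def Int_def)
  also have "\<dots> = (\<Sum>i<g. \<Sum>j<d. h ((i * d + j + c) mod d))" by (rule sum_lessThan_mult)
  also have "\<dots> = (\<Sum>i<g. \<Sum>j<d. h ((j + c) mod d))" by (simp add: add.assoc)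
  also have "\<dots> = g * (\<Sum>j<d. h j)" by (simp add: sum_add_mod)
  also have "(\<Sum>j<d. h j) = card {y \<in> {..<d}. \<not> (a \<le> y \<and> y < d - e)}"
    by (simp add: h_def Int_def)
  also have "\<dots> \<le> card ({..<a} \<union> {d - e..<d})" by (intro card_mono) auto
  also have "\<dots> \<le> a + e" by (rule order_trans[OF card_Un_le]) auto
  finally show ?thesis by simp
qed

text \<open>If adding \<open>v < d\<close> wrapped around, the new residue would be smaller than
  \<open>v\<close>.\<close>

lemma no_carry:
  fixes Z v d :: nat
  assumes "v \<le> (Z + v) mod d" "d > 0"
  shows "(Z + v) mod d = Z mod d + v" "(Z + v) div d = Z div d"
proof -
  have vd: "v < d" using assms mod_less_divisor[of d "Z + v"] by linarith
  have lt: "Z mod d + v < d"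
  proof (rule ccontr)
    assume nl: "\<not> Z mod d + v < d"
    then have "d \<le> Z mod d + v" by simp
    moreover have "Z mod d + v - d < d" using vd mod_less_divisor[OF assms(2), of Z] by linarith
    ultimately have "(Z mod d + v) mod d = Z mod d + v - d" by (simp only: le_mod_geq mod_less)
    moreover have "(Z mod d + v) mod d = (Z + v) mod d" by (simp add: mod_simps)
    ultimately have *: "v \<le> Z mod d + v - d" using assms(1) by (simp only:)
    have "r + v - d < v" if "r < d" "\<not> r + v < d" for r using that vd by linarith
    from this[OF mod_less_divisor[OF assms(2)] nl] * show False by (meson leD)
  qed
  have "Z + v = (Z mod d + v) + (Z div d) * d" by simp
  then have "(Z + v) div d = Z div d" by (metis div_add_mult_eq[OF lt])
  then show "(Z + v) div d = Z div d" .
  have "(Z mod d + v) mod d = (Z + v) mod d" by (simp add: mod_simps)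
  then show "(Z + v) mod d = Z mod d + v" using lt by simp
qed

text \<open>The assumptions concern \<open>Z + v\<close> instead of \<open>Z\<close>, because
  equidistribution is available only for the smoothed squares.\<close>

lemma add_div_eq_of_mod_bounds:
  fixes Z v e d E :: nat
  assumes "v \<le> (Z + v) mod d" "(Z + v) mod d < d - E" "e \<le> E"
  shows "(Z + e) div d = (Z + v) div d"
proof -
  have d: "d > 0" using assms(2) by linarith
  have "Z mod d + e < d" using no_carry(1)[OF assms(1) d] assms(2,3) by linarith
  moreover have "Z + e = (Z mod d + e) + (Z div d) * d" by simp
  ultimately have "(Z + e) div d = Z div d" by (metis div_add_mult_eq)
  then show ?thesis using no_carry(2)[OF assms(1) d] by simp
qed

text \<open>A prime occurs at most \<open>i\<close> times in \<open>s \<le> 2 ^ i\<close>, and if it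
  divides the gcd it also divides \<open>q\<close>.\<close>

lemma gcd_power_dvd_power:
  fixes s q :: nat
  assumes s: "0 < s" "s \<le> 2 ^ i" and q: "q > 0"
  shows "gcd s (q ^ a) dvd q ^ i"
proof (rule multiplicity_le_imp_dvd)
  show "gcd s (q ^ a) \<noteq> 0" using s by simp
  fix p :: nat assume p: "prime p"
  define j where "j = multiplicity p (gcd s (q ^ a))"
  show "multiplicity p (gcd s (q ^ a)) \<le> multiplicity p (q ^ i)"
  proof (cases "j = 0")
    case True
    then show ?thesis by (simp add: j_def)
  next
    case False
    have dvd: "p ^ j dvd gcd s (q ^ a)" unfolding j_def by (rule multiplicity_dvd)
    then have "p ^ j \<le> s" using s by (meson dvd_imp_le dvd_trans gcd_dvd1)
    moreover have "2 ^ j \<le> p ^ j" using p by (intro power_mono prime_ge_2_nat) auto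
    ultimately have "(2::nat) ^ j \<le> 2 ^ i" using s by linarith
    then have ji: "j \<le> i" by simp
    have "p dvd q ^ a" using dvd False by (meson dvd_power dvd_trans gcd_dvd2 neq0_conv)
    then have "p dvd q" using p prime_dvd_power by blast
    then have "p ^ j dvd q ^ i" using ji by (meson dvd_power_same dvd_trans le_imp_power_dvd)
    then show ?thesis unfolding j_def[symmetric] using p q by (intro multiplicity_geI) auto
  qed
qed

lemma exists_power_multiple:
  fixes s q Q :: nat
  assumes s: "0 < s" "s \<le> 2 ^ i" and q: "q > 0"
  shows "\<exists>c. [s * Q * c = q ^ i * Q] (mod q ^ a * Q)"
proof -
  obtain c' where c': "[s * c' = gcd s (q ^ a)] (mod q ^ a)" using cong_solve_nat[of s "q ^ a"] s by auto
  obtain e where e: "q ^ i = gcd s (q ^ a) * e" using gcd_power_dvd_power[OF s q, of a] by blast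
  have "[s * c' * e = gcd s (q ^ a) * e] (mod q ^ a)" by (intro cong_mult c' cong_refl)
  then have "[s * c' * e = q ^ i] (mod q ^ a)" by (simp only: e[symmetric])
  then have "[s * c' * e * Q = q ^ i * Q] (mod q ^ a * Q)" by (simp add: cong_def mod_mult_mult2)
  then show ?thesis by (intro exI[of _ "c' * e"]) (simp add: mult_ac)
qed

lemma mult_cnj_eq_1: "cmod x = 1 \<Longrightarrow> x * cnj x = 1"
  by (metis complex_norm_square of_real_1 one_power2)

section \<open>Separating the window from the digits above and below it\<close>

context digit_phase
begin

definition top_part :: "nat \<Rightarrow> nat \<Rightarrow> complex" where
  "top_part l z = \<chi> l z * cnj (\<chi> l (z mod q ^ m))"

definition bottom_part :: "nat \<Rightarrow> nat \<Rightarrow> nat \<Rightarrow> complex" where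
  "bottom_part \<mu> l z = \<chi> l z * cnj (\<chi> l (z div q ^ \<mu>))"

lemma mod_power_div_power:
  assumes "a \<le> c"
  shows "(z mod q ^ c) div q ^ a = (z div q ^ a) mod q ^ (c - a)"
proof -
  have "q ^ c = q ^ a * q ^ (c - a)" using assms by (simp add: power_add[symmetric])
  then have "z mod q ^ c = z mod q ^ a + ((z div q ^ a) mod q ^ (c - a)) * q ^ a"
    by (simp add: mod_mult2_eq)
  then show ?thesis using div_add_mult_eq[of "z mod q ^ a" "q ^ a"] q_pos[of a] by simp
qed

lemma unimodular_solve:
  assumes "\<chi> l x * \<chi> l y = \<chi> l z * \<chi> l w"
  shows "\<chi> l x = \<chi> l z * (\<chi> l w * cnj (\<chi> l y))"
proof -
  have "\<chi> l x = \<chi> l x * (\<chi> l y * cnj (\<chi> l y))" by (simp add: chi_cnj)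
  also have "\<dots> = \<chi> l z * \<chi> l w * cnj (\<chi> l y)" by (simp add: assms mult.assoc[symmetric])
  finally show ?thesis by (simp add: mult_ac)
qed

text \<open>\<open>low_part\<close> is applied at both ends of the window. Blocks have length
  \<open>m\<close>, so the upper factor reads digits from \<open>\<kappa> - m\<close> on and the
  lower one digits below \<open>\<mu> + m\<close>; each overlaps the window in \<open>m\<close>
  digits.\<close>

lemma chi_factorization:
  assumes "\<mu> + m \<le> \<kappa>"
  shows "\<chi> l Z = top_part l (Z div q ^ (\<kappa> - m)) * bottom_part \<mu> l (Z mod q ^ (\<mu> + m)) * window \<mu> \<kappa> l Z"
proof -
  have km: "\<kappa> - m + m = \<kappa>" "\<kappa> - (\<kappa> - m) = m" using assms by auto
  define Z' where "Z' = Z mod q ^ \<kappa>"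
  have "Z mod q ^ (\<kappa> - m + m) = Z' mod q ^ (\<kappa> - m + m)" unfolding km by (simp add: Z'_def)
  from unimodular_solve[OF low_part[OF this, of l]]
  have 1: "\<chi> l Z = \<chi> l Z' * top_part l (Z div q ^ (\<kappa> - m))"
    unfolding top_part_def Z'_def using mod_power_div_power[of "\<kappa> - m" \<kappa> Z] km by simp
  have "Z' mod q ^ (\<mu> + m) = (Z mod q ^ (\<mu> + m)) mod q ^ (\<mu> + m)"
    unfolding Z'_def using assms by (simp add: mod_mod_cancel le_imp_power_dvd)
  from low_part[OF this, of l]
  have "\<chi> l Z' * \<chi> l ((Z mod q ^ (\<mu> + m)) div q ^ \<mu>) = \<chi> l (Z' div q ^ \<mu>) * \<chi> l (Z mod q ^ (\<mu> + m))"
    by (simp only: mult.commute)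
  from unimodular_solve[OF this]
  have "\<chi> l Z' = window \<mu> \<kappa> l Z * bottom_part \<mu> l (Z mod q ^ (\<mu> + m))"
    by (simp add: window_def Z'_def bottom_part_def)
  with 1 show ?thesis by (simp add: mult_ac)
qed

text \<open>The arguments belong to \<open>(r, s)\<close>, \<open>(r', s)\<close>,
  \<open>(r, s')\<close>, \<open>(r', s')\<close> in this order. Equal \<open>s\<close> means
  agreement above the window, equal \<open>r\<close> agreement below it, so every outer factor meets
  its own conjugate.\<close>

lemma four_product_cancel:
  assumes "\<mu> + m \<le> \<kappa>"
    and top: "a div q ^ (\<kappa> - m) = b div q ^ (\<kappa> - m)" "c div q ^ (\<kappa> - m) = d div q ^ (\<kappa> - m)"
    and bot: "a mod q ^ (\<mu> + m) = c mod q ^ (\<mu> + m)" "b mod q ^ (\<mu> + m) = d mod q ^ (\<mu> + m)"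
  shows "\<chi> l a * cnj (\<chi> l b) * cnj (\<chi> l c) * \<chi> l d
    = window \<mu> \<kappa> l a * cnj (window \<mu> \<kappa> l b) * cnj (window \<mu> \<kappa> l c) * window \<mu> \<kappa> l d"
proof -
  have uni: "top_part l z * cnj (top_part l z) = 1" "bottom_part \<mu> l z * cnj (bottom_part \<mu> l z) = 1" for z
    by (rule mult_cnj_eq_1, simp add: top_part_def bottom_part_def norm_mult norm_chi)+
  have alg: "(t1 * g1 * w1) * cnj (t1 * g2 * w2) * cnj (t2 * g1 * w3) * (t2 * g2 * w4)
     = (t1 * cnj t1) * (t2 * cnj t2) * (g1 * cnj g1) * (g2 * cnj g2) * (w1 * cnj w2 * cnj w3 * w4)"
    for t1 t2 g1 g2 w1 w2 w3 w4 :: complex by (simp add: mult_ac)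
  show ?thesis
    by (simp only: chi_factorization[OF assms(1), of l a] chi_factorization[OF assms(1), of l b]
        chi_factorization[OF assms(1), of l c] chi_factorization[OF assms(1), of l d] top bot alg uni) simp
qed

lemma window_cong: "[z = z'] (mod q ^ \<kappa>) \<Longrightarrow> window \<mu> \<kappa> l z = window \<mu> \<kappa> l z'"
  by (simp add: window_def cong_def)

lemma window_div_cong:
  assumes "\<mu> \<le> \<kappa>" "z div q ^ \<mu> = z' div q ^ \<mu>"
  shows "window \<mu> \<kappa> l z = window \<mu> \<kappa> l z'"
  using assms by (simp add: window_def mod_power_div_power)

definition phase :: "nat \<Rightarrow> complex" where
  "phase n = (\<Prod>l<k. \<chi> l ((n + l)\<^sup>2))"

lemma norm_phase: "cmod (phase n) = 1"
  unfolding phase_def prod_norm[symmetric] by (simp add: norm_chi)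

definition box :: "nat \<Rightarrow> nat \<Rightarrow> nat \<Rightarrow> nat \<Rightarrow> nat \<Rightarrow> nat \<Rightarrow> complex" where
  "box Q r r' s s' n = phase (n + r + s * Q) * cnj (phase (n + r' + s * Q)) *
     cnj (phase (n + r + s' * Q)) * phase (n + r' + s' * Q)"

text \<open>Stands for \<open>(n + a + s * Q)^2\<close> modulo \<open>q ^ \<kappa>\<close>. The
  square \<open>n^2\<close> is replaced by the residue \<open>w\<close>, the \<open>n\<close> in
  \<open>2 * n * a\<close> by the left end \<open>x\<close> of its interval, and the
  \<open>n\<close> in \<open>2 * n * s * Q\<close> by its residue \<open>c\<close>. The small term
  \<open>a^2\<close> is dropped, and \<open>(s * Q)^2\<close> vanishes.\<close>

definition model_arg :: "nat \<Rightarrow> nat \<Rightarrow> nat \<Rightarrow> nat \<Rightarrow> nat \<Rightarrow> nat \<Rightarrow> nat" where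
  "model_arg Q x c w a s = w + 2 * x * a + 2 * (c + a) * (s * Q)"

definition model :: "nat \<Rightarrow> nat \<Rightarrow> nat \<Rightarrow> nat \<Rightarrow> nat \<Rightarrow> nat \<Rightarrow> nat \<Rightarrow> nat \<Rightarrow> nat \<Rightarrow> nat \<Rightarrow> complex" where
  "model \<mu> \<kappa> Q r r' s s' x c w = (\<Prod>l<k.
     window \<mu> \<kappa> l (model_arg Q x c w (r + l) s) * cnj (window \<mu> \<kappa> l (model_arg Q x c w (r' + l) s)) *
     cnj (window \<mu> \<kappa> l (model_arg Q x c w (r + l) s')) * window \<mu> \<kappa> l (model_arg Q x c w (r' + l) s'))"

lemma norm_model: "cmod (model \<mu> \<kappa> Q r r' s s' x c w) = 1"
  unfolding model_def prod_norm[symmetric] by (simp add: norm_mult norm_window)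

lemma norm_box: "cmod (box Q r r' s s' n) = 1"
  by (simp add: box_def norm_mult norm_phase)

text \<open>Residues \<open>w\<close> at which the perturbations by at most \<open>E\<close> and \<open>E'\<close>, and the smoothing by less than
  \<open>L\<close>, cause no carry into the window and out of it, respectively.\<close>

definition regular :: "nat \<Rightarrow> nat \<Rightarrow> nat \<Rightarrow> nat \<Rightarrow> nat \<Rightarrow> nat \<Rightarrow> nat set \<Rightarrow> nat set \<Rightarrow> nat \<Rightarrow> nat \<Rightarrow> nat \<Rightarrow> bool" where
  "regular \<mu> \<kappa> Q L E E' A S x c w \<longleftrightarrow>
     (\<forall>a\<in>A. L \<le> (w + 2 * x * a) mod q ^ \<mu> \<and> (w + 2 * x * a) mod q ^ \<mu> < q ^ \<mu> - E) \<and>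
     (\<forall>s\<in>S. L \<le> (w + 2 * c * (s * Q)) mod q ^ (\<kappa> - m) \<and> (w + 2 * c * (s * Q)) mod q ^ (\<kappa> - m) < q ^ (\<kappa> - m) - E')"

text \<open>\<open>E\<close> bounds \<open>2 * (n - x) * a + a^2\<close>, the part lost in the
  model, which must not carry into the window from below. \<open>E'\<close> bounds the whole change
  \<open>2 * (n + s * Q) * a + a^2\<close> caused by \<open>a\<close>, which must not carry out at
  the top.\<close>

lemma regular_step:
  assumes Q: "Q = q ^ (\<mu> + m)" and \<kappa>: "\<mu> + m \<le> \<kappa>" "\<kappa> \<le> 2 * (\<mu> + m)"
    and A: "A * Q = q ^ \<kappa>" "[n = c] (mod A)" and x: "x \<le> n" "n \<le> x + H"
    and w: "w = (n\<^sup>2 + v) mod q ^ \<kappa>" "v \<le> L"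
    and reg: "regular \<mu> \<kappa> Q L E E' As S x c w" and a: "a \<in> As" and s: "s \<in> S"
    and E: "2 * H * a + a\<^sup>2 \<le> E" and E': "2 * (n + s * Q) * a + a\<^sup>2 \<le> E'"
  shows "(n + a + s * Q)\<^sup>2 div q ^ (\<kappa> - m) = (n + s * Q)\<^sup>2 div q ^ (\<kappa> - m)"
    and "(n + a + s * Q)\<^sup>2 mod Q = (n + a)\<^sup>2 mod Q"
    and "window \<mu> \<kappa> l ((n + a + s * Q)\<^sup>2) = window \<mu> \<kappa> l (model_arg Q x c w a s)"
proof -
  define M where "M = q ^ \<kappa>"
  have QQ: "M dvd Q * Q"
    unfolding M_def Q power_add[symmetric] by (rule le_imp_power_dvd) (use \<kappa> in simp)
  have Q2: "[n\<^sup>2 + y + (s * Q)\<^sup>2 = n\<^sup>2 + y] (mod M)" for n y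
  proof -
    have "(s * Q)\<^sup>2 = (s * s) * (Q * Q)" by (simp add: power2_eq_square mult_ac)
    then have "M dvd (s * Q)\<^sup>2" using QQ by (simp only: dvd_mult)
    then have "[(s * Q)\<^sup>2 = 0] (mod M)" by (simp add: cong_0_iff)
    then have "[n\<^sup>2 + y + (s * Q)\<^sup>2 = n\<^sup>2 + y + 0] (mod M)" by (intro cong_add cong_refl)
    then show ?thesis by simp
  qed
  have wc: "[w = n\<^sup>2 + v] (mod M)" by (simp add: w M_def cong_def)
  \<comment> \<open>A congruence modulo \<open>A\<close> becomes one modulo \<open>A * Q = M\<close>
    after multiplication by \<open>Q\<close>.\<close>
  have nQ: "[2 * (n + y) * (s * Q) = 2 * (c + y) * (s * Q)] (mod M)" for y
  proof -
    have "[n * Q = c * Q] (mod A * Q)" using A(2) by (simp add: cong_def mod_mult_mult2)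
    then have "[n * Q = c * Q] (mod M)" by (simp add: A M_def)
    then have "[2 * s * (n * Q + y * Q) = 2 * s * (c * Q + y * Q)] (mod M)"
      by (rule cong_mult[OF cong_refl cong_add[OF _ cong_refl]])
    then show ?thesis by (simp add: algebra_simps)
  qed
  have down: "[y = z] (mod M) \<Longrightarrow> y mod q ^ i = z mod q ^ i" if "i \<le> \<kappa>" for y z i
    unfolding M_def cong_def[symmetric] by (erule cong_dvd_modulus_nat[OF _ le_imp_power_dvd[OF that]])
  show "(n + a + s * Q)\<^sup>2 div q ^ (\<kappa> - m) = (n + s * Q)\<^sup>2 div q ^ (\<kappa> - m)"
  proof -
    define d where "d = q ^ (\<kappa> - m)"
    define Z where "Z = (n + s * Q)\<^sup>2"
    have "Z + v = n\<^sup>2 + (v + 2 * (n + 0) * (s * Q)) + (s * Q)\<^sup>2" by (simp add: Z_def power2_eq_square algebra_simps)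
    then have "[Z + v = n\<^sup>2 + (v + 2 * (n + 0) * (s * Q))] (mod M)" using Q2[of n "v + 2 * (n + 0) * (s * Q)"] by (simp only:)
    also have "[n\<^sup>2 + (v + 2 * (n + 0) * (s * Q)) = n\<^sup>2 + (v + 2 * (c + 0) * (s * Q))] (mod M)"
      by (intro cong_add cong_refl nQ)
    also have "n\<^sup>2 + (v + 2 * (c + 0) * (s * Q)) = (n\<^sup>2 + v) + 2 * c * (s * Q)" by simp
    also have "[(n\<^sup>2 + v) + 2 * c * (s * Q) = w + 2 * c * (s * Q)] (mod M)"
      by (intro cong_add cong_refl cong_sym[OF wc])
    finally have eq: "(Z + v) mod d = (w + 2 * c * (s * Q)) mod d" unfolding d_def by (rule down[rotated]) simp
    have "L \<le> (Z + v) mod d" "(Z + v) mod d < d - E'" using reg s unfolding eq by (auto simp: regular_def d_def)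
    then have 1: "(Z + e) div d = (Z + v) div d" if "e \<le> E'" for e
      using that w(2) by (intro add_div_eq_of_mod_bounds[where E = E']) auto
    have "(n + a + s * Q)\<^sup>2 = Z + (2 * (n + s * Q) * a + a\<^sup>2)" by (simp add: Z_def power2_eq_square algebra_simps)
    then show ?thesis using 1[OF E'] 1[of 0] by (simp add: d_def Z_def)
  qed
  show "(n + a + s * Q)\<^sup>2 mod Q = (n + a)\<^sup>2 mod Q"
    unfolding power_mod[symmetric, of "n + a + s * Q"] power_mod[symmetric, of "n + a"] by simp
  show "window \<mu> \<kappa> l ((n + a + s * Q)\<^sup>2) = window \<mu> \<kappa> l (model_arg Q x c w a s)"
  proof -
    define Z where "Z = n\<^sup>2 + 2 * x * a + 2 * (c + a) * (s * Q)"
    define e where "e = 2 * (n - x) * a + a\<^sup>2"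
    have "(n - x) * a \<le> H * a" using x by (intro mult_right_mono) auto
    then have e: "e \<le> E" using E unfolding e_def by (simp only: mult.assoc)
    have na: "2 * n * a = 2 * x * a + 2 * (n - x) * a"
    proof -
      have "2 * (x + d) * a = 2 * x * a + 2 * d * a" for d by (simp add: algebra_simps)
      from this[of "n - x"] x show ?thesis by simp
    qed
    have "(n + a + s * Q)\<^sup>2 = n\<^sup>2 + (2 * n * a + a\<^sup>2 + 2 * (n + a) * (s * Q)) + (s * Q)\<^sup>2"
      by (simp add: power2_eq_square algebra_simps)
    then have "[(n + a + s * Q)\<^sup>2 = n\<^sup>2 + (2 * n * a + a\<^sup>2 + 2 * (n + a) * (s * Q))] (mod M)"
      using Q2[of n "2 * n * a + a\<^sup>2 + 2 * (n + a) * (s * Q)"] by (simp only:)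
    also have "[n\<^sup>2 + (2 * n * a + a\<^sup>2 + 2 * (n + a) * (s * Q)) = n\<^sup>2 + (2 * n * a + a\<^sup>2 + 2 * (c + a) * (s * Q))] (mod M)"
      by (intro cong_add cong_refl nQ)
    also have "n\<^sup>2 + (2 * n * a + a\<^sup>2 + 2 * (c + a) * (s * Q)) = Z + e"
      unfolding na Z_def e_def by simp
    finally have 1: "window \<mu> \<kappa> l ((n + a + s * Q)\<^sup>2) = window \<mu> \<kappa> l (Z + e)"
      unfolding M_def by (rule window_cong)
    have "model_arg Q x c w a s = w + (2 * x * a + 2 * (c + a) * (s * Q))" by (simp add: model_arg_def)
    moreover have "[w + (2 * x * a + 2 * (c + a) * (s * Q)) = (n\<^sup>2 + v) + (2 * x * a + 2 * (c + a) * (s * Q))] (mod M)"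
      by (intro cong_add cong_refl wc)
    moreover have "(n\<^sup>2 + v) + (2 * x * a + 2 * (c + a) * (s * Q)) = Z + v" by (simp add: Z_def)
    ultimately have cg: "[model_arg Q x c w a s = Z + v] (mod M)" by (simp only:)
    then have 2: "window \<mu> \<kappa> l (model_arg Q x c w a s) = window \<mu> \<kappa> l (Z + v)" unfolding M_def by (rule window_cong)
    have "(Z + v) mod q ^ \<mu> = model_arg Q x c w a s mod q ^ \<mu>"
      using down[OF _ cg, of \<mu>] \<kappa> by simp
    also have "model_arg Q x c w a s = w + 2 * x * a + q ^ \<mu> * (q ^ m * (2 * (c + a) * s))"
      by (simp add: model_arg_def Q power_add mult_ac)
    finally have "(Z + v) mod q ^ \<mu> = (w + 2 * x * a) mod q ^ \<mu>" by simp
    then have "L \<le> (Z + v) mod q ^ \<mu>" "(Z + v) mod q ^ \<mu> < q ^ \<mu> - E" using reg a by (auto simp: regular_def)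
    then have "(Z + e) div q ^ \<mu> = (Z + v) div q ^ \<mu>"
      using e w(2) by (intro add_div_eq_of_mod_bounds[where E = E]) auto
    then have "window \<mu> \<kappa> l (Z + e) = window \<mu> \<kappa> l (Z + v)"
      using \<kappa> by (intro window_div_cong) auto
    with 1 2 show ?thesis by simp
  qed
qed

lemma box_eq_model:
  assumes Q: "Q = q ^ (\<mu> + m)" and \<kappa>: "\<mu> + m \<le> \<kappa>" "\<kappa> \<le> 2 * (\<mu> + m)"
    and A: "A * Q = q ^ \<kappa>" "[n = c] (mod A)" and x: "x \<le> n" "n \<le> x + H"
    and w: "w = (n\<^sup>2 + v) mod q ^ \<kappa>" "v \<le> L"
    and reg: "regular \<mu> \<kappa> Q L E E' ((+) r ` {..<k} \<union> (+) r' ` {..<k}) {s, s'} x c w"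
    and E: "\<And>l. l < k \<Longrightarrow> 2 * H * (r + l) + (r + l)\<^sup>2 \<le> E" "\<And>l. l < k \<Longrightarrow> 2 * H * (r' + l) + (r' + l)\<^sup>2 \<le> E"
    and E': "\<And>l \<rho> \<sigma>. l < k \<Longrightarrow> \<rho> \<in> {r, r'} \<Longrightarrow> \<sigma> \<in> {s, s'} \<Longrightarrow> 2 * (n + \<sigma> * Q) * (\<rho> + l) + (\<rho> + l)\<^sup>2 \<le> E'"
  shows "box Q r r' s s' n = model \<mu> \<kappa> Q r r' s s' x c w"
proof -
  have "box Q r r' s s' n = (\<Prod>l<k. \<chi> l ((n + r + s * Q + l)\<^sup>2) * cnj (\<chi> l ((n + r' + s * Q + l)\<^sup>2)) *
     cnj (\<chi> l ((n + r + s' * Q + l)\<^sup>2)) * \<chi> l ((n + r' + s' * Q + l)\<^sup>2))"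
    by (simp add: box_def phase_def prod.distrib)
  also have "\<dots> = model \<mu> \<kappa> Q r r' s s' x c w"
    unfolding model_def
  proof (intro prod.cong refl)
    fix l assume "l \<in> {..<k}"
    then have l: "l < k" by simp
    have ord: "n + \<rho> + \<sigma> * Q + l = n + (\<rho> + l) + \<sigma> * Q" for \<rho> \<sigma> by simp
    have step: "(n + (\<rho> + l) + \<sigma> * Q)\<^sup>2 div q ^ (\<kappa> - m) = (n + \<sigma> * Q)\<^sup>2 div q ^ (\<kappa> - m)"
      "(n + (\<rho> + l) + \<sigma> * Q)\<^sup>2 mod q ^ (\<mu> + m) = (n + (\<rho> + l))\<^sup>2 mod q ^ (\<mu> + m)"
      "window \<mu> \<kappa> l ((n + (\<rho> + l) + \<sigma> * Q)\<^sup>2) = window \<mu> \<kappa> l (model_arg Q x c w (\<rho> + l) \<sigma>)"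
      if "\<rho> \<in> {r, r'}" "\<sigma> \<in> {s, s'}" for \<rho> \<sigma>
      using regular_step[where a = "\<rho> + l" and s = \<sigma>, OF Q \<kappa> A x w reg] that l E(1)[OF l] E(2)[OF l] E'[OF l that]
      unfolding Q by auto
    show "\<chi> l ((n + r + s * Q + l)\<^sup>2) * cnj (\<chi> l ((n + r' + s * Q + l)\<^sup>2)) *
        cnj (\<chi> l ((n + r + s' * Q + l)\<^sup>2)) * \<chi> l ((n + r' + s' * Q + l)\<^sup>2) =
      window \<mu> \<kappa> l (model_arg Q x c w (r + l) s) * cnj (window \<mu> \<kappa> l (model_arg Q x c w (r' + l) s)) *
        cnj (window \<mu> \<kappa> l (model_arg Q x c w (r + l) s')) * window \<mu> \<kappa> l (model_arg Q x c w (r' + l) s')"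
      unfolding ord by (subst four_product_cancel[OF \<kappa>(1)]) (simp_all add: step)
  qed
  finally show ?thesis .
qed

lemma card_irregular_le:
  assumes \<mu>: "\<mu> \<le> \<kappa>" "m \<le> \<kappa>" and fin: "finite As" "finite S"
  shows "card {w \<in> {..<q ^ \<kappa>}. \<not> regular \<mu> \<kappa> Q L E E' As S x c w}
    \<le> card As * (q ^ (\<kappa> - \<mu>) * (L + E)) + card S * (q ^ m * (L + E'))"
proof -
  define U where "U a = {w \<in> {..<q ^ (\<kappa> - \<mu>) * q ^ \<mu>}. \<not> (L \<le> (w + 2 * x * a) mod q ^ \<mu> \<and> (w + 2 * x * a) mod q ^ \<mu> < q ^ \<mu> - E)}" for a
  define V where "V s = {w \<in> {..<q ^ m * q ^ (\<kappa> - m)}. \<not> (L \<le> (w + 2 * c * (s * Q)) mod q ^ (\<kappa> - m) \<and>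
      (w + 2 * c * (s * Q)) mod q ^ (\<kappa> - m) < q ^ (\<kappa> - m) - E')}" for s
  have eq: "q ^ (\<kappa> - \<mu>) * q ^ \<mu> = q ^ \<kappa>" "q ^ m * q ^ (\<kappa> - m) = q ^ \<kappa>"
    using \<mu> by (simp_all add: power_add[symmetric])
  have "{w \<in> {..<q ^ \<kappa>}. \<not> regular \<mu> \<kappa> Q L E E' As S x c w} \<subseteq> (\<Union>a\<in>As. U a) \<union> (\<Union>s\<in>S. V s)"
    by (auto simp: regular_def U_def V_def eq)
  then have "card {w \<in> {..<q ^ \<kappa>}. \<not> regular \<mu> \<kappa> Q L E E' As S x c w} \<le> card ((\<Union>a\<in>As. U a) \<union> (\<Union>s\<in>S. V s))"
    using fin by (intro card_mono) (auto simp: U_def V_def)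
  also have "\<dots> \<le> (\<Sum>a\<in>As. card (U a)) + (\<Sum>s\<in>S. card (V s))"
    by (rule order_trans[OF card_Un_le]) (intro add_mono card_UN_le fin)
  also have "\<dots> \<le> (\<Sum>a\<in>As. q ^ (\<kappa> - \<mu>) * (L + E)) + (\<Sum>s\<in>S. q ^ m * (L + E'))"
    unfolding U_def V_def by (intro add_mono sum_mono card_near_boundary_le)
  finally show ?thesis by simp
qed

text \<open>For fixed \<open>s\<close> the arguments for \<open>r + l\<close> and
  \<open>r' + l\<close> lie on one progression with difference \<open>2 * (x + s * Q)\<close>, so
  the four windows regroup by \<open>s\<close> and \<open>s'\<close>.\<close>

lemma model_eq_corr:
  assumes "r \<le> r'"
  shows "model \<mu> \<kappa> Q r r' s s' x c w
    = corr \<mu> \<kappa> (r' - r) (2 * (x + s * Q)) (w + 2 * x * r + 2 * (c + r) * (s * Q))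
      * cnj (corr \<mu> \<kappa> (r' - r) (2 * (x + s' * Q)) (w + 2 * x * r + 2 * (c + r) * (s' * Q)))"
proof -
  have arg: "model_arg Q x c w (r + i) \<sigma> = (w + 2 * x * r + 2 * (c + r) * (\<sigma> * Q)) + i * (2 * (x + \<sigma> * Q))" for i \<sigma>
    by (simp add: model_arg_def algebra_simps)
  have arg': "model_arg Q x c w (r' + i) \<sigma> = (w + 2 * x * r + 2 * (c + r) * (\<sigma> * Q)) + (r' - r + i) * (2 * (x + \<sigma> * Q))" for i \<sigma>
    using arg[of "r' - r + i" \<sigma>] assms by simp
  show ?thesis unfolding model_def corr_def arg arg' cnj_prod prod.distrib[symmetric]
    by (intro prod.cong refl) (simp add: mult_ac)
qed

lemma corr_cong: "[w = w'] (mod q ^ \<kappa>) \<Longrightarrow> corr \<mu> \<kappa> t D w = corr \<mu> \<kappa> t D w'"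
  unfolding corr_def by (intro prod.cong refl arg_cong2[of _ _ _ _ "(*)"] arg_cong[of _ _ cnj] window_cong cong_add cong_refl)

lemma corr_sum_bound_all:
  assumes K: "K \<le> \<kappa>" and bound: "\<And>W. W < q ^ K \<Longrightarrow> cmod (\<Sum>y<q ^ (\<kappa> - K). corr \<mu> \<kappa> t D (W + q ^ K * y)) \<le> b"
  shows "cmod (\<Sum>y<q ^ (\<kappa> - K). corr \<mu> \<kappa> t D (W + q ^ K * y)) \<le> b"
proof -
  define h where "h y = corr \<mu> \<kappa> t D (W mod q ^ K + q ^ K * y)" for y
  have per: "h (y mod q ^ (\<kappa> - K)) = h y" for y
  proof -
    have "[q ^ K * (y mod q ^ (\<kappa> - K)) = q ^ K * y] (mod q ^ K * q ^ (\<kappa> - K))"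
      by (simp add: cong_def mult_mod_right[symmetric])
    then show ?thesis unfolding h_def using K
      by (intro corr_cong cong_add cong_refl) (simp add: power_add[symmetric])
  qed
  have "W + q ^ K * y = W mod q ^ K + q ^ K * (y + W div q ^ K)" for y
    by (simp add: distrib_left)
  then have "(\<Sum>y<q ^ (\<kappa> - K). corr \<mu> \<kappa> t D (W + q ^ K * y)) = (\<Sum>y<q ^ (\<kappa> - K). h (y + W div q ^ K))"
    by (simp only: h_def)
  also have "\<dots> = (\<Sum>y<q ^ (\<kappa> - K). h y)" by (rule sum_periodic_shift[where h = h, OF per])
  finally show ?thesis using bound[of "W mod q ^ K"] q_pos[of K] by (simp add: h_def)
qed

text \<open>After a shift of \<open>w\<close>, the factor belonging to \<open>s\<close> is free of
  \<open>c\<close>, while the argument of the other moves by \<open>2 * (s' - s) * Q * c\<close>. As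
  \<open>c\<close> runs modulo \<open>q ^ a\<close>, these shifts form a group modulo
  \<open>q ^ \<kappa>\<close> that contains all multiples of \<open>q ^ K\<close>. Averaging over
  \<open>c\<close> therefore includes averaging over the digits above \<open>K\<close>.\<close>

lemma model_average_bound:
  assumes r: "r \<le> r'" and s: "s < s'" and i: "2 * (s' - s) \<le> 2 ^ i"
    and Q: "Q = q ^ (\<mu> + m)" and A: "q ^ a * Q = q ^ \<kappa>" and K: "K \<le> \<kappa>" "\<mu> + m + i \<le> K"
    and bound: "\<And>W. W < q ^ K \<Longrightarrow>
      cmod (\<Sum>y<q ^ (\<kappa> - K). corr \<mu> \<kappa> (r' - r) (2 * (x + s' * Q)) (W + q ^ K * y)) \<le> real (q ^ (\<kappa> - K)) * b"
  shows "cmod (\<Sum>c<q ^ a. \<Sum>w<q ^ \<kappa>. model \<mu> \<kappa> Q r r' s s' x c w) \<le> real (q ^ a) * real (q ^ \<kappa>) * b"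
proof -
  define M where "M = q ^ \<kappa>"
  define t where "t = r' - r"
  define \<sigma> where "\<sigma> = s' - s"
  define f where "f = corr \<mu> \<kappa> t (2 * (x + s * Q))"
  define g where "g = corr \<mu> \<kappa> t (2 * (x + s' * Q))"
  have fcong: "[w = w'] (mod M) \<Longrightarrow> f w = f w'" and gcong: "[w = w'] (mod M) \<Longrightarrow> g w = g w'" for w w'
    unfolding f_def g_def M_def by (rule corr_cong, assumption)+
  have "\<exists>c0. [2 * \<sigma> * Q * c0 = q ^ i * Q] (mod q ^ a * Q)"
    by (rule exists_power_multiple) (use s i q2 in \<open>auto simp: \<sigma>_def\<close>)
  then obtain c1 where c1: "[2 * \<sigma> * Q * c1 = q ^ i * Q] (mod M)" unfolding A M_def by blast
  \<comment> \<open>Moving \<open>c\<close> by \<open>c0\<close> moves the argument of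
    \<open>g\<close> by \<open>q ^ K\<close>: \<open>c1\<close> achieves
    \<open>q ^ (\<mu> + m + i)\<close>, and the remaining power of \<open>q\<close> is multiplied
    on.\<close>
  define c0 where "c0 = c1 * q ^ (K - (\<mu> + m + i))"
  have "[2 * \<sigma> * Q * c1 * q ^ (K - (\<mu> + m + i)) = q ^ i * Q * q ^ (K - (\<mu> + m + i))] (mod M)"
    by (rule cong_mult[OF c1 cong_refl])
  moreover have "q ^ i * Q * q ^ (K - (\<mu> + m + i)) = q ^ K"
    unfolding Q power_add[symmetric] using K by simp
  ultimately have c0: "[2 * \<sigma> * Q * c0 = q ^ K] (mod M)" by (simp add: c0_def mult_ac)
  have col: "cmod (\<Sum>c<q ^ a. g (w + 2 * \<sigma> * Q * c)) \<le> real (q ^ a) * b" for w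
  proof -
    define h where "h c = g (w + 2 * \<sigma> * Q * c)" for c
    have per: "h (c mod q ^ a) = h c" for c
    proof -
      have "[Q * (c mod q ^ a) = Q * c] (mod Q * q ^ a)" by (simp add: cong_def mult_mod_right[symmetric])
      then have "[Q * (c mod q ^ a) = Q * c] (mod M)" using A by (simp add: M_def mult.commute)
      then have "[2 * \<sigma> * (Q * (c mod q ^ a)) = 2 * \<sigma> * (Q * c)] (mod M)" by (rule cong_mult[OF cong_refl])
      then show ?thesis unfolding h_def by (intro gcong cong_add cong_refl) (simp only: mult.assoc)
    qed
    have shift: "(\<Sum>c<q ^ a. h c) = (\<Sum>c<q ^ a. g (w + 2 * \<sigma> * Q * c + q ^ K * y))" for y
    proof -
      have "(\<Sum>c<q ^ a. h c) = (\<Sum>c<q ^ a. h (c + c0 * y))" by (rule sum_periodic_shift[where h = h, OF per, symmetric])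
      also have "\<dots> = (\<Sum>c<q ^ a. g (w + 2 * \<sigma> * Q * c + q ^ K * y))"
      proof (intro sum.cong refl)
        fix c
        have "[2 * \<sigma> * Q * c0 * y = q ^ K * y] (mod M)" by (rule cong_mult[OF c0 cong_refl])
        then have "[w + 2 * \<sigma> * Q * c + 2 * \<sigma> * Q * c0 * y = w + 2 * \<sigma> * Q * c + q ^ K * y] (mod M)"
          by (intro cong_add cong_refl)
        moreover have "w + 2 * \<sigma> * Q * c + 2 * \<sigma> * Q * c0 * y = w + 2 * \<sigma> * Q * (c + c0 * y)"
          by (simp add: algebra_simps)
        ultimately show "h (c + c0 * y) = g (w + 2 * \<sigma> * Q * c + q ^ K * y)"
          unfolding h_def by (intro gcong) (simp only:)
      qed
      finally show ?thesis .
    qed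
    define n where "n = q ^ (\<kappa> - K)"
    have n: "n > 0" unfolding n_def by (rule q_pos)
    have "of_nat n * (\<Sum>c<q ^ a. h c) = (\<Sum>y<n. \<Sum>c<q ^ a. g (w + 2 * \<sigma> * Q * c + q ^ K * y))"
      using shift by simp
    also have "\<dots> = (\<Sum>c<q ^ a. \<Sum>y<n. g (w + 2 * \<sigma> * Q * c + q ^ K * y))" by (rule sum.swap)
    also have "cmod \<dots> \<le> (\<Sum>c<q ^ a. real n * b)"
      unfolding n_def g_def t_def by (rule sum_norm_le, rule corr_sum_bound_all[OF K(1) bound])
    finally have "real n * cmod (\<Sum>c<q ^ a. h c) \<le> real n * (real (q ^ a) * b)"
      by (simp add: norm_mult mult_ac)
    then show ?thesis unfolding h_def using n by (simp add: mult_le_cancel_left)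
  qed
  have row: "(\<Sum>w<M. model \<mu> \<kappa> Q r r' s s' x c w) = (\<Sum>w<M. f w * cnj (g (w + 2 * \<sigma> * Q * r + 2 * \<sigma> * Q * c)))" for c
  proof -
    define p where "p = 2 * x * r + 2 * (c + r) * (s * Q)"
    define F where "F w = f w * cnj (g (w + 2 * \<sigma> * Q * r + 2 * \<sigma> * Q * c))" for w
    have per: "F (w mod M) = F w" for w
    proof -
      have c: "[w mod M = w] (mod M)" by (simp add: cong_def)
      have "g (w mod M + 2 * \<sigma> * Q * r + 2 * \<sigma> * Q * c) = g (w + 2 * \<sigma> * Q * r + 2 * \<sigma> * Q * c)"
        by (intro gcong cong_add cong_refl c)
      then show ?thesis unfolding F_def using fcong[OF c] by simp
    qed
    have "model \<mu> \<kappa> Q r r' s s' x c w = F (w + p)" for w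
    proof -
      have "s' = s + \<sigma>" using s by (simp add: \<sigma>_def)
      then have "w + 2 * x * r + 2 * (c + r) * (s' * Q) = w + p + 2 * \<sigma> * Q * r + 2 * \<sigma> * Q * c"
        by (simp add: p_def algebra_simps)
      moreover have "w + 2 * x * r + 2 * (c + r) * (s * Q) = w + p" by (simp add: p_def)
      ultimately show ?thesis unfolding model_eq_corr[OF r] F_def f_def g_def t_def by (simp only:)
    qed
    then have "(\<Sum>w<M. model \<mu> \<kappa> Q r r' s s' x c w) = (\<Sum>w<M. F (w + p))" by simp
    also have "\<dots> = (\<Sum>w<M. F w)" by (rule sum_periodic_shift[where h = F, OF per])
    finally show ?thesis by (simp only: F_def)
  qed
  have "(\<Sum>c<q ^ a. \<Sum>w<M. model \<mu> \<kappa> Q r r' s s' x c w) = (\<Sum>w<M. \<Sum>c<q ^ a. f w * cnj (g (w + 2 * \<sigma> * Q * r + 2 * \<sigma> * Q * c)))"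
    unfolding row by (rule sum.swap)
  also have "\<dots> = (\<Sum>w<M. f w * cnj (\<Sum>c<q ^ a. g (w + 2 * \<sigma> * Q * r + 2 * \<sigma> * Q * c)))"
    by (simp add: sum_distrib_left)
  also have "cmod \<dots> \<le> (\<Sum>w<M. real (q ^ a) * b)"
  proof (rule sum_norm_le)
    fix w
    have "cmod (f w) = 1" unfolding f_def by (rule norm_corr)
    then show "cmod (f w * cnj (\<Sum>c<q ^ a. g (w + 2 * \<sigma> * Q * r + 2 * \<sigma> * Q * c))) \<le> real (q ^ a) * b"
      using col[of "w + 2 * \<sigma> * Q * r"] by (simp only: norm_mult complex_mod_cnj mult_1_left)
  qed
  finally show ?thesis by (simp add: M_def mult_ac)
qed

end

section \<open>Comparing box sums with the model on short progressions\<close>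

context digit_phase
begin

text \<open>Equidistribution is used twice. Applied to the indicator of the irregular residues,
  whose density is at most \<open>\<beta>\<close>, it bounds the share of bad pairs
  \<open>(t, v)\<close> by \<open>\<beta> + \<epsilon>\<close>, each costing at most 2. Applied to
  the model it costs another \<open>\<epsilon>\<close>.\<close>

lemma piece_bound:
  assumes Q: "Q = q ^ (\<mu> + m)" and \<kappa>: "\<mu> + m \<le> \<kappa>" "\<kappa> \<le> 2 * (\<mu> + m)" and A: "A * Q = q ^ \<kappa>"
    and pos: "A > 0" "T > 0" "L > 0" "Y > 0" and L: "L \<le> q ^ \<kappa>" and \<epsilon>: "\<epsilon> \<ge> 0"
    and rel: "2 * real (A\<^sup>2 * T) / real L + 2 * real (q ^ \<kappa>) * (real Y + real T / real Y) / (real T)\<^sup>2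
       + 5 * real (q ^ \<kappa>) / (real T * real L) \<le> \<epsilon>\<^sup>2"
    and x: "A dvd x" and c: "c < A"
    and E: "\<And>l. l < k \<Longrightarrow> 2 * (A * T) * (r + l) + (r + l)\<^sup>2 \<le> E" "\<And>l. l < k \<Longrightarrow> 2 * (A * T) * (r' + l) + (r' + l)\<^sup>2 \<le> E"
    and E': "\<And>l \<rho> \<sigma>. l < k \<Longrightarrow> \<rho> \<in> {r, r'} \<Longrightarrow> \<sigma> \<in> {s, s'} \<Longrightarrow> 2 * (x + A * T + \<sigma> * Q) * (\<rho> + l) + (\<rho> + l)\<^sup>2 \<le> E'"
    and \<beta>: "real (2 * k * (q ^ (\<kappa> - \<mu>) * (L + E)) + 2 * (q ^ m * (L + E'))) \<le> \<beta> * real (q ^ \<kappa>)"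
  shows "cmod ((\<Sum>t<T. box Q r r' s s' (x + c + A * t))
      - of_real (real T / real (q ^ \<kappa>)) * (\<Sum>w<q ^ \<kappa>. model \<mu> \<kappa> Q r r' s s' x c w)) \<le> real T * (2 * \<beta> + 3 * \<epsilon>)"
proof -
  define M where "M = q ^ \<kappa>"
  define As where "As = (+) r ` {..<k} \<union> (+) r' ` {..<k}"
  define bad where "bad w \<longleftrightarrow> \<not> regular \<mu> \<kappa> Q L E E' As {s, s'} x c w" for w
  define \<Psi> where "\<Psi> w = model \<mu> \<kappa> Q r r' s s' x c w" for w
  define n where "n t = x + c + A * t" for t
  define z where "z t v = ((n t)\<^sup>2 + v) mod M" for t v
  have M0: "M > 0" unfolding M_def by (rule q_pos)
  have near: "cmod ((\<Sum>t<T. \<Sum>v<L. h (z t v)) - of_real (real T * real L / real M) * (\<Sum>w<M. h w)) \<le> real T * real L * \<epsilon>"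
    if "\<And>w. cmod (h w) \<le> 1" for h
    unfolding z_def n_def M_def using that
    by (intro squares_near_uniform[where Y = Y] pos L \<epsilon> rel q_pos)
  have cardbad: "real (card {w \<in> {..<M}. bad w}) \<le> \<beta> * real M"
  proof -
    have "card {w \<in> {..<M}. bad w} \<le> card As * (q ^ (\<kappa> - \<mu>) * (L + E)) + card {s, s'} * (q ^ m * (L + E'))"
      unfolding bad_def M_def using \<kappa> by (intro card_irregular_le) (auto simp: As_def)
    also have "\<dots> \<le> 2 * k * (q ^ (\<kappa> - \<mu>) * (L + E)) + 2 * (q ^ m * (L + E'))"
    proof (intro add_mono mult_right_mono)
      have "card As \<le> card ((+) r ` {..<k}) + card ((+) r' ` {..<k})" unfolding As_def by (rule card_Un_le)
      also have "\<dots> \<le> k + k" by (intro add_mono order_trans[OF card_image_le]) auto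
      finally show "card As \<le> 2 * k" by simp
      show "card {s, s'} \<le> 2" by (simp add: card_insert_if)
    qed auto
    finally have "real (card {w \<in> {..<M}. bad w}) \<le> real (2 * k * (q ^ (\<kappa> - \<mu>) * (L + E)) + 2 * (q ^ m * (L + E')))"
      by (simp only: of_nat_le_iff)
    with \<beta> show ?thesis unfolding M_def by linarith
  qed
  have diff: "cmod (box Q r r' s s' (n t) - \<Psi> (z t v)) \<le> 2 * of_bool (bad (z t v))" if t: "t < T" and v: "v < L" for t v
  proof (cases "bad (z t v)")
    case True
    have "cmod (box Q r r' s s' (n t) - \<Psi> (z t v)) \<le> 1 + 1"
      unfolding \<Psi>_def by (rule order_trans[OF norm_triangle_ineq4]) (simp add: norm_box norm_model)
    then show ?thesis using True by simp
  next
    case False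
    have "A * t + A \<le> A * T" using t by (metis Suc_leI add.commute mult_Suc_right mult_le_mono2)
    then have nx: "x \<le> n t" "n t \<le> x + A * T" using c by (auto simp: n_def)
    have nc: "[n t = c] (mod A)" using x by (auto simp: n_def cong_def elim!: dvdE)
    have "box Q r r' s s' (n t) = model \<mu> \<kappa> Q r r' s s' x c (z t v)"
    proof (rule box_eq_model[OF Q \<kappa> A nc nx])
      show "z t v = ((n t)\<^sup>2 + v) mod q ^ \<kappa>" by (simp add: z_def M_def)
      show "v \<le> L" using v by simp
      show "regular \<mu> \<kappa> Q L E E' ((+) r ` {..<k} \<union> (+) r' ` {..<k}) {s, s'} x c (z t v)"
        using False by (simp add: bad_def As_def)
      fix l \<rho> \<sigma> assume "l < k" "\<rho> \<in> {r, r'}" "\<sigma> \<in> {s, s'}"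
      then have "2 * (x + A * T + \<sigma> * Q) * (\<rho> + l) + (\<rho> + l)\<^sup>2 \<le> E'" by (rule E')
      moreover have "2 * (n t + \<sigma> * Q) * (\<rho> + l) \<le> 2 * (x + A * T + \<sigma> * Q) * (\<rho> + l)"
        using nx by (intro mult_right_mono mult_left_mono) auto
      ultimately show "2 * (n t + \<sigma> * Q) * (\<rho> + l) + (\<rho> + l)\<^sup>2 \<le> E'" by linarith
    qed (fact E)+
    then show ?thesis using False by (simp add: \<Psi>_def)
  qed
  have badsum: "(\<Sum>t<T. \<Sum>v<L. of_bool (bad (z t v)) :: real) \<le> real T * real L * (\<beta> + \<epsilon>)"
  proof -
    define h :: "nat \<Rightarrow> complex" where "h w = of_real (of_bool (bad w))" for w
    have "cmod (h w) \<le> 1" for w by (simp add: h_def)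
    from near[OF this]
    have *: "cmod ((\<Sum>t<T. \<Sum>v<L. h (z t v)) - of_real (real T * real L / real M) * (\<Sum>w<M. h w)) \<le> real T * real L * \<epsilon>" .
    have "(\<Sum>w<M. h w) = of_real (real (card {w \<in> {..<M}. bad w}))"
      unfolding h_def of_real_sum[symmetric] by (simp add: Int_def)
    with * have "cmod (of_real ((\<Sum>t<T. \<Sum>v<L. of_bool (bad (z t v))) - real T * real L / real M * real (card {w \<in> {..<M}. bad w})))
        \<le> real T * real L * \<epsilon>"
      by (simp only: h_def of_real_sum of_real_mult of_real_diff)
    then have "(\<Sum>t<T. \<Sum>v<L. of_bool (bad (z t v))) - real T * real L / real M * real (card {w \<in> {..<M}. bad w})
        \<le> real T * real L * \<epsilon>" unfolding norm_of_real by linarith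
    moreover have "real T * real L / real M * real (card {w \<in> {..<M}. bad w}) \<le> real T * real L / real M * (\<beta> * real M)"
      by (intro mult_left_mono cardbad) auto
    moreover have "real T * real L / real M * (\<beta> * real M) = real T * real L * \<beta>" using M0 by simp
    ultimately show ?thesis unfolding distrib_left by linarith
  qed
  define B where "B = (\<Sum>t<T. box Q r r' s s' (n t))"
  define P where "P = (\<Sum>t<T. \<Sum>v<L. \<Psi> (z t v))"
  have "of_nat L * B - P = (\<Sum>t<T. \<Sum>v<L. box Q r r' s s' (n t) - \<Psi> (z t v))"
    by (simp add: B_def P_def sum_subtractf sum_distrib_left)
  also have "cmod \<dots> \<le> (\<Sum>t<T. \<Sum>v<L. 2 * of_bool (bad (z t v)))"
    by (intro sum_norm_le diff) auto
  also have "\<dots> = 2 * (\<Sum>t<T. \<Sum>v<L. of_bool (bad (z t v)))" by (simp only: sum_distrib_left)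
  also have "\<dots> \<le> 2 * (real T * real L * (\<beta> + \<epsilon>))" by (intro mult_left_mono badsum) auto
  finally have 1: "cmod (of_nat L * B - P) \<le> 2 * (real T * real L * (\<beta> + \<epsilon>))" .
  have "cmod (\<Psi> w) \<le> 1" for w by (simp add: \<Psi>_def norm_model)
  from near[OF this] have 2: "cmod (P - of_real (real T * real L / real M) * (\<Sum>w<M. \<Psi> w)) \<le> real T * real L * \<epsilon>"
    by (simp only: P_def)
  have "of_nat L * (B - of_real (real T / real M) * (\<Sum>w<M. \<Psi> w))
     = (of_nat L * B - P) + (P - of_real (real T * real L / real M) * (\<Sum>w<M. \<Psi> w))"
    by (simp add: algebra_simps)
  then have "cmod (of_nat L * (B - of_real (real T / real M) * (\<Sum>w<M. \<Psi> w))) \<le> 2 * (real T * real L * (\<beta> + \<epsilon>)) + real T * real L * \<epsilon>"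
    using norm_triangle_mono[OF 1 2] by (simp only:)
  then have "real L * cmod (B - of_real (real T / real M) * (\<Sum>w<M. \<Psi> w)) \<le> 2 * (real T * real L * (\<beta> + \<epsilon>)) + real T * real L * \<epsilon>"
    by (simp only: norm_mult norm_of_nat)
  also have "\<dots> = real L * (real T * (2 * \<beta> + 3 * \<epsilon>))" by (simp add: algebra_simps)
  finally have "real L * cmod (B - of_real (real T / real M) * (\<Sum>w<M. \<Psi> w)) \<le> real L * (real T * (2 * \<beta> + 3 * \<epsilon>))" .
  then have "cmod (B - of_real (real T / real M) * (\<Sum>w<M. \<Psi> w)) \<le> real T * (2 * \<beta> + 3 * \<epsilon>)"
    using pos by (simp add: mult_le_cancel_left)
  then show ?thesis by (simp only: B_def n_def \<Psi>_def M_def)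
qed

end

section \<open>Off-diagonal terms and the choice of parameters\<close>

context digit_pattern
begin

definition c_swap :: real where
  "c_swap = (real (q ^ G) - 2 + cmod (1 + \<zeta>)) / real (q ^ G)"

text \<open>Bounds the mean factor contributed by one block, a good block being granted the
  frequency \<open>1 / (q ^ G)^2\<close>.\<close>

definition c_good :: real where
  "c_good = 1 - (1 - c_swap) / (real (q ^ G))\<^sup>2"

lemma norm_zeta: "cmod \<zeta> = 1"
  by (simp add: \<zeta>_def norm_mult norm_divide norm_chi)

lemma c_swap_bounds: "0 \<le> c_swap" "c_swap \<le> 1"
proof -
  have "2 \<le> real (q ^ G)" using window_bound_le(3) by (metis of_nat_le_iff of_nat_numeral)
  moreover have "cmod (1 + \<zeta>) \<le> 2" using norm_triangle_ineq[of 1 \<zeta>] by (simp add: norm_zeta)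
  moreover have "0 \<le> (b - 2 + x) / b \<and> (b - 2 + x) / b \<le> 1" if "2 \<le> b" "x \<le> 2" "0 \<le> x" for b x :: real
    using that by (simp add: divide_le_eq_1_pos)
  ultimately show "0 \<le> c_swap" "c_swap \<le> 1"
    unfolding c_swap_def by (meson norm_ge_zero)+
qed

lemma corr_sum_bound_product:
  assumes W: "W < q ^ K" and K: "\<mu> \<le> K" "K + I * G \<le> \<kappa>"
  shows "cmod (\<Sum>y<q ^ (\<kappa> - K). corr \<mu> \<kappa> t (2 * D) (W + q ^ K * y))
    \<le> real (q ^ (\<kappa> - K)) * (\<Prod>i<I. if good t D (K + i * G) then c_swap else 1)"
proof -
  have "\<kappa> - K = G * I + (\<kappa> - K - I * G)" using K by (simp add: mult.commute)
  then have eq: "q ^ (\<kappa> - K) = (q ^ G) ^ I * q ^ (\<kappa> - K - I * G)" by (metis power_add power_mult)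
  have b0: "real (q ^ G) > 0" using q_pos[of G] by (simp only: of_nat_0_less_iff)
  have "(\<Prod>i<I. if good t D (K + i * G) then real (q ^ G) - 2 + cmod (1 + \<zeta>) else real (q ^ G))
    = (\<Prod>i<I. real (q ^ G) * (if good t D (K + i * G) then c_swap else 1))"
    using b0 by (intro prod.cong refl) (simp add: c_swap_def)
  also have "\<dots> = real ((q ^ G) ^ I) * (\<Prod>i<I. if good t D (K + i * G) then c_swap else 1)"
    by (simp add: prod.distrib)
  finally show ?thesis unfolding eq
    using corr_sum_bound[OF W K, where e = "q ^ (\<kappa> - K - I * G)" and t = t and D = D] by (simp add: mult_ac)
qed

text \<open>The range is cut into intervals of length \<open>H = q ^ (a + \<tau>)\<close>, each
  treated over all classes modulo \<open>q ^ a\<close>. Interval \<open>j\<close> enters only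
  through the difference \<open>j * H + s' * Q\<close>, a multiple of
  \<open>q ^ (a + \<tau>)\<close>, so the average over \<open>j\<close> supplies the random
  difference.\<close>

lemma off_diagonal_bound:
  fixes Y T L E E' N :: nat
  assumes r: "r < r'" and l: "q ^ (l + 1) \<le> 2 * (r' - r)" "2 * (r' - r) < q ^ (l + 2)" "I * G \<le> l"
    and s: "s < s'" "2 * (s' - s) \<le> 2 ^ i"
    and Q: "Q = q ^ (\<mu> + m)" and \<kappa>: "a + (\<mu> + m) = \<kappa>" "\<kappa> \<le> 2 * (\<mu> + m)"
    and Z: "\<mu> + m + i \<le> Z" "Z + l + I * G \<le> \<kappa>"
    and T: "T = q ^ \<tau>" and h: "a + \<tau> \<le> Z" "a + \<tau> \<le> \<mu> + m"
    and N: "q ^ (Z + l + I * G - (a + \<tau>)) \<le> N div q ^ (a + \<tau>)"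
    and pos: "L > 0" "Y > 0" and L: "L \<le> q ^ \<kappa>" and \<epsilon>: "\<epsilon> \<ge> 0" and \<beta>0: "\<beta> \<ge> 0"
    and rel: "2 * real ((q ^ a)\<^sup>2 * T) / real L + 2 * real (q ^ \<kappa>) * (real Y + real T / real Y) / (real T)\<^sup>2
       + 5 * real (q ^ \<kappa>) / (real T * real L) \<le> \<epsilon>\<^sup>2"
    and E: "2 * q ^ (a + \<tau>) * (r' + k) + (r' + k)\<^sup>2 \<le> E"
    and E': "2 * (N + s' * Q) * (r' + k) + (r' + k)\<^sup>2 \<le> E'"
    and \<beta>: "real (2 * k * (q ^ (\<kappa> - \<mu>) * (L + E)) + 2 * (q ^ m * (L + E'))) \<le> \<beta> * real (q ^ \<kappa>)"
  shows "cmod (\<Sum>n<N. box Q r r' s s' n) \<le> real (q ^ (a + \<tau>)) + real N * (2 * \<beta> + 3 * \<epsilon> + 3 * c_good ^ I)"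
proof -
  define A where "A = q ^ a"
  define M where "M = q ^ \<kappa>"
  define H where "H = q ^ (a + \<tau>)"
  define J where "J = N div H"
  define K where "K = Z + l"
  define b where "b j = (\<Prod>i<I. if good (r' - r) (j * H + s' * Q) (K + i * G) then c_swap else 1)" for j
  have H: "H = A * T" by (simp add: H_def A_def T power_add)
  have H0: "H > 0" unfolding H_def by (rule q_pos)
  have A0: "A > 0" unfolding A_def by (rule q_pos)
  have T0: "T > 0" unfolding T by (rule q_pos)
  have M0: "real M > 0" unfolding M_def using q_pos[of \<kappa>] by (simp only: of_nat_0_less_iff)
  have AQ: "A * Q = q ^ \<kappa>" by (simp add: A_def Q power_add[symmetric] \<kappa>(1))
  have piece: "cmod (\<Sum>v<H. box Q r r' s s' (j * H + v)) \<le> real H * (2 * \<beta> + 3 * \<epsilon>) + real H * b j" if j: "j < J" for j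
  proof -
    define x where "x = j * H"
    have xN: "x + A * T \<le> N"
    proof -
      have "x + A * T = Suc j * H" by (simp add: x_def H)
      also have "\<dots> \<le> J * H" using j by (intro mult_right_mono) auto
      also have "\<dots> \<le> N" by (simp add: J_def)
      finally show ?thesis .
    qed
    have mono: "2 * y * (\<rho> + l) + (\<rho> + l)\<^sup>2 \<le> 2 * y' * (r' + k) + (r' + k)\<^sup>2"
      if "l < k" "\<rho> \<in> {r, r'}" "y \<le> y'" for y y' \<rho> l
    proof -
      have le: "\<rho> + l \<le> r' + k" using that r by auto
      show ?thesis by (rule add_mono[OF mult_mono[OF mult_le_mono2[OF that(3)] le] power_mono[OF le]]) auto
    qed
    have EH: "2 * H * (\<rho> + l) + (\<rho> + l)\<^sup>2 \<le> E" if "l < k" "\<rho> \<in> {r, r'}" for l \<rho>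
      using order_trans[OF mono[OF that order_refl, of H]] E unfolding H_def by blast
    have pb: "cmod ((\<Sum>t<T. box Q r r' s s' (x + c + A * t))
        - of_real (real T / real M) * (\<Sum>w<M. model \<mu> \<kappa> Q r r' s s' x c w)) \<le> real T * (2 * \<beta> + 3 * \<epsilon>)" if c: "c < A" for c
      unfolding M_def
    proof (rule piece_bound[OF Q _ \<kappa>(2) AQ A0 T0 pos L \<epsilon>])
      show "\<mu> + m \<le> \<kappa>" using \<kappa> by simp
      show "2 * real (A\<^sup>2 * T) / real L + 2 * real (q ^ \<kappa>) * (real Y + real T / real Y) / (real T)\<^sup>2
        + 5 * real (q ^ \<kappa>) / (real T * real L) \<le> \<epsilon>\<^sup>2" unfolding A_def by (rule rel)
      show "A dvd x" by (simp add: x_def H)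
      show "2 * (A * T) * (r + l) + (r + l)\<^sup>2 \<le> E" "2 * (A * T) * (r' + l) + (r' + l)\<^sup>2 \<le> E" if "l < k" for l
        unfolding H[symmetric] by (intro EH that; simp)+
      show "2 * (x + A * T + \<sigma> * Q) * (\<rho> + l) + (\<rho> + l)\<^sup>2 \<le> E'" if "l < k" "\<rho> \<in> {r, r'}" "\<sigma> \<in> {s, s'}" for l \<rho> \<sigma>
      proof -
        have "\<sigma> * Q \<le> s' * Q" using that s by (intro mult_right_mono) auto
        then have "x + A * T + \<sigma> * Q \<le> N + s' * Q" using xN by linarith
        from mono[OF that(1,2) this] E' show ?thesis by linarith
      qed
    qed (fact c \<beta>)+
    have mb: "cmod (\<Sum>c<A. \<Sum>w<M. model \<mu> \<kappa> Q r r' s s' x c w) \<le> real A * real M * b j"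
      unfolding A_def M_def
    proof (rule model_average_bound[OF less_imp_le[OF r] s Q])
      show "q ^ a * Q = q ^ \<kappa>" using AQ by (simp add: A_def)
      show "K \<le> \<kappa>" "\<mu> + m + i \<le> K" using Z by (auto simp: K_def)
      fix W assume "W < q ^ K"
      then show "cmod (\<Sum>y<q ^ (\<kappa> - K). corr \<mu> \<kappa> (r' - r) (2 * (x + s' * Q)) (W + q ^ K * y)) \<le> real (q ^ (\<kappa> - K)) * b j"
        unfolding b_def x_def using Z by (intro corr_sum_bound_product) (auto simp: K_def)
    qed
    have "(\<Sum>v<H. box Q r r' s s' (j * H + v)) = (\<Sum>t<T. \<Sum>c<A. box Q r r' s s' (j * H + (t * A + c)))"
      unfolding H by (simp only: mult.commute[of A T] sum_lessThan_mult)
    also have "\<dots> = (\<Sum>c<A. \<Sum>t<T. box Q r r' s s' (x + c + A * t))"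
      by (subst sum.swap) (simp add: x_def mult.commute add_ac)
    also have "\<dots> = (\<Sum>c<A. (\<Sum>t<T. box Q r r' s s' (x + c + A * t)) - of_real (real T / real M) * (\<Sum>w<M. model \<mu> \<kappa> Q r r' s s' x c w))
        + of_real (real T / real M) * (\<Sum>c<A. \<Sum>w<M. model \<mu> \<kappa> Q r r' s s' x c w)"
      by (simp add: sum_subtractf sum_distrib_left)
    finally have split: "(\<Sum>v<H. box Q r r' s s' (j * H + v)) =
      (\<Sum>c<A. (\<Sum>t<T. box Q r r' s s' (x + c + A * t)) - of_real (real T / real M) * (\<Sum>w<M. model \<mu> \<kappa> Q r r' s s' x c w))
        + of_real (real T / real M) * (\<Sum>c<A. \<Sum>w<M. model \<mu> \<kappa> Q r r' s s' x c w)" .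
    have "cmod (\<Sum>v<H. box Q r r' s s' (j * H + v))
      \<le> (\<Sum>c<A. real T * (2 * \<beta> + 3 * \<epsilon>)) + real T / real M * (real A * real M * b j)"
      unfolding split
    proof (rule norm_triangle_mono)
      show "cmod (\<Sum>c<A. (\<Sum>t<T. box Q r r' s s' (x + c + A * t)) - of_real (real T / real M) * (\<Sum>w<M. model \<mu> \<kappa> Q r r' s s' x c w))
        \<le> (\<Sum>c<A. real T * (2 * \<beta> + 3 * \<epsilon>))" by (intro sum_norm_le pb) auto
      have "cmod (of_real (real T / real M) * (\<Sum>c<A. \<Sum>w<M. model \<mu> \<kappa> Q r r' s s' x c w))
         = real T / real M * cmod (\<Sum>c<A. \<Sum>w<M. model \<mu> \<kappa> Q r r' s s' x c w)"
        by (simp only: norm_mult norm_of_real abs_of_nonneg divide_nonneg_nonneg of_nat_0_le_iff)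
      also have "\<dots> \<le> real T / real M * (real A * real M * b j)" by (intro mult_left_mono mb) auto
      finally show "cmod (of_real (real T / real M) * (\<Sum>c<A. \<Sum>w<M. model \<mu> \<kappa> Q r r' s s' x c w))
         \<le> real T / real M * (real A * real M * b j)" .
    qed
    then have "cmod (\<Sum>v<H. box Q r r' s s' (j * H + v))
      \<le> real A * (real T * (2 * \<beta> + 3 * \<epsilon>)) + real T / real M * (real A * real M * b j)"
      by (simp only: sum_constant card_lessThan)
    moreover have "real T / real M * (real A * real M * b j) = real H * b j"
      unfolding H of_nat_mult using M0 by simp
    moreover have "real A * (real T * (2 * \<beta> + 3 * \<epsilon>)) = real H * (2 * \<beta> + 3 * \<epsilon>)"
      unfolding H of_nat_mult by (simp only: mult.assoc)
    ultimately show ?thesis by (simp only:)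
  qed
  have bsum: "(\<Sum>j<J. b j) \<le> 3 * real J * c_good ^ I"
  proof -
    define s0 where "s0 = s' * q ^ (\<mu> + m - (a + \<tau>))"
    have "j * H + s' * Q = q ^ (a + \<tau>) * (j + s0)" for j
    proof -
      have "q ^ (a + \<tau>) * q ^ (\<mu> + m - (a + \<tau>)) = Q" unfolding Q power_add[symmetric] using h by simp
      then show ?thesis by (simp add: s0_def H_def distrib_left mult.commute mult.left_commute)
    qed
    then have "(\<Sum>j<J. b j) = (\<Sum>j<J. \<Prod>i<I. if good (r' - r) (q ^ (a + \<tau>) * (j + s0)) (Z + l + i * G) then c_swap else 1)"
      by (simp only: b_def K_def)
    also have "\<dots> \<le> 3 * real J * (1 - (1 - c_swap) / (real (q ^ G))\<^sup>2) ^ I"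
      using N by (intro good_average l h c_swap_bounds) (simp add: J_def H_def)
    finally show ?thesis by (simp only: c_good_def)
  qed
  have JH: "real J * real H \<le> real N" 
    by (metis J_def div_times_less_eq_dividend of_nat_le_iff of_nat_mult)
  have c_good0: "c_good ^ I \<ge> 0"
  proof (cases "J = 0")
    case True
    then have "q ^ (Z + l + I * G - (a + \<tau>)) \<le> 0" using N by (simp add: J_def H_def)
    then show ?thesis using q_pos[of "Z + l + I * G - (a + \<tau>)"] by linarith
  next
    case False
    have "0 \<le> (\<Sum>j<J. b j)" unfolding b_def using c_swap_bounds by (intro sum_nonneg prod_nonneg) auto
    then have "0 \<le> 3 * real J * c_good ^ I" using bsum by linarith
    then show ?thesis using False by (simp add: zero_le_mult_iff)
  qed
  have "N = J * H + N mod H" by (simp add: J_def)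
  then have "(\<Sum>n<N. box Q r r' s s' n) = (\<Sum>n<J * H. box Q r r' s s' n) + (\<Sum>n\<in>{J * H..<N}. box Q r r' s s' n)"
    using sum.atLeastLessThan_concat[of 0 "J * H" N "box Q r r' s s'"] by (simp add: atLeast0LessThan J_def)
  also have "(\<Sum>n<J * H. box Q r r' s s' n) = (\<Sum>j<J. \<Sum>v<H. box Q r r' s s' (j * H + v))" by (rule sum_lessThan_mult)
  finally have "cmod (\<Sum>n<N. box Q r r' s s' n)
      \<le> cmod (\<Sum>j<J. \<Sum>v<H. box Q r r' s s' (j * H + v)) + cmod (\<Sum>n\<in>{J * H..<N}. box Q r r' s s' n)"
    by (simp only: norm_triangle_ineq)
  also have "cmod (\<Sum>n\<in>{J * H..<N}. box Q r r' s s' n) \<le> real (card {J * H..<N}) * 1"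
    by (intro sum_norm_bound) (simp add: norm_box)
  also have "card {J * H..<N} = N mod H" by (simp add: J_def minus_div_mult_eq_mod)
  also have "real (N mod H) * 1 \<le> real H" using H0 by (simp add: less_imp_le)
  also have "cmod (\<Sum>j<J. \<Sum>v<H. box Q r r' s s' (j * H + v)) \<le> (\<Sum>j<J. real H * (2 * \<beta> + 3 * \<epsilon>) + real H * b j)"
    by (intro sum_norm_le piece) auto
  also have "\<dots> = real J * real H * (2 * \<beta> + 3 * \<epsilon>) + real H * (\<Sum>j<J. b j)"
    by (simp add: sum.distrib sum_distrib_left)
  also have "\<dots> \<le> real J * real H * (2 * \<beta> + 3 * \<epsilon>) + real H * (3 * real J * c_good ^ I)"
    by (intro add_left_mono mult_left_mono bsum) auto
  also have "\<dots> = real J * real H * (2 * \<beta> + 3 * \<epsilon> + 3 * c_good ^ I)" by (simp add: algebra_simps)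
  also have "\<dots> \<le> real N * (2 * \<beta> + 3 * \<epsilon> + 3 * c_good ^ I)"
    using \<epsilon> \<beta>0 c_good0 by (intro mult_right_mono JH) auto
  finally show ?thesis by (simp add: H_def)
qed

end

context digit_pattern
begin

lemma c_good_bounds: "0 \<le> c_good" "\<zeta> \<noteq> 1 \<Longrightarrow> c_good < 1"
proof -
  define N where "N = (real (q ^ G))\<^sup>2"
  have N: "1 \<le> N" unfolding N_def using q_power_ge_1[of G] by (intro one_le_power) (simp flip: of_nat_power)
  have "(1 - c_swap) / N \<le> 1" using c_swap_bounds N by (subst divide_le_eq_1_pos) auto
  then show "0 \<le> c_good" by (simp add: c_good_def N_def)
  assume "\<zeta> \<noteq> 1"
  have "cmod (1 + \<zeta>) \<noteq> cmod 1 + cmod \<zeta>"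
    using \<open>\<zeta> \<noteq> 1\<close> by (subst norm_triangle_eq) (simp add: norm_zeta)
  then have "cmod (1 + \<zeta>) < 2" using norm_triangle_ineq[of 1 \<zeta>] by (simp add: norm_zeta)
  moreover have "real (q ^ G) > 0" using q_pos[of G] by (simp only: of_nat_0_less_iff)
  ultimately have "c_swap < 1" unfolding c_swap_def by (subst divide_less_eq_1_pos) auto
  then have "(1 - c_swap) / N > 0" using N by simp
  then show "c_good < 1" by (simp add: c_good_def N_def)
qed

text \<open>\<open>\<kappa> = \<nu> + 3 * p\<close> leaves room above the changes of size
  \<open>E'\<close>, and \<open>E\<close> lies \<open>2 * p\<close> digits below
  \<open>q ^ \<mu>\<close>. The three terms of the equidistribution condition have exponent gaps of
  at least \<open>3 * p\<close>, so \<open>\<epsilon> = 1 / q ^ p\<close> is admissible; together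
  with \<open>\<beta> = 8 / q ^ p\<close> and the incomplete last interval this adds up to
  20.\<close>

lemma off_diagonal_saving:
  fixes n \<nu> N :: nat
  assumes G5: "m + 5 \<le> G" "k \<le> G" and n: "n \<ge> 1"
    and p: "p = 2 * G * n" and \<nu>: "\<nu> = 10 * (q * p) + 100 * p + e" and N: "q ^ \<nu> \<le> N" "N < q ^ (\<nu> + 1)"
    and r: "r + q ^ (G * n + 1) \<le> r'" "r' < q ^ p" and s: "s < s'" "s' < q ^ p"
  shows "cmod (\<Sum>x<N. box (q ^ (9 * (q * p) + 97 * p + e)) r r' s s' x) \<le> real N * (20 / real (q ^ p) + 3 * c_good ^ n)"
proof -
  define v where "v = q * p"
  have "1 * G \<le> n * G" using n by (rule mult_le_mono1)
  then have pG: "G \<le> p" "n * G + n * G = p" by (auto simp: p)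
  \<comment> \<open>\<open>d\<close> is \<open>p - m\<close>; using it keeps truncated subtraction
    out of the exponents.\<close>
  obtain d where d: "p = m + d" using pG G5 by (metis add_leD1 le_Suc_ex order_trans)
  have kp: "k \<le> q ^ p"
  proof -
    have "k \<le> p" using G5 pG by simp
    also have "p < 2 ^ p" by (rule less_exp)
    also have "(2::nat) ^ p \<le> q ^ p" using q2 by (rule power_mono) simp
    finally show ?thesis by simp
  qed
  define \<mu> where "\<mu> = 9 * v + 96 * p + e + d"
  define \<kappa> where "\<kappa> = 10 * v + 103 * p + e"
  define a where "a = v + 6 * p"
  define \<tau> where "\<tau> = 7 * v + 79 * p + e + d"
  \<comment> \<open>This is \<open>\<mu> + m + i\<close> with \<open>i = v + 1\<close>, the lowest
    position reachable by averaging over \<open>c\<close>.\<close>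
  define Z where "Z = 10 * v + 97 * p + e + 1"
  define E where "E = q ^ (9 * v + 94 * p + e + d)"
  define E' where "E' = q ^ (\<nu> + p + 5)"
  define Y where "Y = q ^ (3 * v + 27 * p)"
  define Q where "Q = q ^ (9 * v + 97 * p + e)"
  have "9 * v + 97 * p + e = \<mu> + m" using d by (simp add: \<mu>_def)
  then have Q: "Q = q ^ (\<mu> + m)" by (simp only: Q_def)
  have \<nu>v: "\<nu> = 10 * v + 100 * p + e" using \<nu> by (simp add: v_def)
  have p1: "p \<ge> 5" using pG G5 by simp
  define t where "t = r' - r"
  have t: "q ^ (G * n + 1) \<le> t" "t < q ^ p" "r < r'"
    unfolding t_def using r q_pos[of "G * n + 1"] by linarith+
  obtain j where j: "q ^ j \<le> 2 * t" "2 * t < q ^ (j + 1)"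
  proof -
    have "1 \<le> 2 * t" using t(1) q_pos[of "G * n + 1"] by linarith
    then show ?thesis using ex_power_ivl1[OF q2] that by blast
  qed
  have "q ^ (G * n + 1) < q ^ (j + 1)" using t(1) j(2) by linarith
  then have jlo: "G * n + 1 \<le> j" using q2 by (subst (asm) power_strict_increasing_iff) auto
  have "q ^ j < 2 * q ^ p" using j(1) t(2) by linarith
  also have "\<dots> \<le> q ^ (p + 1)" by (rule two_mult_q_power)
  finally have jhi: "j < p + 1" using q2 by (subst (asm) power_strict_increasing_iff) auto
  define l where "l = j - 1"
  have l: "q ^ (l + 1) \<le> 2 * (r' - r)" "2 * (r' - r) < q ^ (l + 2)" "n * G \<le> l" "l < p"
    using j jlo jhi by (auto simp: l_def t_def mult.commute)
  have rk: "r' + k \<le> q ^ (p + 1)" using r(2) kp two_mult_q_power[of p] by linarith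
  have rk2: "(r' + k)\<^sup>2 \<le> q ^ (2 * p + 2)"
    using power_mono[OF rk, of 2] by (simp add: power_mult[symmetric] algebra_simps del: power_Suc)
  have E_le: "2 * q ^ (a + \<tau>) * (r' + k) + (r' + k)\<^sup>2 \<le> E"
  proof -
    have "2 * q ^ (a + \<tau>) * (r' + k) \<le> q ^ (a + \<tau> + 1) * q ^ (p + 1)"
      by (intro mult_mono two_mult_q_power rk) auto
    also have "\<dots> = q ^ (a + \<tau> + 1 + (p + 1))" by (simp only: power_add)
    also have "\<dots> \<le> q ^ (9 * v + 93 * p + e + d)" using p1 by (intro q_power_mono) (simp add: a_def \<tau>_def)
    finally have 1: "2 * q ^ (a + \<tau>) * (r' + k) \<le> q ^ (9 * v + 93 * p + e + d)" .
    have "q ^ (2 * p + 2) \<le> q ^ (9 * v + 93 * p + e + d)" using p1 by (intro q_power_mono) simp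
    then have "2 * q ^ (a + \<tau>) * (r' + k) + (r' + k)\<^sup>2 \<le> 2 * q ^ (9 * v + 93 * p + e + d)" using 1 rk2 by linarith
    also have "\<dots> \<le> q ^ (9 * v + 93 * p + e + d + 1)" by (rule two_mult_q_power)
    also have "\<dots> \<le> E" unfolding E_def using p1 by (intro q_power_mono) simp
    finally show ?thesis .
  qed
  have E'_le: "2 * (N + s' * Q) * (r' + k) + (r' + k)\<^sup>2 \<le> E'"
  proof -
    have "s' * Q \<le> q ^ p * Q" using s by (intro mult_right_mono) auto
    also have "\<dots> = q ^ (p + (9 * v + 97 * p + e))" by (simp only: Q_def power_add)
    also have "\<dots> \<le> q ^ (\<nu> + 1)" by (intro q_power_mono) (simp add: \<nu>v)
    finally have "N + s' * Q \<le> 2 * q ^ (\<nu> + 1)" using N by linarith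
    also have "\<dots> \<le> q ^ (\<nu> + 1 + 1)" by (rule two_mult_q_power)
    finally have "2 * (N + s' * Q) \<le> 2 * q ^ (\<nu> + 1 + 1)" by simp
    also have "\<dots> \<le> q ^ (\<nu> + 1 + 1 + 1)" by (rule two_mult_q_power)
    finally have "2 * (N + s' * Q) * (r' + k) \<le> q ^ (\<nu> + 1 + 1 + 1) * q ^ (p + 1)"
      by (intro mult_mono rk) auto
    also have "\<dots> = q ^ (\<nu> + p + 4)"
      unfolding power_add[symmetric] by (rule arg_cong[of _ _ "(^) q"]) simp
    finally have 1: "2 * (N + s' * Q) * (r' + k) \<le> q ^ (\<nu> + p + 4)" .
    have "q ^ (2 * p + 2) \<le> q ^ (\<nu> + p + 4)" by (intro q_power_mono) (simp add: \<nu>v)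
    then have "2 * (N + s' * Q) * (r' + k) + (r' + k)\<^sup>2 \<le> 2 * q ^ (\<nu> + p + 4)" using 1 rk2 by linarith
    also have "\<dots> \<le> q ^ (\<nu> + p + 4 + 1)" by (rule two_mult_q_power)
    also have "\<nu> + p + 4 + 1 = \<nu> + p + 5" by simp
    finally show ?thesis unfolding E'_def .
  qed
  have rpos: "real (q ^ i) > 0" for i using q_pos[of i] by (simp only: of_nat_0_less_iff)
  have q0: "q \<noteq> 0" using q2 by simp
  have \<beta>: "real (2 * k * (q ^ (\<kappa> - \<mu>) * (E + E)) + 2 * (q ^ m * (E + E'))) \<le> 8 / real (q ^ p) * real (q ^ \<kappa>)"
  proof -
    define x where "x = \<nu> + 2 * p"
    have \<kappa>x: "\<kappa> = p + x" by (simp add: \<kappa>_def x_def \<nu>v)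
    have "2 * k * (q ^ (\<kappa> - \<mu>) * (E + E)) = 4 * (k * (q ^ (\<kappa> - \<mu>) * E))" by simp
    also have "q ^ (\<kappa> - \<mu>) * E = q ^ ((\<kappa> - \<mu>) + (9 * v + 94 * p + e + d))" unfolding E_def by (simp only: power_add)
    also have "(\<kappa> - \<mu>) + (9 * v + 94 * p + e + d) = \<nu> + p"
      using d by (simp add: \<kappa>_def \<mu>_def \<nu>v)
    also have "4 * (k * q ^ (\<nu> + p)) \<le> 4 * (q ^ p * q ^ (\<nu> + p))" by (intro mult_le_mono2 mult_right_mono kp) auto
    also have "q ^ p * q ^ (\<nu> + p) = q ^ x"
      unfolding power_add[symmetric] by (rule arg_cong[of _ _ "(^) q"]) (simp add: x_def)
    finally have 1: "2 * k * (q ^ (\<kappa> - \<mu>) * (E + E)) \<le> 4 * q ^ x" .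
    have "E \<le> E'" unfolding E_def E'_def by (intro q_power_mono) (simp add: \<nu>v d)
    then have "2 * (q ^ m * (E + E')) \<le> 4 * (q ^ m * E')"
      using mult_le_mono2[of "E + E'" "2 * E'" "q ^ m"] by simp
    also have "q ^ m * E' = q ^ (m + (\<nu> + p + 5))" unfolding E'_def by (simp only: power_add)
    also have "4 * \<dots> \<le> 4 * q ^ x" using pG G5 by (intro mult_le_mono2 q_power_mono) (simp add: x_def)
    finally have "2 * k * (q ^ (\<kappa> - \<mu>) * (E + E)) + 2 * (q ^ m * (E + E')) \<le> 8 * q ^ x" using 1 by linarith
    then have "real (2 * k * (q ^ (\<kappa> - \<mu>) * (E + E)) + 2 * (q ^ m * (E + E'))) \<le> real (8 * q ^ x)" by (simp only: of_nat_le_iff)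
    also have "\<dots> = 8 / real (q ^ p) * real (q ^ \<kappa>)"
      using q0 unfolding \<kappa>x power_add of_nat_mult by simp
    finally show ?thesis .
  qed
  define \<delta> where "\<delta> = 1 / real (q ^ (3 * p))"
  have ratio: "real (q ^ i) / real (q ^ i') \<le> \<delta>" if "i + 3 * p \<le> i'" for i i'
  proof -
    have "q ^ i * q ^ (3 * p) \<le> q ^ i'" using that by (simp add: power_add[symmetric] q_power_mono)
    then have "real (q ^ i) * real (q ^ (3 * p)) \<le> real (q ^ i')" by (metis of_nat_le_iff of_nat_mult)
    then show ?thesis using rpos[of i'] rpos[of "3 * p"] by (simp add: \<delta>_def divide_simps mult.commute)
  qed
  have rel: "2 * real ((q ^ a)\<^sup>2 * q ^ \<tau>) / real E + 2 * real (q ^ \<kappa>) * (real Y + real (q ^ \<tau>) / real Y) / (real (q ^ \<tau>))\<^sup>2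
       + 5 * real (q ^ \<kappa>) / (real (q ^ \<tau>) * real E) \<le> (1 / real (q ^ p))\<^sup>2"
  proof -
    have "(q ^ a)\<^sup>2 * q ^ \<tau> = q ^ (2 * a + \<tau>)" by (simp add: power_add power_mult[symmetric] mult.commute)
    then have 1: "2 * real ((q ^ a)\<^sup>2 * q ^ \<tau>) / real E \<le> 2 * \<delta>"
      using ratio[of "2 * a + \<tau>" "9 * v + 94 * p + e + d"] by (simp add: E_def a_def \<tau>_def)
    have T0: "real (q ^ \<tau>) > 0" and Y0: "real Y > 0" unfolding Y_def by (rule rpos)+
    have "Y * Y \<le> q ^ \<tau>" unfolding Y_def power_add[symmetric] by (intro q_power_mono) (simp add: \<tau>_def)
    then have "real Y * real Y \<le> real (q ^ \<tau>)" by (metis of_nat_le_iff of_nat_mult)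
    then have YT: "real Y \<le> real (q ^ \<tau>) / real Y" using Y0 by (simp add: pos_le_divide_eq)
    have "2 * real (q ^ \<kappa>) * (real Y + real (q ^ \<tau>) / real Y) / (real (q ^ \<tau>))\<^sup>2
      \<le> 2 * real (q ^ \<kappa>) * (real (q ^ \<tau>) / real Y + real (q ^ \<tau>) / real Y) / (real (q ^ \<tau>))\<^sup>2"
      using YT by (intro divide_right_mono mult_left_mono) auto
    also have "\<dots> = 4 * (real (q ^ \<kappa>) / (real (q ^ \<tau>) * real Y))"
      using T0 Y0 by (simp add: power2_eq_square)
    also have "real (q ^ \<tau>) * real Y = real (q ^ (\<tau> + (3 * v + 27 * p)))"
      unfolding Y_def by (simp only: power_add of_nat_mult)
    also have "4 * (real (q ^ \<kappa>) / real (q ^ (\<tau> + (3 * v + 27 * p)))) \<le> 4 * \<delta>"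
      by (intro mult_left_mono ratio) (auto simp: \<kappa>_def \<tau>_def)
    finally have 2: "2 * real (q ^ \<kappa>) * (real Y + real (q ^ \<tau>) / real Y) / (real (q ^ \<tau>))\<^sup>2 \<le> 4 * \<delta>" .
    have "real (q ^ \<tau>) * real E = real (q ^ (\<tau> + (9 * v + 94 * p + e + d)))"
      unfolding E_def by (simp only: power_add of_nat_mult)
    then have "5 * real (q ^ \<kappa>) / (real (q ^ \<tau>) * real E) = 5 * (real (q ^ \<kappa>) / real (q ^ (\<tau> + (9 * v + 94 * p + e + d))))"
      by simp
    also have "\<dots> \<le> 5 * \<delta>" by (intro mult_left_mono ratio) (auto simp: \<kappa>_def \<tau>_def)
    finally have 3: "5 * real (q ^ \<kappa>) / (real (q ^ \<tau>) * real E) \<le> 5 * \<delta>" .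
    have "11 * \<delta> \<le> (1 / real (q ^ p))\<^sup>2"
    proof -
      have "(16::nat) = 2 ^ 4" by simp
      also have "(2::nat) ^ 4 \<le> q ^ 4" using q2 by (rule power_mono) simp
      also have "\<dots> \<le> q ^ p" using p1 by (intro q_power_mono) simp
      finally have "16 \<le> real (q ^ p)" by (metis of_nat_le_iff of_nat_numeral)
      moreover have "\<delta> = (1 / real (q ^ p))\<^sup>2 * (1 / real (q ^ p))"
        by (simp add: \<delta>_def power_mult[symmetric] power2_eq_square power3_eq_cube mult.commute[of 3] power_mult)
      moreover have "11 * (1 / P) \<le> 1" if "16 \<le> P" for P :: real using that by (simp add: field_simps)
      moreover have "11 * (y\<^sup>2 * y) \<le> y\<^sup>2" if "11 * y \<le> 1" for y :: real
        using mult_left_mono[OF that, of "y\<^sup>2"] by (simp add: algebra_simps)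
      ultimately show ?thesis by metis
    qed
    with 1 2 3 show ?thesis by linarith
  qed
  \<comment> \<open>The bound \<open>q ^ p\<close> for \<open>s'\<close> is turned into a power of 2
    by \<open>q \<le> 2 ^ q\<close>, which is why \<open>v = q * p\<close>.\<close>
  have "2 * (s' - s) \<le> 2 ^ (v + 1)"
  proof -
    have "q \<le> 2 ^ q" using less_exp[of q] by simp
    then have "q ^ p \<le> (2 ^ q) ^ p" by (rule power_mono) simp
    then have "q ^ p \<le> 2 ^ v" by (simp add: v_def power_mult)
    then show ?thesis using s by simp
  qed
  moreover have "q ^ (Z + l + n * G - (a + \<tau>)) \<le> N div q ^ (a + \<tau>)"
  proof -
    have "Z + l + n * G - (a + \<tau>) \<le> \<nu> - (a + \<tau>)"
      using l pG p1 by (intro diff_le_mono) (simp add: Z_def \<nu>v)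
    then have "q ^ (Z + l + n * G - (a + \<tau>)) \<le> q ^ (\<nu> - (a + \<tau>))" by (rule q_power_mono)
    also have "\<dots> = q ^ \<nu> div q ^ (a + \<tau>)"
      using q2 d by (intro power_diff) (auto simp: \<nu>v a_def \<tau>_def)
    also have "\<dots> \<le> N div q ^ (a + \<tau>)" by (intro div_le_mono N)
    finally show ?thesis .
  qed
  moreover have "E \<le> q ^ \<kappa>" unfolding E_def by (intro q_power_mono) (simp add: \<kappa>_def d)
  ultimately have "cmod (\<Sum>x<N. box Q r r' s s' x)
      \<le> real (q ^ (a + \<tau>)) + real N * (2 * (8 / real (q ^ p)) + 3 * (1 / real (q ^ p)) + 3 * c_good ^ n)"
    using l pG d q_pos p1
    by (intro off_diagonal_bound[where Z = Z and i = "v + 1" and Y = Y and L = E and E = E and E' = E' and l = l,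
          OF t(3) _ _ _ s(1) _ Q _ _ _ _ refl _ _ _ _ _ _ _ _ rel E_le E'_le \<beta>])
      (auto simp: a_def \<mu>_def \<kappa>_def Z_def \<tau>_def E_def Y_def)
  moreover have "real (q ^ (a + \<tau>)) \<le> real N * (1 / real (q ^ p))"
  proof -
    have "q ^ (a + \<tau>) * q ^ p = q ^ (a + \<tau> + p)" by (simp only: power_add)
    also have "\<dots> \<le> q ^ \<nu>" using d by (intro q_power_mono) (simp add: a_def \<tau>_def \<nu>v)
    also have "\<dots> \<le> N" by (rule N)
    finally have "real (q ^ (a + \<tau>)) * real (q ^ p) \<le> real N" by (metis of_nat_le_iff of_nat_mult)
    then show ?thesis using rpos[of p] by (simp add: pos_le_divide_eq)
  qed
  ultimately have "cmod (\<Sum>x<N. box Q r r' s s' x)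
      \<le> real N * (1 / real (q ^ p)) + real N * (2 * (8 / real (q ^ p)) + 3 * (1 / real (q ^ p)) + 3 * c_good ^ n)"
    by linarith
  also have "\<dots> = real N * (20 / real (q ^ p) + 3 * c_good ^ n)"
    unfolding distrib_left[symmetric] by simp
  finally show ?thesis by (simp only: Q_def v_def)
qed

text \<open>The gap \<open>q ^ (G * n + 1)\<close> is, up to a factor \<open>q\<close>, the square
  root of the range \<open>q ^ p\<close>. It is small enough for the excluded pairs to be
  negligible, and large enough for \<open>r' - r\<close> to provide \<open>n\<close> digits of base
  \<open>q ^ G\<close>.\<close>

lemma phase_sum_saving:
  assumes G5: "m + 5 \<le> G" "k \<le> G" and \<zeta>: "\<zeta> \<noteq> 1"
  shows "\<exists>\<phi> C. 0 < \<phi> \<and> \<phi> < 1 \<and> C > 0 \<and> (\<forall>n \<nu> N. q ^ \<nu> \<le> N \<longrightarrow> N < q ^ (\<nu> + 1) \<longrightarrow>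
    (10 * q + 100) * (2 * G) * n \<le> \<nu> \<longrightarrow> cmod (\<Sum>x<N. phase x) \<le> C * real N * \<phi> ^ n)"
proof -
  \<comment> \<open>The maximum with \<open>1 / 2\<close> lets \<open>\<theta> ^ n\<close> also
    dominate the powers \<open>1 / q ^ i\<close> with \<open>i \<ge> n\<close>. The fourth root
    below undoes the two applications of Cauchy--Schwarz.\<close>
  define \<theta> where "\<theta> = max c_good (1 / 2)"
  define \<phi> where "\<phi> = root 4 \<theta>"
  define C where "C = 2 * real q + 28"
  have \<theta>: "1 / 2 \<le> \<theta>" "c_good \<le> \<theta>" "\<theta> < 1" using c_good_bounds(2)[OF \<zeta>] by (auto simp: \<theta>_def)
  have \<phi>: "0 < \<phi>" "\<phi> < 1" "\<phi> ^ 4 = \<theta>" using \<theta> by (auto simp: \<phi>_def)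
  have "cmod (\<Sum>x<N. phase x) \<le> C * real N * \<phi> ^ n"
    if N: "q ^ \<nu> \<le> N" "N < q ^ (\<nu> + 1)" and n\<nu>: "(10 * q + 100) * (2 * G) * n \<le> \<nu>" for n \<nu> N
  proof (cases "n = 0")
    case True
    have "cmod (\<Sum>x<N. phase x) \<le> real (card {..<N}) * 1" by (intro sum_norm_bound) (simp add: norm_phase)
    also have "\<dots> \<le> C * real N" using mult_right_mono[of 1 C "real N"] by (simp add: C_def)
    finally show ?thesis using True by simp
  next
    case False
    define p where "p = 2 * G * n"
    have "(10 * q + 100) * (2 * G) * n = 10 * (q * p) + 100 * p" by (simp add: p_def algebra_simps)
    then obtain e where \<nu>: "\<nu> = 10 * (q * p) + 100 * p + e" using n\<nu> by (metis le_Suc_ex)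
    define Q where "Q = q ^ (9 * (q * p) + 97 * p + e)"
    define x where "x = 1 / real (q ^ p)"
    have rpos: "real (q ^ i) > 0" for i using q_pos[of i] by (simp only: of_nat_0_less_iff)
    have G1: "n \<le> G * n" using G5 by simp
    have small: "1 / real (q ^ i) \<le> \<theta> ^ n" if "n \<le> i" for i
    proof -
      have "(2::nat) ^ n \<le> q ^ n" using q2 by (rule power_mono) simp
      also have "\<dots> \<le> q ^ i" using that by (rule q_power_mono)
      finally have "real (2 ^ n) \<le> real (q ^ i)" by (simp only: of_nat_le_iff)
      then have "1 / real (q ^ i) \<le> 1 / real (2 ^ n)" using rpos[of i] by (intro divide_left_mono) auto
      also have "\<dots> = (1 / 2) ^ n" by (simp add: power_one_over)
      also have "\<dots> \<le> \<theta> ^ n" using \<theta> by (intro power_mono) auto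
      finally show ?thesis .
    qed
    have xs: "x \<le> \<theta> ^ n" unfolding x_def by (rule small) (use G1 in \<open>simp add: p_def\<close>)
    have cs: "c_good ^ n \<le> \<theta> ^ n" using \<theta> c_good_bounds(1) by (intro power_mono) auto
    \<comment> \<open>The constant collects \<open>2 * q\<close> from the excluded gaps, 1 from
      \<open>s = s'\<close>, and \<open>20 + 3\<close> from the off-diagonal terms.\<close>
    define X where "X = (2 * real q + 24) * \<phi> ^ n"
    have X0: "X \<ge> 0" using \<phi> by (simp add: X_def)
    have "cmod (\<Sum>y<N. phase y) \<le> 2 * (real (q ^ p) + real (q ^ p) * real Q) + real N * X"
    proof (rule box_bound[where ?T0.0 = "q ^ (G * n + 1)" and \<epsilon> = "20 * x + 3 * c_good ^ n"])
      show "cmod (phase y) \<le> 1" for y by (simp add: norm_phase)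
      show "q ^ p > 0" "q ^ p > 0" "q ^ (G * n + 1) > 0" by (rule q_pos)+
      show "0 \<le> 20 * x + 3 * c_good ^ n" using c_good_bounds(1) by (simp add: x_def)
      show "X \<ge> 0" by (rule X0)
      show "cmod (\<Sum>y<N. phase (y + r + s * Q) * cnj (phase (y + r' + s * Q)) * cnj (phase (y + r + s' * Q)) * phase (y + r' + s' * Q))
          \<le> real N * (20 * x + 3 * c_good ^ n)"
        if "r + q ^ (G * n + 1) \<le> r'" "r' < q ^ p" "s < s'" "s' < q ^ p" for r r' s s'
        using off_diagonal_saving[OF G5 _ p_def \<nu> N that] False
        unfolding box_def Q_def x_def by simp
      have "p = G * n + G * n" by (simp add: p_def)
      then have "q ^ p = q ^ (G * n) * q ^ (G * n)" by (simp only: power_add)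
      then have "2 * real (q ^ (G * n + 1)) / real (q ^ p) = 2 * real q * (1 / real (q ^ (G * n)))"
        using rpos[of "G * n"] by (simp add: divide_simps)
      also have "\<dots> \<le> 2 * real q * \<theta> ^ n" by (intro mult_left_mono small G1) auto
      finally have "2 * real (q ^ (G * n + 1)) / real (q ^ p) + 1 / real (q ^ p) + (20 * x + 3 * c_good ^ n) \<le> (2 * real q + 24) * \<theta> ^ n"
        using xs cs unfolding x_def[symmetric] distrib_right by linarith
      also have "\<dots> \<le> (2 * real q + 24) ^ 4 * \<theta> ^ n"
        using \<theta> power_increasing[of 1 4 "2 * real q + 24"] by (intro mult_right_mono) auto
      also have "\<dots> = X ^ 4"
        unfolding X_def power_mult_distrib \<phi>(3)[symmetric] by (simp add: power_mult[symmetric] mult.commute)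
      finally show "2 * real (q ^ (G * n + 1)) / real (q ^ p) + 1 / real (q ^ p) + (20 * x + 3 * c_good ^ n) \<le> X ^ 4" .
    qed
    moreover have "2 * (real (q ^ p) + real (q ^ p) * real Q) \<le> 4 * (real N * x)"
    proof -
      have "q ^ p * 1 \<le> q ^ p * Q" unfolding Q_def by (intro mult_le_mono2 q_power_ge_1)
      moreover have "q ^ p * Q * q ^ p \<le> N"
      proof -
        have "q ^ p * Q * q ^ p = q ^ (p + (9 * (q * p) + 97 * p + e) + p)" unfolding Q_def by (simp only: power_add)
        also have "\<dots> \<le> q ^ \<nu>" by (intro q_power_mono) (simp add: \<nu>)
        finally show ?thesis using N by linarith
      qed
      then have "real (q ^ p * Q) * real (q ^ p) \<le> real N" by (metis of_nat_le_iff of_nat_mult)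
      then have "real (q ^ p * Q) \<le> real N * x" using rpos[of p] by (simp add: x_def pos_le_divide_eq)
      moreover have "real (q ^ p * 1) \<le> real (q ^ p * Q)" using calculation(1) by (simp only: of_nat_le_iff)
      ultimately show ?thesis by simp
    qed
    moreover have "4 * (real N * x) \<le> 4 * (real N * \<phi> ^ n)"
    proof -
      have "\<theta> \<le> \<phi>" using \<phi> power_decreasing[of 1 4 \<phi>] by simp
      then have "\<theta> ^ n \<le> \<phi> ^ n" using \<theta> by (intro power_mono) auto
      then show ?thesis using xs by (intro mult_left_mono) auto
    qed
    moreover have "4 * (real N * \<phi> ^ n) + real N * X = C * real N * \<phi> ^ n"
      by (simp add: X_def C_def algebra_simps)
    ultimately show ?thesis by linarith
  qed
  moreover have "C > 0" by (simp add: C_def)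
  ultimately show ?thesis using \<phi> by blast
qed

end

section \<open>Conclusion\<close>

lemma power_saving_of_digit_saving:
  fixes f :: "nat \<Rightarrow> real" and q K :: nat and \<phi> C :: real
  assumes q: "q \<ge> 2" and K: "K > 0" and \<phi>: "0 < \<phi>" "\<phi> < 1" and C: "C > 0"
    and f: "\<And>n \<nu> N. q ^ \<nu> \<le> N \<Longrightarrow> N < q ^ (\<nu> + 1) \<Longrightarrow> K * n \<le> \<nu> \<Longrightarrow> f N \<le> C * real N * \<phi> ^ n"
  shows "\<exists>\<eta> > 0. \<exists>C > 0. \<forall>N \<ge> (1::nat). f N \<le> C * real N powr (1 - \<eta>)"
proof -
  \<comment> \<open>Chosen so that \<open>\<phi> = q powr (- (K * \<eta>))\<close>. Rounding
    \<open>\<nu> / K\<close> down to \<open>n\<close> loses at most one factor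
    \<open>\<phi>\<close>, hence the constant \<open>C / \<phi>\<close>.\<close>
  define \<eta> where "\<eta> = - ln \<phi> / (real K * ln (real q))"
  have lnq: "ln (real q) > 0" using q by simp
  have ln\<phi>: "ln \<phi> < 0" using \<phi> by simp
  have \<eta>: "\<eta> > 0" unfolding \<eta>_def using lnq ln\<phi> K by (intro divide_pos_pos mult_pos_pos) auto
  have "f N \<le> C / \<phi> * real N powr (1 - \<eta>)" if N1: "N \<ge> 1" for N :: nat
  proof -
    obtain \<nu> where \<nu>: "q ^ \<nu> \<le> N" "N < q ^ (\<nu> + 1)" using ex_power_ivl1[OF q N1] by blast
    define n where "n = \<nu> div K"
    have "K * n \<le> \<nu>" by (simp add: n_def)
    from f[OF \<nu> this] have fN: "f N \<le> C * real N * \<phi> ^ n" .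
    have "\<nu> + 1 \<le> K * (n + 1)" using dividend_less_times_div[OF K, of \<nu>] by (simp add: n_def)
    then have \<nu>n: "real (\<nu> + 1) \<le> real K * (real n + 1)" by (metis of_nat_1 of_nat_add of_nat_le_iff of_nat_mult)
    have "real N \<le> real q ^ (\<nu> + 1)" using \<nu>(2) by (metis less_imp_le of_nat_le_iff of_nat_power)
    then have "ln (real N) \<le> ln (real q ^ (\<nu> + 1))" using N1 q by (subst ln_le_cancel_iff) auto
    also have "\<dots> = real (\<nu> + 1) * ln (real q)" using q by (simp only: ln_realpow)
    also have "\<dots> \<le> real K * (real n + 1) * ln (real q)" using \<nu>n lnq by (intro mult_right_mono) auto
    finally have "\<eta> * ln (real N) \<le> \<eta> * (real K * (real n + 1) * ln (real q))" using \<eta> by (intro mult_left_mono) auto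
    also have "\<dots> = - (real n + 1) * ln \<phi>" unfolding \<eta>_def using lnq K by (simp add: algebra_simps)
    finally have le: "real (n + 1) * ln \<phi> \<le> - \<eta> * ln (real N)" by (simp add: algebra_simps)
    have "\<phi> ^ (n + 1) = exp (real (n + 1) * ln \<phi>)" using \<phi>(1) by (simp only: exp_of_nat_mult exp_ln)
    also have "\<dots> \<le> exp (- \<eta> * ln (real N))" using le by (simp only: exp_le_cancel_iff)
    also have "\<dots> = real N powr (- \<eta>)" using N1 by (simp add: powr_def)
    finally have "\<phi> ^ n \<le> real N powr (- \<eta>) / \<phi>" using \<phi> by (simp add: pos_le_divide_eq mult.commute)
    then have "C * real N * \<phi> ^ n \<le> C * real N * (real N powr (- \<eta>) / \<phi>)" using C by (intro mult_left_mono) auto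
    also have "\<dots> = C / \<phi> * real N powr (1 - \<eta>)" using N1 by (simp add: powr_diff powr_minus field_simps)
    finally show ?thesis using fN by linarith
  qed
  then show ?thesis using \<eta> C \<phi> by (intro exI[of _ \<eta>] conjI exI[of _ "C / \<phi>"] allI impI) auto
qed

theorem theorem2:
  fixes q m' k :: nat and b :: "nat \<Rightarrow> nat" and \<alpha> :: "nat \<Rightarrow> real"
  assumes "q \<ge> 2"
    and "digital_function q b"
    and "gcd (q - 1) m' = 1"
    and "gcd m' (Gcd (range b)) = 1"
    and "k \<ge> 1"
    and "\<forall>l<k. \<alpha> l \<in> {real a / real m' | a. a < m'}"
    and "\<exists>l<k. \<alpha> l \<noteq> 0"
  shows "\<exists>\<eta> > 0. \<exists>C > 0. \<forall>N \<ge> (1::nat).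
    cmod (\<Sum>n<N. exp (2 * pi * \<i> * complex_of_real (\<Sum>l<k. \<alpha> l * real (b ((n + l)\<^sup>2)))))
      \<le> C * real N powr (1 - \<eta>)"
proof -
  obtain m where m: "m \<ge> 1" and b0: "b 0 = 0" and bq: "\<And>n. b (q * n) = b n"
    and low: "\<And>P n n'. n mod q ^ (P + m) = n' mod q ^ (P + m) \<Longrightarrow> b n + b (n' div q ^ P) = b n' + b (n div q ^ P)"
    and split: "\<And>B x w. w * q ^ m < q ^ B \<Longrightarrow> b (x * q ^ B + w) = b x + b w"
    using digital_function_props[OF assms(1,2)] by blast
  define \<chi> where "\<chi> l x = cis (2 * pi * \<alpha> l * real (b x))" for l x
  \<comment> \<open>The least index is taken so that all earlier strands have trivial phase.\<close>
  define i0 where "i0 = (LEAST l. l < k \<and> \<alpha> l \<noteq> 0)"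
  have i0: "i0 < k" "\<alpha> i0 \<noteq> 0" using LeastI_ex[OF assms(7)] by (auto simp: i0_def)
  have before: "\<alpha> l = 0" if "l < i0" for l
    using not_less_Least[of l "\<lambda>l. l < k \<and> \<alpha> l \<noteq> 0"] that i0 by (auto simp: i0_def)
  obtain a where a: "\<alpha> i0 = real a / real m'" "a < m'" using assms(6) i0 by blast
  have "a > 0" using a i0 by (cases a) auto
  have "\<chi> i0 x = cis (2 * pi * (real a / real m') * real (b x))" for x by (simp add: \<chi>_def a)
  from exists_nonlinear_phase[OF assms(1) b0 bq this \<open>a > 0\<close> a(2) assms(3,4), of m]
  obtain u \<delta> where u\<delta>: "\<delta> > 0" "\<chi> i0 (u + q ^ m * \<delta>) * \<chi> i0 (u + 1) \<noteq> \<chi> i0 u * \<chi> i0 (u + 1 + q ^ m * \<delta>)"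
    by blast
  define \<Delta> where "\<Delta> = q ^ m * \<delta>"
  define B' where "B' = 8 * k\<^sup>2 + 2 * k + 2 * q\<^sup>2 + 2"
  \<comment> \<open>\<open>u + 1 + \<Delta> + m\<close> makes the block long enough, by
    \<open>n < q ^ n\<close>; the terms \<open>5\<close> and \<open>k\<close> secure
    \<open>m + 5 \<le> G\<close> and \<open>k \<le> G\<close>.\<close>
  define B where "B = u + 1 + \<Delta> + m + 5 + k"
  interpret digit_phase q m k \<chi>
  proof
    show "2 \<le> q" by (fact assms)
    show "cmod (\<chi> l x) = 1" for l x by (simp add: \<chi>_def)
    show "\<chi> l n * \<chi> l (n' div q ^ P) = \<chi> l n' * \<chi> l (n div q ^ P)"
      if "n mod q ^ (P + m) = n' mod q ^ (P + m)" for n P n' l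
      unfolding \<chi>_def cis_mult distrib_left[symmetric] of_nat_add[symmetric] low[OF that] ..
    show "\<chi> l (x * q ^ B + w) = \<chi> l x * \<chi> l w" if "w * q ^ m < q ^ B" for w B l x
      unfolding \<chi>_def cis_mult distrib_left[symmetric] of_nat_add[symmetric] split[OF that] ..
  qed
  have n_less: "n < q ^ n" for n
    using less_exp[of n] power_mono[of 2 q n] assms(1) by linarith
  interpret digit_pattern q m k \<chi> i0 u \<Delta> B' B "B' + B" "q ^ B'"
  proof
    show "i0 < k" by (fact i0)
    show "\<chi> l x = 1" if "l < i0" for l x using before[OF that] by (simp add: \<chi>_def)
    show "0 < \<Delta>" using u\<delta>(1) q_pos[of m] by (simp add: \<Delta>_def)
    show "q ^ m dvd \<Delta>" by (simp add: \<Delta>_def)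
    have "(u + 1 + \<Delta>) * q ^ m < q ^ (u + 1 + \<Delta>) * q ^ m"
      by (intro mult_strict_right_mono n_less q_pos)
    also have "\<dots> \<le> q ^ B" unfolding power_add[symmetric] by (intro q_power_mono) (simp add: B_def)
    finally show "(u + 1 + \<Delta>) * q ^ m < q ^ B" .
    show "8 * k\<^sup>2 + 2 * k + 2 * q\<^sup>2 + 2 \<le> q ^ B'"
      using n_less[of B'] unfolding B'_def by linarith
  qed (rule refl)+
  have "\<zeta> \<noteq> 1"
  proof
    assume z: "\<zeta> = 1"
    have "\<chi> i0 (u + \<Delta>) / \<chi> i0 u = \<chi> i0 (u + \<Delta>) / \<chi> i0 u * (cnj (\<chi> i0 (u + 1 + \<Delta>) / \<chi> i0 (u + 1)) * (\<chi> i0 (u + 1 + \<Delta>) / \<chi> i0 (u + 1)))"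
      using mult_cnj_eq_1[of "\<chi> i0 (u + 1 + \<Delta>) / \<chi> i0 (u + 1)"] by (simp add: norm_divide norm_chi mult.commute)
    also have "\<dots> = \<chi> i0 (u + 1 + \<Delta>) / \<chi> i0 (u + 1)"
      using z unfolding \<zeta>_def mult.assoc[symmetric] by simp
    finally show False using u\<delta>(2) chi_nonzero by (simp add: \<Delta>_def divide_simps mult_ac)
  qed
  moreover have "m + 5 \<le> B' + B" "k \<le> B' + B" by (simp_all add: B_def)
  ultimately obtain \<phi> C where \<phi>: "0 < \<phi>" "\<phi> < 1" "C > 0"
    and bound: "\<And>n \<nu> N. q ^ \<nu> \<le> N \<Longrightarrow> N < q ^ (\<nu> + 1) \<Longrightarrow>
      (10 * q + 100) * (2 * (B' + B)) * n \<le> \<nu> \<Longrightarrow> cmod (\<Sum>x<N. phase x) \<le> C * real N * \<phi> ^ n"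
    using phase_sum_saving by blast
  have phase: "exp (2 * pi * \<i> * complex_of_real (\<Sum>l<k. \<alpha> l * real (b ((n + l)\<^sup>2)))) = phase n" for n
    unfolding phase_def \<chi>_def cis_conv_exp exp_sum[symmetric, OF finite_lessThan]
    by (simp add: sum_distrib_left mult_ac)
  show ?thesis unfolding phase
  proof (rule power_saving_of_digit_saving[OF assms(1) _ \<phi> bound])
    show "0 < (10 * q + 100) * (2 * (B' + B))" by (simp add: B_def)
  qed
qed

end
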